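(* Assume the Riemann hypothesis. Fix a constant $C>1/\pi$ and, for large $t$, let $$L(t)=\max_{|u-t|\leqslant C\log\log t}|S(u)|.$$ Then for each fixed $\sigma$ with $1/2<\sigma<1$ there is a constant $c>0$ such that, for all large $t$, $$\zeta(\sigma+it)\ll\exp\Big(c\,\max\big(L(t)^{2-2\sigma},(\log t)^{1-\sigma}\big)(\log\log t)^{1-2\sigma}\Big).$$ Here $c$ and the implied constant may depend on $\sigma$ and $C$ but not on $t$.
   Context: $\zeta$ is the Riemann zeta function. For $t>0$, $N(t)$ is the number of zeros $\rho=\beta+i\gamma$ of $\zeta$ with $0<\beta<1$ and $0<\gamma\leqslant t$, counted with multiplicity. $S(t)=\frac1\pi\Delta\arg\zeta$, where $\Delta\arg$ denotes the change of argument of $\zeta$ along the straight line from $2$ to $2+it$ and then along the straight line from $2+it$ to $\frac12+it$ (if $t$ is the ordinate of a zero, $S(t)=\lim_{\epsilon\to0^+}S(t+\epsilon)$). It is the remainder term in $$N(t)=\frac{t}{2\pi}\log\Big(\frac{t}{2\pi e}\Big)+\frac78+S(t)+O(1/t).$$ The maximum defining $L(t)$ is understood as a supremum. *)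

theory Defs
  imports "HOL-Complex_Analysis.Complex_Analysis"
begin

text \<open>
  The Riemann zeta function is the analytic continuation of its Dirichlet series to the
  complex plane without the point 1; the value at the pole is set to 0 by convention.
  Lemma \<open>ex1_is_zeta\<close> shows that the description is satisfied by exactly one function.
\<close>

definition is_zeta :: "(complex \<Rightarrow> complex) \<Rightarrow> bool" where
  "is_zeta f \<longleftrightarrow> f holomorphic_on (- {1}) \<and>
     (\<forall>s. Re s > 1 \<longrightarrow> (\<lambda>n. 1 / of_nat (Suc n) powr s) sums f s) \<and> f 1 = 0"

definition zeta :: "complex \<Rightarrow> complex" where
  "zeta = (THE f. is_zeta f)"

text \<open>
  Existence of the continuation: expanding \<open>(n + 1) powr (1 - s)\<close> in powers of \<open>n\<close> up to order
  \<open>K\<close> and summing over \<open>n \<ge> 1\<close> expresses \<open>(s - 1) * zeta s\<close> through the values of \<open>zeta\<close> at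
  \<open>s + 1, \<dots>, s + K - 1\<close> and a remainder that is holomorphic for \<open>Re s > 2 - K\<close>.
\<close>

definition zeta_series :: "complex \<Rightarrow> complex" where
  "zeta_series s = (\<Sum>n. 1 / of_nat (Suc n) powr s)"

definition falling :: "complex \<Rightarrow> nat \<Rightarrow> complex" where
  "falling a k = (\<Prod>j<k. a - of_nat j)"

definition zeta_rem :: "nat \<Rightarrow> nat \<Rightarrow> complex \<Rightarrow> complex" where
  "zeta_rem K n s = of_nat (Suc (Suc n)) powr (1 - s) -
     (\<Sum>k\<le>K. falling (1 - s) k * of_nat (Suc n) powr (1 - s - of_nat k) / fact k)"

lemma zeta_rem_bound:
  assumes "Re s + real K \<ge> 2"
  shows "norm (zeta_rem K n s) \<le> norm (falling (1 - s) (Suc K)) * (1 / real (Suc n) ^ 2)"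
proof -
  let ?S = "closed_segment (of_nat (Suc n)) (of_nat (Suc (Suc n))) :: complex set"
  let ?f = "\<lambda>i z. falling (1 - s) i * z powr (1 - s - of_nat i)"
  have seg: "\<exists>r. z = of_real r \<and> r \<ge> real (Suc n)" if "z \<in> ?S" for z
  proof -
    from that obtain u where u: "0 \<le> u" "u \<le> 1" and
      z: "z = (1 - u) *\<^sub>R of_nat (Suc n) + u *\<^sub>R of_nat (Suc (Suc n))"
      by (auto simp: closed_segment_def)
    have "z = of_real (real (Suc n) + u)"
      using z by (simp add: scaleR_conv_of_real algebra_simps)
    thus ?thesis using u by (intro exI[of _ "real (Suc n) + u"]) auto
  qed
  have "norm (?f 0 (of_nat (Suc (Suc n))) -
          (\<Sum>i\<le>K. ?f i (of_nat (Suc n)) * (of_nat (Suc (Suc n)) - of_nat (Suc n)) ^ i / fact i))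
        \<le> (norm (falling (1 - s) (Suc K)) * (1 / real (Suc n) ^ 2)) *
           norm (of_nat (Suc (Suc n)) - of_nat (Suc n) :: complex) ^ Suc K / fact K"
  proof (rule complex_Taylor[where S = ?S and f = ?f])
    fix i z assume z: "z \<in> ?S" and "i \<le> K"
    from seg[OF z] obtain r where r: "z = of_real r" "r \<ge> real (Suc n)" by blast
    have "z \<notin> \<real>\<^sub>\<le>\<^sub>0" using r by (auto simp: complex_nonpos_Reals_iff)
    hence "(?f i has_field_derivative
        falling (1 - s) i * ((1 - s - of_nat i) * z powr (1 - s - of_nat i - 1))) (at z within ?S)"
      by (auto intro!: derivative_eq_intros)
    also have "falling (1 - s) i * ((1 - s - of_nat i) * z powr (1 - s - of_nat i - 1)) = ?f (Suc i) z"
      by (simp add: falling_def algebra_simps)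
    finally show "(?f i has_field_derivative ?f (Suc i) z) (at z within ?S)" .
  next
    fix z assume z: "z \<in> ?S"
    from seg[OF z] obtain r where r: "z = of_real r" "r \<ge> real (Suc n)" by blast
    have "norm (z powr (1 - s - of_nat (Suc K))) = r powr (- Re s - real K)"
      using r by (simp add: norm_powr_real_powr)
    also have "\<dots> \<le> r powr (-2)"
      using r assms by (intro powr_mono) auto
    also have "\<dots> \<le> real (Suc n) powr (-2)"
      using r by (intro powr_mono2') auto
    also have "\<dots> = 1 / real (Suc n) ^ 2"
      by (simp add: powr_minus powr_numeral divide_inverse del: of_nat_Suc)
    finally show "norm (?f (Suc K) z) \<le> norm (falling (1 - s) (Suc K)) * (1 / real (Suc n) ^ 2)"
      unfolding norm_mult by (intro mult_left_mono) auto
  qed auto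
  also have "\<dots> \<le> norm (falling (1 - s) (Suc K)) * (1 / real (Suc n) ^ 2)"
  proof -
    have "(x::real) / fact K \<le> x" if "x \<ge> 0" for x
      using that by (intro divide_le_eq[THEN iffD2]) (auto simp: mult_le_cancel_left1 fact_ge_1)
    from this[of "norm (falling (1 - s) (Suc K)) * (1 / real (Suc n) ^ 2)"] show ?thesis
      by simp
  qed
  finally show ?thesis by (simp add: zeta_rem_def falling_def[of _ 0])
qed

lemma zeta_rem_summable:
  assumes "Re s + real K \<ge> 2"
  shows "summable (\<lambda>n. zeta_rem K n s)"
proof (rule summable_comparison_test')
  show "summable (\<lambda>n. norm (falling (1 - s) (Suc K)) * (1 / real (Suc n) ^ 2))"
    using inverse_power_summable[of 2, where ?'a = real]
    by (intro summable_mult, subst summable_Suc_iff) (auto simp: field_simps)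
  show "norm (zeta_rem K n s) \<le> norm (falling (1 - s) (Suc K)) * (1 / real (Suc n) ^ 2)" if "n \<ge> 0" for n
    using zeta_rem_bound[OF assms] .
qed

lemma zeta_rem_holomorphic: "zeta_rem K n holomorphic_on A"
  unfolding zeta_rem_def falling_def by (intro holomorphic_intros) auto

lemma zeta_rem_suminf_holomorphic:
  "(\<lambda>s. \<Sum>n. zeta_rem K n s) holomorphic_on {s. Re s > 2 - real K}" (is "_ holomorphic_on ?A")
proof (rule holomorphic_uniform_sequence)
  show "open ?A" by (rule open_halfspace_Re_gt)
  show "(\<lambda>s. \<Sum>n<N. zeta_rem K n s) holomorphic_on ?A" for N
    by (intro holomorphic_intros zeta_rem_holomorphic)
  fix x assume x: "x \<in> ?A"
  obtain d where d: "d > 0" "cball x d \<subseteq> ?A"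
    using open_contains_cball open_halfspace_Re_gt x by metis
  have "continuous_on (cball x d) (\<lambda>s. falling (1 - s) (Suc K))"
    unfolding falling_def by (intro continuous_intros)
  hence "compact ((\<lambda>s. falling (1 - s) (Suc K)) ` cball x d)"
    by (intro compact_continuous_image) auto
  hence "bounded ((\<lambda>s. falling (1 - s) (Suc K)) ` cball x d)" by (rule compact_imp_bounded)
  then obtain B where B: "\<And>s. s \<in> cball x d \<Longrightarrow> norm (falling (1 - s) (Suc K)) \<le> B"
    unfolding bounded_iff by blast
  have "uniform_limit (cball x d) (\<lambda>N s. \<Sum>n<N. zeta_rem K n s) (\<lambda>s. \<Sum>n. zeta_rem K n s) sequentially"
  proof (rule Weierstrass_m_test)
    show "summable (\<lambda>n. B * (1 / real (Suc n) ^ 2))"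
      using inverse_power_summable[of 2, where ?'a = real]
      by (intro summable_mult, subst summable_Suc_iff) (auto simp: field_simps)
    fix n s assume s: "s \<in> cball x d"
    hence "Re s + real K \<ge> 2" using d by force
    from zeta_rem_bound[OF this, of n] B[OF s]
    show "norm (zeta_rem K n s) \<le> B * (1 / real (Suc n) ^ 2)"
      by (meson order_trans mult_right_mono zero_le_divide_1_iff zero_le_power of_nat_0_le_iff)
  qed
  with d show "\<exists>d>0. cball x d \<subseteq> ?A \<and>
    uniform_limit (cball x d) (\<lambda>N s. \<Sum>n<N. zeta_rem K n s) (\<lambda>s. \<Sum>n. zeta_rem K n s) sequentially"
    by blast
qed

lemma zeta_series_sums:
  assumes "Re s > 1"
  shows "(\<lambda>n. 1 / of_nat (Suc n) powr s) sums zeta_series s"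
proof -
  have "summable (\<lambda>n. 1 / of_nat (Suc n) powr s)"
  proof (rule summable_comparison_test')
    show "summable (\<lambda>n. real (Suc n) powr (- Re s))"
      using assms by (subst summable_Suc_iff) (simp add: summable_real_powr_iff)
    show "norm (1 / of_nat (Suc n) powr s) \<le> real (Suc n) powr (- Re s)" if "n \<ge> 0" for n
      using norm_powr_real_powr[of "of_nat (Suc n)" s]
      by (simp add: norm_divide norm_inverse powr_minus divide_inverse del: of_nat_Suc)
  qed
  thus ?thesis unfolding zeta_series_def by (rule summable_sums)
qed

lemma zeta_series_rec:
  assumes s: "Re s > 1" and K: "K \<ge> 1"
  shows "(s - 1) * zeta_series s = 1 + (\<Sum>k\<in>{2..K}. falling (1 - s) k / fact k * zeta_series (s + of_nat k - 1)) +
           (\<Sum>n. zeta_rem K n s)"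
proof -
  have lim: "(\<lambda>n. of_nat (Suc n) powr (1 - s)) \<longlonglongrightarrow> (0::complex)"
  proof (rule tendsto_norm_zero_cancel)
    have "(\<lambda>n. real (Suc n) powr (- (Re s - 1))) \<longlonglongrightarrow> 0"
      using s by (intro LIMSEQ_Suc tendsto_neg_powr) (auto intro: filterlim_real_sequentially)
    moreover have "norm (of_nat (Suc n) powr (1 - s)) = real (Suc n) powr (- (Re s - 1))" for n
      using norm_powr_real_powr[of "of_nat (Suc n)" "1 - s"] by (simp del: of_nat_Suc)
    ultimately show "(\<lambda>n. norm (of_nat (Suc n) powr (1 - s))) \<longlonglongrightarrow> 0" by presburger
  qed
  have A: "(\<lambda>n. of_nat (Suc (Suc n)) powr (1 - s) - of_nat (Suc n) powr (1 - s)) sums (-1)"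
    using telescope_sums[OF lim] by simp
  have B: "(\<lambda>n. \<Sum>k\<in>{1..K}. falling (1 - s) k / fact k * (1 / of_nat (Suc n) powr (s + of_nat k - 1))) sums
        (\<Sum>k\<in>{1..K}. falling (1 - s) k / fact k * zeta_series (s + of_nat k - 1))"
    using s by (intro sums_sum sums_mult zeta_series_sums) auto
  have C: "(\<lambda>n. zeta_rem K n s) sums (\<Sum>n. zeta_rem K n s)"
    using s K by (intro summable_sums zeta_rem_summable) auto
  have D: "of_nat (Suc (Suc n)) powr (1 - s) - of_nat (Suc n) powr (1 - s) =
     (\<Sum>k\<in>{1..K}. falling (1 - s) k / fact k * (1 / of_nat (Suc n) powr (s + of_nat k - 1))) + zeta_rem K n s" for n
  proof -
    have K': "{..K} = insert 0 {1..K}" by auto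
    have p: "of_nat (Suc n) powr (1 - s - of_nat k) = 1 / of_nat (Suc n) powr (s + of_nat k - 1)" for k
      using powr_minus_divide[of "of_nat (Suc n)" "s + of_nat k - 1"]
      by (simp add: algebra_simps del: of_nat_Suc)
    have "zeta_rem K n s = of_nat (Suc (Suc n)) powr (1 - s) - (of_nat (Suc n) powr (1 - s) +
            (\<Sum>k\<in>{1..K}. falling (1 - s) k * of_nat (Suc n) powr (1 - s - of_nat k) / fact k))"
      unfolding zeta_rem_def K' by (subst sum.insert) (auto simp: falling_def[of _ 0])
    thus ?thesis unfolding p by (simp add: mult.commute)
  qed
  have "(-1) = (\<Sum>k\<in>{1..K}. falling (1 - s) k / fact k * zeta_series (s + of_nat k - 1)) + (\<Sum>n. zeta_rem K n s)"
    using sums_unique2[OF A] sums_add[OF B C] unfolding D by blast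
  moreover have "{1..K} = insert 1 {2..K}" using K by auto
  ultimately show ?thesis by (simp add: falling_def algebra_simps)
qed

lemma zeta_series_continuation_half:
  "\<exists>F. F holomorphic_on {s. Re s > 1 - real m} \<and> (\<forall>s. Re s > 1 \<longrightarrow> F s = (s - 1) * zeta_series s)"
proof (induction m)
  case 0
  have "(\<lambda>s. 1 + (\<Sum>n. zeta_rem 1 n s)) holomorphic_on {s. Re s > 1 - real 0}"
    using zeta_rem_suminf_holomorphic[of 1] by (intro holomorphic_intros) auto
  thus ?case using zeta_series_rec[of _ 1] by (intro exI conjI) auto
next
  case (Suc m)
  then obtain F where F: "F holomorphic_on {s. Re s > 1 - real m}"
    "\<And>s. Re s > 1 \<Longrightarrow> F s = (s - 1) * zeta_series s" by blast
  define K where "K = m + 2"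
  define G where "G = (\<lambda>s. 1 - (\<Sum>k\<in>{2..K}. falling (1 - s) (k - 1) / fact k * F (s + of_nat k - 1)) +
           (\<Sum>n. zeta_rem K n s))"
  have "G holomorphic_on {s. Re s > 1 - real (Suc m)}"
    unfolding G_def
  proof (intro holomorphic_intros)
    show "(\<lambda>s. \<Sum>n. zeta_rem K n s) holomorphic_on {s. 1 - real (Suc m) < Re s}"
      using zeta_rem_suminf_holomorphic[of K] by (rule holomorphic_on_subset) (auto simp: K_def)
    fix k assume k: "k \<in> {2..K}"
    show "(\<lambda>s. falling (1 - s) (k - 1)) holomorphic_on {s. 1 - real (Suc m) < Re s}"
      unfolding falling_def by (intro holomorphic_intros)
    have "F \<circ> (\<lambda>s. s + of_nat k - 1) holomorphic_on {s. 1 - real (Suc m) < Re s}"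
      by (rule holomorphic_on_compose_gen[OF _ F(1)]) (use k in \<open>auto intro!: holomorphic_intros\<close>)
    thus "(\<lambda>s. F (s + of_nat k - 1)) holomorphic_on {s. 1 - real (Suc m) < Re s}"
      by (simp add: o_def)
  qed auto
  moreover have "G s = (s - 1) * zeta_series s" if s: "Re s > 1" for s
  proof -
    have "falling (1 - s) (k - 1) / fact k * F (s + of_nat k - 1) =
          - (falling (1 - s) k / fact k * zeta_series (s + of_nat k - 1))" if k: "k \<in> {2..K}" for k
    proof -
      obtain j where j: "k = Suc j" using k by (cases k) auto
      have "F (s + of_nat k - 1) = (s + of_nat k - 1 - 1) * zeta_series (s + of_nat k - 1)"
        using k s by (intro F(2)) auto
      also have "s + of_nat k - 1 - 1 = - (1 - s - of_nat j)" by (simp add: j)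
      finally have "falling (1 - s) j * F (s + of_nat k - 1) =
          - ((falling (1 - s) j * (1 - s - of_nat j)) * zeta_series (s + of_nat k - 1))"
        by (simp only:) (simp add: algebra_simps)
      also have "falling (1 - s) j * (1 - s - of_nat j) = falling (1 - s) k" by (simp add: j falling_def)
      finally show ?thesis by (simp add: j)
    qed
    hence "(\<Sum>k\<in>{2..K}. falling (1 - s) (k - 1) / fact k * F (s + of_nat k - 1)) =
           - (\<Sum>k\<in>{2..K}. falling (1 - s) k / fact k * zeta_series (s + of_nat k - 1))"
      by (simp add: sum_negf)
    thus ?thesis using zeta_series_rec[OF s, of K] by (simp add: G_def K_def)
  qed
  ultimately show ?case by blast
qed

lemma zeta_series_continuation: "\<exists>F. F holomorphic_on UNIV \<and> (\<forall>s. Re s > 1 \<longrightarrow> F s = (s - 1) * zeta_series s)"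
proof -
  obtain F where F: "\<And>m. F m holomorphic_on {s. Re s > 1 - real m}"
    "\<And>m s. Re s > 1 \<Longrightarrow> F m s = (s - 1) * zeta_series s"
    using zeta_series_continuation_half by metis
  have eq: "F m s = F n s" if mn: "m \<le> n" and s: "Re s > 1 - real m" for m n s
  proof -
    have "F m s - F n s = 0"
    proof (rule analytic_continuation_open[where s = "{s. Re s > 1}" and s' = "{s. Re s > 1 - real m}"
          and f = "\<lambda>s. F m s - F n s" and g = "\<lambda>_. 0"])
      show "connected {s. 1 - real m < Re s}"
        by (intro convex_connected convex_halfspace_Re_gt)
      show "{s. Re s > 1} \<noteq> {}" by (auto intro: exI[of _ 2])
      show "(\<lambda>s. F m s - F n s) holomorphic_on {s. 1 - real m < Re s}"
        using mn by (intro holomorphic_intros F(1) holomorphic_on_subset[OF F(1)[of n]]) auto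
    qed (use s F(2) in \<open>auto simp: open_halfspace_Re_gt\<close>)
    thus ?thesis by simp
  qed
  define G where "G = (\<lambda>s. F (nat \<lceil>2 - Re s\<rceil>) s)"
  have G: "G s = F m s" if s: "Re s > 1 - real m" for m s
  proof -
    have "Re s > 1 - real (nat \<lceil>2 - Re s\<rceil>)" by linarith
    thus ?thesis using eq[of m "nat \<lceil>2 - Re s\<rceil>" s] eq[of "nat \<lceil>2 - Re s\<rceil>" m s] s
      unfolding G_def by (metis nle_le)
  qed
  have "G holomorphic_on (\<Union>m. {s. Re s > 1 - real m})"
  proof (rule holomorphic_on_UN_open)
    show "G holomorphic_on {s. 1 - real m < Re s}" for m
      using F(1)[of m] by (rule holomorphic_transform) (auto simp: G)
  qed (auto simp: open_halfspace_Re_gt)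
  moreover have "(\<Union>m. {s. Re s > 1 - real m}) = UNIV"
  proof -
    have "\<exists>m. Re s > 1 - real m" for s
      using reals_Archimedean2[of "1 - Re s"] by (auto simp: algebra_simps)
    thus ?thesis by auto
  qed
  moreover have "G s = (s - 1) * zeta_series s" if "Re s > 1" for s
    using G[of 0 s] F(2)[OF that] that by simp
  ultimately show ?thesis by (metis)
qed

lemma ex1_is_zeta: "\<exists>!f. is_zeta f"
proof (rule ex_ex1I)
  obtain F where F: "F holomorphic_on UNIV" "\<And>s. Re s > 1 \<Longrightarrow> F s = (s - 1) * zeta_series s"
    using zeta_series_continuation by blast
  define f where "f = (\<lambda>s. F s / (s - 1))"
  have "f holomorphic_on (- {1})"
    unfolding f_def by (intro holomorphic_intros holomorphic_on_subset[OF F(1)]) auto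
  moreover have "f s = zeta_series s" if "Re s > 1" for s
    using that F(2)[OF that] by (auto simp: f_def)
  ultimately have "is_zeta f"
    using zeta_series_sums unfolding is_zeta_def by (auto simp: f_def)
  thus "\<exists>f. is_zeta f" by blast
next
  fix f g assume fg: "is_zeta f" "is_zeta g"
  show "f = g"
  proof
    fix s show "f s = g s"
    proof (cases "s = 1")
      case False
      show ?thesis
      proof (rule analytic_continuation_open[where s = "{s. Re s > 1}" and s' = "- {1}" and f = f and g = g])
        show "connected (- {1 :: complex})"
          by (intro connected_punctured_universe) auto
        show "{s. Re s > 1} \<noteq> {}" by (auto intro: exI[of _ 2])
        show "f z = g z" if "z \<in> {s. Re s > 1}" for z
          using fg that unfolding is_zeta_def by (blast intro: sums_unique2)
      qed (use fg False in \<open>auto simp: open_halfspace_Re_gt is_zeta_def\<close>)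
    qed (use fg in \<open>auto simp: is_zeta_def\<close>)
  qed
qed

lemma is_zeta_zeta: "is_zeta zeta"
  unfolding zeta_def by (rule theI'[OF ex1_is_zeta])

lemma zeta_holomorphic: "zeta holomorphic_on (- {1})"
  and zeta_sums: "Re s > 1 \<Longrightarrow> (\<lambda>n. 1 / of_nat (Suc n) powr s) sums zeta s"
  using is_zeta_zeta by (auto simp: is_zeta_def)

definition riemann_hypothesis :: bool where
  "riemann_hypothesis \<longleftrightarrow> (\<forall>s. zeta s = 0 \<and> 0 < Re s \<and> Re s < 1 \<longrightarrow> Re s = 1 / 2)"

text \<open>
  The change of argument along a path that avoids 0: the total increment of a continuous branch
  of the argument on the path. It is well defined by lemma \<open>arg_change_unique\<close>.
\<close>

definition arg_change :: "(real \<Rightarrow> complex) \<Rightarrow> real" where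
  "arg_change p = (THE d. \<exists>\<theta>. continuous_on {0..1} \<theta> \<and>
     (\<forall>x\<in>{0..1}. p x = of_real (cmod (p x)) * cis (\<theta> x)) \<and> d = \<theta> 1 - \<theta> 0)"

lemma arg_change_unique:
  assumes "path p" "0 \<notin> path_image p"
  shows "\<exists>!d. \<exists>\<theta>. continuous_on {0..1} \<theta> \<and>
     (\<forall>x\<in>{0..1}. p x = of_real (cmod (p x)) * cis (\<theta> x)) \<and> d = \<theta> 1 - \<theta> 0"
proof (rule ex_ex1I)
  have nz: "p x \<noteq> 0" if "x \<in> {0..1}" for x
    using assms(2) that by (auto simp: path_image_def)
  obtain g where g: "continuous_on {0..1} g" "\<And>x. x \<in> {0..1} \<Longrightarrow> p x = exp (g x)"
    using continuous_logarithm_on_contractible[of "{0..1::real}" p] assms(1) nz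
      convex_imp_contractible[of "{0..1::real}"] by (auto simp: path_def)
  have "p x = of_real (cmod (p x)) * cis (Im (g x))" if "x \<in> {0..1}" for x
    using g(2)[OF that] by (simp add: exp_eq_polar norm_mult)
  moreover have "continuous_on {0..1} (\<lambda>x. Im (g x))"
    using g by (intro continuous_intros)
  ultimately show "\<exists>d \<theta>. continuous_on {0..1} \<theta> \<and>
     (\<forall>x\<in>{0..1}. p x = of_real (cmod (p x)) * cis (\<theta> x)) \<and> d = \<theta> 1 - \<theta> 0" by blast
next
  have nz: "p x \<noteq> 0" if "x \<in> {0..1}" for x
    using assms(2) that by (auto simp: path_image_def)
  fix d e
  assume "\<exists>\<theta>. continuous_on {0..1} \<theta> \<and>
     (\<forall>x\<in>{0..1}. p x = of_real (cmod (p x)) * cis (\<theta> x)) \<and> d = \<theta> 1 - \<theta> 0"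
  then obtain \<theta> where 1: "continuous_on {0..1} \<theta>" 
     "\<And>x. x\<in>{0..1} \<Longrightarrow> p x = of_real (cmod (p x)) * cis (\<theta> x)" "d = \<theta> 1 - \<theta> 0" by blast
  assume "\<exists>\<theta>. continuous_on {0..1} \<theta> \<and>
     (\<forall>x\<in>{0..1}. p x = of_real (cmod (p x)) * cis (\<theta> x)) \<and> e = \<theta> 1 - \<theta> 0"
  then obtain \<phi> where 2: "continuous_on {0..1} \<phi>" 
     "\<And>x. x\<in>{0..1} \<Longrightarrow> p x = of_real (cmod (p x)) * cis (\<phi> x)" "e = \<phi> 1 - \<phi> 0" by blast
  define h where "h = (\<lambda>x. (\<theta> x - \<phi> x) / (2 * pi))"
  have "h x \<in> \<int>" if x: "x \<in> {0..1}" for x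
  proof -
    have "of_real (cmod (p x)) * cis (\<theta> x) = of_real (cmod (p x)) * cis (\<phi> x)"
      using 1(2)[OF x] 2(2)[OF x] by metis
    hence "cis (\<theta> x) = cis (\<phi> x)" using nz[OF x] by simp
    hence "cis (\<theta> x - \<phi> x) = 1" by (simp flip: cis_divide)
    hence "cos (\<theta> x - \<phi> x) = 1" by (simp add: complex_eq_iff)
    then obtain n :: int where "\<theta> x - \<phi> x = of_int n * 2 * pi"
      using cos_one_2pi_int by blast
    thus ?thesis by (simp add: h_def)
  qed
  moreover have "continuous_on {0..1} h"
    unfolding h_def by (intro continuous_intros 1 2) auto
  moreover have "1 \<le> norm (h y - h x)" if "h x \<in> \<int>" "h y \<in> \<int>" "h y \<noteq> h x" for x y
    using Ints_nonzero_abs_ge1[of "h y - h x"] that by auto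
  ultimately have "h constant_on {0..1}"
    by (intro continuous_discrete_range_constant) (auto intro!: exI[of _ 1])
  hence "h 0 = h 1" unfolding constant_on_def by force
  thus "d = e" using 1 2 by (simp add: h_def field_simps)
qed

definition zeta_path :: "real \<Rightarrow> real \<Rightarrow> complex" where
  "zeta_path t = linepath 2 (Complex 2 t) +++ linepath (Complex 2 t) (Complex (1 / 2) t)"

definition zero_ordinate :: "real \<Rightarrow> bool" where
  "zero_ordinate t \<longleftrightarrow> (\<exists>\<beta>. 0 < \<beta> \<and> \<beta> < 1 \<and> zeta (Complex \<beta> t) = 0)"

text \<open>
  Only \<open>t > 0\<close> is meaningful below. The ordinates of the zeros are discrete, so near an ordinate
  the right-hand limit runs only over heights \<open>u\<close> at which the change of argument is defined.
\<close>

definition zeta_S :: "real \<Rightarrow> real" where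
  "zeta_S t = (if zero_ordinate t
     then Lim (at_right t) (\<lambda>u. 1 / pi * arg_change (zeta \<circ> zeta_path u))
     else 1 / pi * arg_change (zeta \<circ> zeta_path t))"

definition zeta_L :: "real \<Rightarrow> real \<Rightarrow> real" where
  "zeta_L C t = (SUP u\<in>{u. \<bar>u - t\<bar> \<le> C * ln (ln t)}. \<bar>zeta_S u\<bar>)"

end

theory Submission
  imports Defs "HOL-Real_Asymp.Real_Asymp"
begin

text \<open>
  Write \<open>x = 2 ^ J\<close> and compare \<open>log \<zeta>\<close> with the logarithm of the Euler product over the primes
  \<open>p \<le> x\<close>.  Chebyshev's bound makes this logarithm \<open>O(x powr (1 - \<sigma>) / log x)\<close> on every line
  \<open>Re s = \<sigma>\<close> with \<open>1/2 \<le> \<sigma> < 1\<close>, and it makes the remaining primes contribute only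
  \<open>O(x powr (-1) / log x)\<close> on the line \<open>Re s = 2\<close>.  Under the Riemann hypothesis the difference \<open>G\<close>
  of the two logarithms is holomorphic to the right of the critical line.  The size of \<open>G\<close> inside the
  strip is estimated by Cauchy's formula on the rectangle with sides on \<open>Re s = 1/2\<close> and
  \<open>Re s = 2\<close> and with height \<open>2 * H\<close> centred at \<open>t\<close>, where \<open>H = C * ln (ln t)\<close>.  The integrand is
  multiplied by \<open>x powr (s - \<sigma> - \<i>t)\<close>, which balances the left and the right side, and by a Gaussian
  \<open>exp ((s - \<sigma> - \<i>t)\<^sup>2)\<close>, which is \<open>O(exp (- H\<^sup>2))\<close> on the horizontal sides.  Since
  \<open>H\<close> is of the order of \<open>ln (ln t)\<close>, this is smaller than every negative power of \<open>ln t\<close>.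

  Three points make this work.  First, the left side must involve only \<open>Im (log \<zeta>)\<close>, which is
  \<open>pi * zeta_S\<close> there, because \<open>log |\<zeta>|\<close> is not controlled by \<open>zeta_L\<close>.  The real part is removed by
  subtracting the complex conjugate of Cauchy's theorem for the reflected kernel, which has no pole
  in the rectangle (lemma \<open>rectangle_estimate\<close>).  Secondly, the only available bound for \<open>log \<zeta>\<close> on
  the horizontal sides, which follows from polynomial growth of \<open>\<zeta>\<close> by the Borel-Caratheodory
  inequality, is \<open>O(ln t / (Re s - 1/2))\<close> and is not integrable up to the critical line; the kernel is
  therefore given zeros at the two left corners.  Thirdly, \<open>log \<zeta>\<close> is singular at the zeros on the
  critical line, but its imaginary part is locally bounded there, so that dominated convergence
  allows the left side to approach the critical line (lemma \<open>log_zeta_minus_euler_log_bound\<close>).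

  The result is
  \<open>log \<zeta>(\<sigma> + \<i>t) = O(x powr (1 - \<sigma>) / log x + L * x powr (1/2 - \<sigma>) + 1)\<close> with \<open>L = zeta_L C t\<close>, as
  long as \<open>x\<close> is at most a fixed power of \<open>ln t\<close>.  With \<open>M = max L (sqrt (ln t))\<close> the choice
  \<open>x = (M * ln (ln t))\<^sup>2\<close> turns the first two terms into
  \<open>M powr (2 - 2 * \<sigma>) * ln (ln t) powr (1 - 2 * \<sigma>)\<close>; the lower bound for \<open>M\<close> ensures that \<open>log x\<close> is
  at least of the order of \<open>ln (ln t)\<close>.  If \<open>M\<close> exceeds a suitable power of \<open>ln t\<close>, the assertion is
  weaker than the polynomial growth of \<open>\<zeta>\<close>.
\<close>

section \<open>Chebyshev's upper bound\<close>

definition dyadic_primes :: "nat \<Rightarrow> nat set" where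
  "dyadic_primes j = {p. prime p \<and> 2 ^ j < p \<and> p \<le> 2 ^ Suc j}"

lemma finite_dyadic_primes [simp]: "finite (dyadic_primes j)"
  by (rule finite_subset[of _ "{..2 ^ Suc j}"]) (auto simp: dyadic_primes_def)

lemma prod_distinct_primes_dvd:
  fixes m :: nat
  assumes "finite A" "\<And>p. p \<in> A \<Longrightarrow> prime p \<and> p dvd m"
  shows "\<Prod>A dvd m"
  using assms
proof (induction A)
  case (insert p A)
  have "coprime p (\<Prod>A)"
    using insert by (intro prod_coprime_right primes_coprime) auto
  moreover have "p dvd m" "\<Prod>A dvd m" using insert by auto
  ultimately show ?case using insert by (simp add: divides_mult)
qed simp

text \<open>
  Every prime in \<open>(n, 2 * n]\<close> divides the binomial coefficient \<open>2 * n choose n\<close>, which is at most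
  \<open>4 ^ n\<close>.  The denominator \<open>j + 1\<close> instead of \<open>j\<close> makes the bound meaningful for the first block.
\<close>

lemma card_dyadic_primes_le: "real (card (dyadic_primes j)) \<le> 4 * 2 ^ j / (real j + 1)"
proof -
  define n :: nat where "n = 2 ^ j"
  let ?c = "card (dyadic_primes j)"
  have n: "n \<ge> 1" by (simp add: n_def)
  have "p dvd (2 * n choose n)" if p: "p \<in> dyadic_primes j" for p
  proof -
    have pr: "prime p" "n < p" "p \<le> 2 * n" using p by (auto simp: dyadic_primes_def n_def)
    have "p dvd fact n * fact (2 * n - n) * (2 * n choose n)"
      using pr by (subst binomial_fact_lemma) (auto simp: prime_dvd_fact_iff)
    thus ?thesis using pr by (auto simp: prime_dvd_mult_iff prime_dvd_fact_iff)
  qed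
  hence "\<Prod>(dyadic_primes j) dvd (2 * n choose n)"
    by (intro prod_distinct_primes_dvd) (auto simp: dyadic_primes_def)
  hence "\<Prod>(dyadic_primes j) \<le> (2 * n choose n)" by (rule dvd_imp_le) auto
  also have "\<dots> \<le> 2 ^ (2 * n)" by (rule binomial_le_pow2)
  finally have "\<Prod>(dyadic_primes j) \<le> 2 ^ (2 * n)" .
  moreover have "(\<Prod>p\<in>dyadic_primes j. n) \<le> \<Prod>(dyadic_primes j)"
    by (intro prod_mono) (auto simp: dyadic_primes_def n_def)
  ultimately have "n ^ ?c \<le> 2 ^ (2 * n)" by simp
  hence "(2::nat) ^ (j * ?c) \<le> 2 ^ (2 * n)" by (simp add: n_def power_mult)
  hence jc: "j * ?c \<le> 2 * n" by simp
  show ?thesis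
  proof (cases "j = 0")
    case True
    have "dyadic_primes 0 \<subseteq> {2}" by (auto simp: dyadic_primes_def)
    hence "card (dyadic_primes 0) \<le> card {2::nat}" by (intro card_mono) auto
    thus ?thesis using True by simp
  next
    case False
    have "(real j + 1) * real ?c \<le> (2 * real j) * real ?c"
      using False by (intro mult_right_mono) auto
    also have "\<dots> \<le> 2 * (2 * real n)"
      using jc by (simp flip: of_nat_mult)
    finally show ?thesis by (simp add: n_def field_simps)
  qed
qed

lemma dyadic_primes_sum_le:
  fixes \<theta> :: real
  assumes "\<theta> \<ge> 0"
  shows "(\<Sum>p\<in>dyadic_primes j. real p powr (- \<theta>)) \<le> 4 * (2 powr (1 - \<theta>)) ^ j / (real j + 1)"
proof -
  have "(\<Sum>p\<in>dyadic_primes j. real p powr (- \<theta>)) \<le> (\<Sum>p\<in>dyadic_primes j. (2 ^ j) powr (- \<theta>))"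
    using assms by (intro sum_mono powr_mono2') (auto simp: dyadic_primes_def simp flip: of_nat_power)
  also have "\<dots> = real (card (dyadic_primes j)) * (2 ^ j) powr (- \<theta>)" by simp
  also have "\<dots> \<le> 4 * 2 ^ j / (real j + 1) * (2 ^ j) powr (- \<theta>)"
    by (intro mult_right_mono card_dyadic_primes_le) auto
  also have "\<dots> = 4 * (2 powr (1 - \<theta>)) ^ j / (real j + 1)"
    by (simp add: powr_powr powr_diff powr_minus divide_simps flip: powr_realpow)
       (simp add: mult.commute)
  finally show ?thesis .
qed

lemma primes_le_two_power: "{p. prime p \<and> p \<le> 2 ^ J} = (\<Union>j<J. dyadic_primes j)"
proof (induction J)
  case 0
  have "\<not> (prime p \<and> p \<le> 1)" for p :: nat
    using prime_gt_1_nat[of p] by auto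
  thus ?case by auto
next
  case (Suc J)
  have "{p. prime p \<and> p \<le> 2 ^ Suc J} = {p. prime p \<and> p \<le> 2 ^ J} \<union> dyadic_primes J"
    by (auto simp: dyadic_primes_def)
  thus ?case unfolding Suc by (auto simp: lessThan_Suc)
qed

lemma disjoint_dyadic_primes: "i \<noteq> j \<Longrightarrow> dyadic_primes i \<inter> dyadic_primes j = {}"
proof (induction i j rule: linorder_wlog)
  case (le i j)
  hence "(2::nat) ^ Suc i \<le> 2 ^ j" by (intro power_increasing) auto
  thus ?case by (force simp: dyadic_primes_def)
qed (auto simp: Int_commute)

text \<open>
  The \<open>j\<close>-th dyadic block contributes at most a constant times \<open>q ^ j / (j + 1)\<close> with
  \<open>q = 2 powr (1 - \<theta>) > 1\<close>.  The term of index \<open>J - i\<close> of the sum of these numbers over \<open>j < J\<close> is smaller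
  than \<open>q ^ J / (J + 1)\<close> by a factor \<open>(i + 1) / q ^ i\<close>, because \<open>(J + 1) / (J - i + 1) \<le> i + 1\<close>, and
  these factors have a finite sum.
\<close>

lemma prime_power_sum_le:
  fixes \<theta> :: real
  assumes "0 \<le> \<theta>" "\<theta> < 1"
  obtains K where "K > 0"
    "\<And>J. (\<Sum>p | prime p \<and> p \<le> 2 ^ J. real p powr (- \<theta>)) \<le> K * (2 ^ J) powr (1 - \<theta>) / (real J + 1)"
proof -
  define q where "q = (2::real) powr (1 - \<theta>)"
  define r where "r = 1 / q"
  have q: "q > 1" using assms by (simp add: q_def)
  have r: "0 < r" "r < 1" using q by (auto simp: r_def)
  have sm: "(\<lambda>n. real (Suc n) * r ^ n) sums (1 / (1 - r)\<^sup>2)"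
    using geometric_deriv_sums[of r] r by auto
  have main: "(\<Sum>p | prime p \<and> p \<le> 2 ^ J. real p powr (- \<theta>)) \<le> 4 / (1 - r)\<^sup>2 * (2 ^ J) powr (1 - \<theta>) / (real J + 1)" for J
  proof -
    have "(\<Sum>p | prime p \<and> p \<le> 2 ^ J. real p powr (- \<theta>)) = (\<Sum>j<J. \<Sum>p\<in>dyadic_primes j. real p powr (- \<theta>))"
      unfolding primes_le_two_power by (rule sum.UNION_disjoint) (auto simp: disjoint_dyadic_primes)
    also have "\<dots> \<le> (\<Sum>j<J. 4 * q ^ J / (real J + 1) * (real (Suc (J - j)) * r ^ (J - j)))"
    proof (rule sum_mono)
      fix j assume j: "j \<in> {..<J}"
      define i where "i = J - j"
      have J: "J = i + j" using j by (simp add: i_def)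
      have "(real J + 1) \<le> (real i + 1) * (real j + 1)" by (simp add: J algebra_simps)
      hence *: "1 / (real j + 1) \<le> (real i + 1) / (real J + 1)" by (simp add: field_simps)
      have "(\<Sum>p\<in>dyadic_primes j. real p powr (- \<theta>)) \<le> 4 * q ^ j * (1 / (real j + 1))"
        using dyadic_primes_sum_le[OF assms(1), of j] by (simp add: q_def)
      also have "\<dots> \<le> 4 * q ^ j * ((real i + 1) / (real J + 1))"
        using q * by (intro mult_left_mono) auto
      also have "q ^ j = q ^ J * r ^ i" using q by (simp add: J power_add r_def field_simps)
      also have "4 * (q ^ J * r ^ i) * ((real i + 1) / (real J + 1)) =
          4 * q ^ J / (real J + 1) * (real (Suc i) * r ^ i)"
        by (simp add: add.commute)
      finally show "(\<Sum>p\<in>dyadic_primes j. real p powr (- \<theta>)) \<le> 4 * q ^ J / (real J + 1) * (real (Suc (J - j)) * r ^ (J - j))"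
        by (simp only: i_def)
    qed
    also have "\<dots> = 4 * q ^ J / (real J + 1) * (\<Sum>j<J. real (Suc (J - j)) * r ^ (J - j))"
      by (rule sum_distrib_left[symmetric])
    also have "(\<Sum>j<J. real (Suc (J - j)) * r ^ (J - j)) = (\<Sum>i\<in>{1..J}. real (Suc i) * r ^ i)"
      by (rule sum.reindex_bij_witness[of _ "\<lambda>i. J - i" "\<lambda>j. J - j"]) auto
    also have "4 * q ^ J / (real J + 1) * (\<Sum>i\<in>{1..J}. real (Suc i) * r ^ i) \<le>
        4 * q ^ J / (real J + 1) * (1 / (1 - r)\<^sup>2)"
    proof (rule mult_left_mono)
      have "(\<Sum>i\<in>{1..J}. real (Suc i) * r ^ i) \<le> (\<Sum>n. real (Suc n) * r ^ n)"
        using sm r by (intro sum_le_suminf) (auto simp: sums_iff)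
      thus "(\<Sum>i\<in>{1..J}. real (Suc i) * r ^ i) \<le> 1 / (1 - r)\<^sup>2" using sm by (simp add: sums_iff)
    qed (use q in auto)
    also have "q ^ J = (2 ^ J) powr (1 - \<theta>)"
      by (simp add: q_def powr_powr mult.commute flip: powr_realpow)
    finally show ?thesis by (simp add: field_simps)
  qed
  show ?thesis
    by (rule that[OF _ main]) (use r in auto)
qed

lemma prime_square_tail_le:
  assumes "finite S" "\<And>p. p \<in> S \<Longrightarrow> prime p \<and> p > 2 ^ J"
  shows "(\<Sum>p\<in>S. real p powr (- 2)) \<le> 8 / (2 ^ J * (real J + 1))"
proof -
  obtain N where N: "\<And>p. p \<in> S \<Longrightarrow> p < N"
    using assms(1) finite_nat_set_iff_bounded by auto
  have sub: "S \<subseteq> (\<Union>j\<in>{J..<N}. dyadic_primes j)"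
  proof
    fix p assume p: "p \<in> S"
    have "p \<in> {p. prime p \<and> p \<le> 2 ^ N}"
    proof -
      have "p < 2 ^ N" using N[OF p] less_exp[of N] by linarith
      thus ?thesis using assms(2)[OF p] by simp
    qed
    then obtain j where j: "j < N" "p \<in> dyadic_primes j" unfolding primes_le_two_power by auto
    have "j \<ge> J"
    proof (rule ccontr)
      assume "\<not> j \<ge> J"
      hence "(2::nat) ^ Suc j \<le> 2 ^ J" by (intro power_increasing) auto
      thus False using j assms(2)[OF p] by (auto simp: dyadic_primes_def)
    qed
    thus "p \<in> (\<Union>j\<in>{J..<N}. dyadic_primes j)" using j by auto
  qed
  have "(\<Sum>p\<in>S. real p powr (- 2)) \<le> (\<Sum>p\<in>(\<Union>j\<in>{J..<N}. dyadic_primes j). real p powr (- 2))"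
    using sub by (intro sum_mono2) auto
  also have "\<dots> = (\<Sum>j\<in>{J..<N}. \<Sum>p\<in>dyadic_primes j. real p powr (- 2))"
    by (rule sum.UNION_disjoint) (auto simp: disjoint_dyadic_primes)
  also have "\<dots> \<le> (\<Sum>j\<in>{J..<N}. 4 / (real J + 1) * (1 / 2) ^ j)"
  proof (rule sum_mono)
    fix j assume j: "j \<in> {J..<N}"
    have "(\<Sum>p\<in>dyadic_primes j. real p powr (- 2)) \<le> 4 * (1 / 2) ^ j / (real j + 1)"
      using dyadic_primes_sum_le[of 2 j] by (simp add: powr_minus)
    also have "\<dots> \<le> 4 * (1 / 2) ^ j / (real J + 1)"
      using j by (intro divide_left_mono) auto
    finally show "(\<Sum>p\<in>dyadic_primes j. real p powr (- 2)) \<le> 4 / (real J + 1) * (1 / 2) ^ j" by simp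
  qed
  also have "\<dots> = 4 / (real J + 1) * (\<Sum>j\<in>{J..<N}. (1 / 2) ^ j)"
    by (rule sum_distrib_left[symmetric])
  also have "4 / (real J + 1) * (\<Sum>j\<in>{J..<N}. (1 / 2 :: real) ^ j) \<le> 4 / (real J + 1) * (2 * (1 / 2) ^ J)"
  proof (rule mult_left_mono, cases "J \<le> N")
    case True
    have "(\<Sum>j\<in>{J..<N}. (1 / 2 :: real) ^ j) = 2 * ((1 / 2) ^ J - (1 / 2) ^ N)"
      using True by (induction N rule: dec_induct) auto
    thus "(\<Sum>j\<in>{J..<N}. (1 / 2 :: real) ^ j) \<le> 2 * (1 / 2) ^ J" by simp
  qed auto
  also have "\<dots> = 8 / (2 ^ J * (real J + 1))" by (simp add: power_one_over field_simps)
  finally show ?thesis .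
qed

section \<open>The Euler product\<close>

text \<open>
  For \<open>Re s > 0\<close> every Euler factor lies in the disc of radius 1 about 1, so that the principal
  logarithms are holomorphic there.
\<close>

definition euler_log :: "nat \<Rightarrow> complex \<Rightarrow> complex" where
  "euler_log N s = (\<Sum>p | prime p \<and> p \<le> N. - Ln (1 - 1 / of_nat p powr s))"

lemma finite_primes_le [simp]: "finite {p::nat. prime p \<and> p \<le> N}"
  by (rule finite_subset[of _ "{..N}"]) auto

lemma norm_inverse_powr: "n > 0 \<Longrightarrow> norm (1 / of_nat n powr s) = real n powr (- Re s)"
  using norm_powr_real_powr[of "of_nat n" s] by (simp add: norm_divide norm_inverse powr_minus divide_inverse)

lemma norm_inverse_prime_powr_lt_1:
  assumes "prime p" "Re s > 0"
  shows "norm (1 / of_nat p powr s) < 1"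
proof -
  have "real p > 1" using prime_gt_1_nat[OF assms(1)] by simp
  thus ?thesis using assms powr_less_mono[of "- Re s" 0 "real p"]
    by (subst norm_inverse_powr) (auto simp: prime_gt_0_nat)
qed

lemma one_minus_nonpos_Reals: "norm (z :: complex) < 1 \<Longrightarrow> 1 - z \<notin> \<real>\<^sub>\<le>\<^sub>0"
  using complex_Re_le_cmod[of z] by (auto simp: complex_nonpos_Reals_iff)

lemma euler_factor_nonpos_Reals:
  assumes "prime p" "Re s > 0"
  shows "1 - 1 / of_nat p powr s \<notin> \<real>\<^sub>\<le>\<^sub>0"
  by (intro one_minus_nonpos_Reals norm_inverse_prime_powr_lt_1 assms)

lemma norm_Ln_one_minus_le:
  assumes "norm z \<le> 3 / 4"
  shows "norm (Ln (1 - z)) \<le> 4 * norm z"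
proof -
  have "norm (Ln (1 + - z)) \<le> norm (Ln (1 + - z) - - z) + norm (- z)"
    using norm_triangle_ineq[of "Ln (1 + - z) - - z" "- z"] by simp
  also have "\<dots> \<le> norm z ^ 2 / (1 - norm z) + norm z"
    using Ln_approx_linear[of "- z"] assms by simp
  also have "\<dots> = norm z / (1 - norm z)"
    using assms by (simp add: divide_simps) (simp add: algebra_simps power2_eq_square)
  also have "\<dots> \<le> norm z / (1 / 4)" using assms by (intro divide_left_mono) auto
  finally show ?thesis by simp
qed

lemma norm_Ln_euler_factor_le:
  assumes "prime p" "Re s \<ge> 1 / 2"
  shows "norm (Ln (1 - 1 / of_nat p powr s)) \<le> 4 * real p powr (- Re s)"
proof -
  have p: "real p \<ge> 2" using prime_ge_2_nat[OF assms(1)] by simp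
  have "real p powr (- Re s) \<le> 2 powr (- Re s)"
    using p assms by (intro powr_mono2') auto
  also have "\<dots> \<le> 2 powr (- (1 / 2))" using assms by (intro powr_mono) auto
  also have "\<dots> \<le> 3 / 4"
  proof (rule power2_le_imp_le)
    have "(2 powr (- (1 / 2)))\<^sup>2 = (2::real) powr (- (1 / 2) + - (1 / 2))"
      unfolding power2_eq_square powr_add[symmetric] ..
    also have "\<dots> = 1 / 2" by (simp add: powr_minus_divide)
    finally show "(2 powr (- (1 / 2)))\<^sup>2 \<le> (3 / 4 :: real)\<^sup>2" by (simp add: power2_eq_square)
  qed auto
  finally have "norm (1 / of_nat p powr s) \<le> 3 / 4"
    using prime_gt_0_nat[OF assms(1)] by (subst norm_inverse_powr)
  from norm_Ln_one_minus_le[OF this] show ?thesis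
    using prime_gt_0_nat[OF assms(1)] by (subst (asm) norm_inverse_powr)
qed

lemma norm_euler_log_le:
  assumes "Re s \<ge> 1 / 2"
  shows "norm (euler_log N s) \<le> 4 * (\<Sum>p | prime p \<and> p \<le> N. real p powr (- Re s))"
proof -
  have "norm (euler_log N s) \<le> (\<Sum>p | prime p \<and> p \<le> N. 4 * real p powr (- Re s))"
    unfolding euler_log_def
    by (intro sum_norm_le) (use norm_Ln_euler_factor_le[OF _ assms] in auto)
  thus ?thesis by (simp add: sum_distrib_left)
qed

lemma euler_log_holomorphic: "euler_log N holomorphic_on {s. Re s > 0}"
  unfolding euler_log_def
proof (intro holomorphic_intros)
  fix p s assume "p \<in> {p::nat. prime p \<and> p \<le> N}" "s \<in> {s. 0 < Re s}"
  thus "1 - 1 / of_nat p powr s \<notin> \<real>\<^sub>\<le>\<^sub>0" "of_nat p powr s \<noteq> (0::complex)"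
    using euler_factor_nonpos_Reals[of p s] prime_gt_0_nat[of p] by auto
qed

lemma exp_euler_log:
  assumes "Re s > 0"
  shows "exp (euler_log N s) * (\<Prod>p | prime p \<and> p \<le> N. 1 - 1 / of_nat p powr s) = 1"
proof -
  have nz: "1 - 1 / of_nat p powr s \<noteq> 0" if "prime p" for p
    using euler_factor_nonpos_Reals[OF that assms] by fastforce
  have "exp (euler_log N s) = (\<Prod>p | prime p \<and> p \<le> N. exp (- Ln (1 - 1 / of_nat p powr s)))"
    unfolding euler_log_def by (rule exp_sum) auto
  also have "\<dots> = (\<Prod>p | prime p \<and> p \<le> N. 1 / (1 - 1 / of_nat p powr s))"
    using nz by (intro prod.cong) (auto simp: exp_minus divide_inverse)
  finally show ?thesis using nz by (simp add: prod_dividef)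
qed

definition rough_numbers :: "nat \<Rightarrow> nat set" where
  "rough_numbers N = {n. n > 0 \<and> (\<forall>p. prime p \<and> p \<le> N \<longrightarrow> \<not> p dvd n)}"

lemma zeta_has_sum:
  assumes "Re s > 1"
  shows "((\<lambda>n. 1 / of_nat n powr s) has_sum zeta s) {0<..}"
    and "(\<lambda>n. real n powr (- Re s)) summable_on {0<..}"
proof -
  have *: "summable (\<lambda>n. real (Suc n) powr (- Re s))"
    using assms by (subst summable_Suc_iff) (simp add: summable_real_powr_iff)
  have inj: "inj Suc" by simp
  have r: "range Suc = {0<..}" by (auto simp: image_iff) presburger
  have "((\<lambda>n. 1 / of_nat (Suc n) powr s) has_sum zeta s) UNIV"
  proof (rule norm_summable_imp_has_sum)
    have "norm (1 / of_nat (Suc n) powr s) = real (Suc n) powr (- Re s)" for n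
      by (rule norm_inverse_powr) simp
    thus "summable (\<lambda>n. norm (1 / of_nat (Suc n) powr s))" using * by presburger
  qed (rule zeta_sums[OF assms])
  thus "((\<lambda>n. 1 / of_nat n powr s) has_sum zeta s) {0<..}"
    using has_sum_reindex[OF inj, of "\<lambda>n. 1 / of_nat n powr s" "zeta s"] unfolding r by (simp add: o_def)
  have "(\<lambda>n. real (Suc n) powr (- Re s)) summable_on UNIV"
    by (rule summable_nonneg_imp_summable_on[OF *]) auto
  thus "(\<lambda>n. real n powr (- Re s)) summable_on {0<..}"
    using summable_on_reindex[OF inj, of "\<lambda>n. real n powr (- Re s)"] unfolding r by (simp add: o_def)
qed

text \<open>
  Multiplying by the Euler factor of a prime \<open>p\<close> sieves out the multiples of \<open>p\<close>.
\<close>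

lemma sieve_has_sum:
  assumes "Re s > 1"
  shows "((\<lambda>n. 1 / of_nat n powr s) has_sum
          ((\<Prod>p | prime p \<and> p \<le> N. 1 - 1 / of_nat p powr s) * zeta s)) (rough_numbers N)"
proof (induction N)
  case 0
  have "{p::nat. prime p \<and> p \<le> 0} = {}" by auto
  moreover have "rough_numbers 0 = {0<..}" by (auto simp: rough_numbers_def)
  ultimately show ?case using zeta_has_sum(1)[OF assms] by (simp only:) simp
next
  case (Suc N)
  show ?case
  proof (cases "prime (Suc N)")
    case False
    have "{p. prime p \<and> p \<le> Suc N} = {p. prime p \<and> p \<le> N}"
      using False by (auto simp: le_Suc_eq)
    moreover have "rough_numbers (Suc N) = rough_numbers N"
      using False by (auto simp: rough_numbers_def le_Suc_eq)
    ultimately show ?thesis using Suc by simp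
  next
    case True
    define q where "q = Suc N"
    define c where "c = (\<Prod>p | prime p \<and> p \<le> N. 1 - 1 / of_nat p powr s) * zeta s"
    have q: "prime q" using True by (simp add: q_def)
    hence q0: "q > 0" by (rule prime_gt_0_nat)
    have inj: "inj_on ((*) q) (rough_numbers N)" using q0 by (auto intro: inj_onI)
    have "((\<lambda>n. 1 / of_nat q powr s * (1 / of_nat n powr s)) has_sum (1 / of_nat q powr s * c)) (rough_numbers N)"
      using Suc unfolding c_def by (rule has_sum_cmult_right)
    moreover have "1 / of_nat q powr s * (1 / of_nat n powr s) = 1 / of_nat (q * n) powr s" for n
      by (simp add: powr_times_real)
    ultimately have A: "((\<lambda>n. 1 / of_nat n powr s) has_sum (1 / of_nat q powr s * c)) ((*) q ` rough_numbers N)"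
      by (subst has_sum_reindex[OF inj]) (simp add: o_def)
    have sub: "(*) q ` rough_numbers N \<subseteq> rough_numbers N"
    proof
      fix m assume "m \<in> (*) q ` rough_numbers N"
      then obtain n where n: "m = q * n" "n \<in> rough_numbers N" by blast
      have "\<not> p dvd q" if "prime p" "p \<le> N" for p
        using primes_dvd_imp_eq[OF that(1) q] that(2) by (auto simp: q_def)
      thus "m \<in> rough_numbers N"
        using n q0 by (auto simp: rough_numbers_def prime_dvd_mult_iff)
    qed
    have eq: "rough_numbers (Suc N) = rough_numbers N - (*) q ` rough_numbers N"
    proof (intro equalityI subsetI)
      fix n assume "n \<in> rough_numbers N - (*) q ` rough_numbers N"
      hence n: "n \<in> rough_numbers N" "n \<notin> (*) q ` rough_numbers N" by auto
      have "\<not> q dvd n"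
      proof
        assume "q dvd n"
        then obtain m where m: "n = q * m" by (elim dvdE)
        hence "m \<in> rough_numbers N" using n(1) by (auto simp: rough_numbers_def)
        thus False using n(2) m by blast
      qed
      thus "n \<in> rough_numbers (Suc N)"
        using n(1) by (auto simp: rough_numbers_def le_Suc_eq q_def)
    next
      fix n assume n: "n \<in> rough_numbers (Suc N)"
      hence "\<not> q dvd n" using q by (auto simp: rough_numbers_def q_def)
      thus "n \<in> rough_numbers N - (*) q ` rough_numbers N" using n by (auto simp: rough_numbers_def)
    qed
    have "((\<lambda>n. 1 / of_nat n powr s) has_sum (c - 1 / of_nat q powr s * c)) (rough_numbers (Suc N))"
      unfolding eq using Suc A sub unfolding c_def by (intro has_sum_Diff)
    moreover have "{p. prime p \<and> p \<le> Suc N} = insert q {p. prime p \<and> p \<le> N}"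
      using q by (auto simp: q_def le_Suc_eq)
    hence "(\<Prod>p | prime p \<and> p \<le> Suc N. 1 - 1 / of_nat p powr s) * zeta s = c - 1 / of_nat q powr s * c"
      by (simp add: c_def q_def algebra_simps)
    ultimately show ?thesis by simp
  qed
qed

text \<open>
  After sieving by the primes up to \<open>N\<close> only the term 1 and terms with \<open>n > N\<close> are left.
\<close>

lemma exp_euler_log_tendsto:
  assumes s: "Re s > 1"
  shows "(\<lambda>N. exp (euler_log N s)) \<longlonglongrightarrow> zeta s" and "zeta s \<noteq> 0"
proof -
  let ?f = "\<lambda>n. 1 / of_nat n powr s :: complex" and ?g = "\<lambda>n::nat. real n powr (- Re s)"
  define E where "E = (\<lambda>N. \<Prod>p | prime p \<and> p \<le> N. 1 - 1 / of_nat p powr s)"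
  have gs: "?g summable_on {0<..}" using zeta_has_sum(2)[OF s] .
  have bound: "norm (E N * zeta s - 1) \<le> infsum ?g {0<..} - sum ?g {1..N}" if N: "N \<ge> 1" for N
  proof -
    have one: "1 \<in> rough_numbers N" by (auto simp: rough_numbers_def)
    have "(?f has_sum (E N * zeta s - ?f 1)) (rough_numbers N - {1})"
      using sieve_has_sum[OF s, of N] one
      by (intro has_sum_Diff) (auto simp: E_def has_sum_finite_iff)
    hence 1: "(?f has_sum (E N * zeta s - 1)) (rough_numbers N - {1})" by simp
    have sub: "rough_numbers N - {1} \<subseteq> {0<..} - {1..N}"
    proof
      fix n assume n: "n \<in> rough_numbers N - {1}"
      then obtain p where "prime p" "p dvd n" using prime_factor_nat[of n] by auto
      moreover from this have "p \<le> n" using n by (auto simp: rough_numbers_def intro: dvd_imp_le)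
      ultimately show "n \<in> {0<..} - {1..N}" using n by (force simp: rough_numbers_def)
    qed
    have "(?g has_sum (infsum ?g {0<..} - sum ?g {1..N})) ({0<..} - {1..N})"
      using gs by (intro has_sum_Diff) (auto simp: has_sum_finite_iff)
    hence 2: "?g summable_on ({0<..} - {1..N})" "infsum ?g ({0<..} - {1..N}) = infsum ?g {0<..} - sum ?g {1..N}"
      by (auto simp: has_sum_iff)
    have 3: "?g summable_on (rough_numbers N - {1})"
      using summable_on_subset_banach[OF 2(1) sub] .
    have 4: "((\<lambda>n. norm (?f n)) has_sum infsum ?g (rough_numbers N - {1})) (rough_numbers N - {1})"
      using has_sum_infsum[OF 3]
      by (rule has_sum_cong[THEN iffD1, rotated]) (auto simp: rough_numbers_def norm_inverse_powr)
    have "norm (E N * zeta s - 1) \<le> infsum ?g (rough_numbers N - {1})"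
      by (rule norm_has_sum_bound[OF 4 1])
    also have "\<dots> \<le> infsum ?g ({0<..} - {1..N})"
      using 3 2(1) sub by (intro infsum_mono_neutral) auto
    finally show ?thesis using 2(2) by simp
  qed
  have "(\<lambda>N. sum ?g {1..N}) \<longlonglongrightarrow> infsum ?g {0<..}"
  proof -
    have "(?g has_sum infsum ?g {0<..}) {0<..}" using gs by simp
    hence "(?g has_sum infsum ?g {0<..}) UNIV"
      by (rule has_sum_cong_neutral[THEN iffD1, rotated -1]) auto
    hence "?g sums infsum ?g {0<..}" by (rule has_sum_imp_sums)
    hence "(\<lambda>N. sum ?g {..N}) \<longlonglongrightarrow> infsum ?g {0<..}" by (simp add: sums_def_le)
    moreover have "sum ?g {..N} = sum ?g {1..N}" for N
      by (rule sum.mono_neutral_right) (auto simp: not_le)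
    ultimately show ?thesis by simp
  qed
  hence "(\<lambda>N. infsum ?g {0<..} - sum ?g {1..N}) \<longlonglongrightarrow> infsum ?g {0<..} - infsum ?g {0<..}"
    by (intro tendsto_intros)
  hence "(\<lambda>N. infsum ?g {0<..} - sum ?g {1..N}) \<longlonglongrightarrow> 0" by simp
  hence "(\<lambda>N. E N * zeta s - 1) \<longlonglongrightarrow> 0"
    by (rule Lim_null_comparison[rotated]) (use bound in \<open>auto intro!: eventually_sequentiallyI[of 1]\<close>)
  hence lim: "(\<lambda>N. E N * zeta s) \<longlonglongrightarrow> 1" by (simp add: LIM_zero_iff)
  have ee: "exp (euler_log N s) * E N = 1" for N
    unfolding E_def using exp_euler_log[of s N] s by simp
  show z: "zeta s \<noteq> 0"
  proof
    assume "zeta s = 0"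
    thus False using lim LIMSEQ_unique[of "\<lambda>_. 0::complex" 0 1] by simp
  qed
  have "(\<lambda>N. zeta s / (E N * zeta s)) \<longlonglongrightarrow> zeta s / 1"
    by (intro tendsto_intros lim) auto
  moreover have "zeta s / (E N * zeta s) = exp (euler_log N s)" for N
  proof -
    have "E N \<noteq> 0" using ee[of N] by auto
    thus ?thesis using ee[of N] z by (simp add: field_simps)
  qed
  ultimately show "(\<lambda>N. exp (euler_log N s)) \<longlonglongrightarrow> zeta s" by simp
qed

section \<open>Growth and zero-free region\<close>

lemma norm_zeta_le_Re_gt:
  assumes "Re s \<ge> 3 / 2"
  shows "norm (zeta s) \<le> (\<Sum>n. real (Suc n) powr (- (3 / 2)))"
proof -
  have sm: "summable (\<lambda>n. real (Suc n) powr (- (3 / 2)))"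
    by (subst summable_Suc_iff) (simp add: summable_real_powr_iff)
  have le: "norm (1 / of_nat (Suc n) powr s) \<le> real (Suc n) powr (- (3 / 2))" for n
    using assms by (subst norm_inverse_powr) (auto intro!: powr_mono)
  have "zeta s = (\<Sum>n. 1 / of_nat (Suc n) powr s)"
    using zeta_sums[of s] assms by (simp add: sums_iff)
  also have "norm \<dots> \<le> (\<Sum>n. real (Suc n) powr (- (3 / 2)))"
    by (rule norm_suminf_le[OF le sm])
  finally show ?thesis .
qed

text \<open>
  This recurrence connects \<open>\<zeta>\<close> in the half plane \<open>Re s > 0\<close> with absolutely convergent series, which
  yields polynomial growth.
\<close>

lemma zeta_recurrence:
  assumes "Re s > 0" "s \<noteq> 1"
  shows "(s - 1) * zeta s = 1 + falling (1 - s) 2 / 2 * zeta (s + 1) + (\<Sum>n. zeta_rem 2 n s)"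
proof (rule analytic_continuation_open[where s = "{s. Re s > 1}" and s' = "{s. Re s > 0} - {1}"
      and f = "\<lambda>s. (s - 1) * zeta s" and g = "\<lambda>s. 1 + falling (1 - s) 2 / 2 * zeta (s + 1) + (\<Sum>n. zeta_rem 2 n s)"])
  show "open ({s. 0 < Re s} - {1})" by (intro open_Diff open_halfspace_Re_gt) auto
  show "connected ({s::complex. 0 < Re s} - {1})"
    by (rule connected_open_delete) (auto intro: convex_connected convex_halfspace_Re_gt open_halfspace_Re_gt)
  show "{s. 1 < Re s} \<noteq> {}" by (auto intro: exI[of _ 2])
  show "(\<lambda>s. (s - 1) * zeta s) holomorphic_on {s. 0 < Re s} - {1}"
    by (intro holomorphic_intros holomorphic_on_subset[OF zeta_holomorphic]) auto
  have "zeta \<circ> (\<lambda>s. s + 1) holomorphic_on {s. 0 < Re s} - {1}"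
    by (rule holomorphic_on_compose_gen[OF _ zeta_holomorphic]) (auto intro!: holomorphic_intros)
  thus "(\<lambda>s. 1 + falling (1 - s) 2 / 2 * zeta (s + 1) + (\<Sum>n. zeta_rem 2 n s)) holomorphic_on {s. 0 < Re s} - {1}"
    unfolding falling_def o_def
    by (intro holomorphic_intros holomorphic_on_subset[OF zeta_rem_suminf_holomorphic]) auto
  fix s :: complex assume "s \<in> {s. 1 < Re s}"
  hence s: "Re s > 1" by simp
  have *: "zeta z = zeta_series z" if "Re z > 1" for z
    using zeta_sums[OF that] zeta_series_sums[OF that] sums_unique2 by blast
  have "{2..2::nat} = {2}" by auto
  thus "(s - 1) * zeta s = 1 + falling (1 - s) 2 / 2 * zeta (s + 1) + (\<Sum>n. zeta_rem 2 n s)"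
    using zeta_series_rec[OF s, of 2] s by (simp add: * fact_numeral add.commute)
qed (use assms in \<open>auto simp: open_halfspace_Re_gt\<close>)

lemma zeta_growth:
  obtains K where "K \<ge> 1" "\<And>s. 1 / 2 \<le> Re s \<Longrightarrow> Re s \<le> 4 \<Longrightarrow> Im s \<ge> 1 \<Longrightarrow> norm (zeta s) \<le> K * (Im s)\<^sup>2"
proof -
  define Z where "Z = (\<Sum>n. real (Suc n) powr (- (3 / 2)))"
  define Q where "Q = (\<Sum>n. 1 / real (Suc n) ^ 2)"
  have sQ: "summable (\<lambda>n. 1 / real (Suc n) ^ 2)"
    using inverse_power_summable[of 2, where ?'a = real]
    by (subst summable_Suc_iff) (auto simp: field_simps)
  have Q0: "Q \<ge> 0" unfolding Q_def by (intro suminf_nonneg sQ) auto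
  have Z0: "Z \<ge> 0"
    using norm_zeta_le_Re_gt[of 2] norm_ge_zero[of "zeta 2"] unfolding Z_def by (simp add: order_trans[OF norm_ge_zero])
  have main: "norm (zeta s) \<le> (1 + 5 * Z + 30 * Q) * (Im s)\<^sup>2"
    if s: "1 / 2 \<le> Re s" "Re s \<le> 4" "Im s \<ge> 1" for s
  proof -
    define y where "y = Im s"
    have y: "y \<ge> 1" using s by (simp add: y_def)
    have s1: "s \<noteq> 1" using s by auto
    have n1: "norm (s - 1) \<ge> 1" using abs_Im_le_cmod[of "s - 1"] s by simp
    have ns: "norm s \<le> 5 * y" using cmod_le[of s] s by (simp add: y_def)
    have ns': "norm (s + 1) \<le> 6 * y" using cmod_le[of "s + 1"] s by (simp add: y_def)
    have f2: "falling (1 - s) 2 = (s - 1) * s"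
      by (simp add: falling_def numeral_2_eq_2 algebra_simps)
    have f3: "falling (1 - s) (Suc 2) = - (s - 1) * s * (s + 1)"
      by (simp add: falling_def numeral_2_eq_2 algebra_simps)
    have "norm (\<Sum>n. zeta_rem 2 n s) \<le> (\<Sum>n. norm (falling (1 - s) (Suc 2)) * (1 / real (Suc n) ^ 2))"
      using s sQ by (intro norm_suminf_le zeta_rem_bound summable_mult) auto
    also have "\<dots> = norm (s - 1) * (norm s * norm (s + 1) * Q)"
      unfolding Q_def f3 using sQ by (subst suminf_mult) (auto simp: norm_mult norm_minus_commute)
    finally have r: "norm (\<Sum>n. zeta_rem 2 n s) \<le> norm (s - 1) * (norm s * norm (s + 1) * Q)" .
    have "norm (s - 1) * norm (zeta s) = norm (1 + (s - 1) * s / 2 * zeta (s + 1) + (\<Sum>n. zeta_rem 2 n s))"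
      using zeta_recurrence[of s] s s1 by (simp add: f2 flip: norm_mult)
    also have "\<dots> \<le> 1 + norm ((s - 1) * s / 2 * zeta (s + 1)) + norm (\<Sum>n. zeta_rem 2 n s)"
      by (intro norm_triangle_le add_mono order_refl) auto
    also have "\<dots> \<le> norm (s - 1) * 1 + norm (s - 1) * (norm s * norm (zeta (s + 1))) + norm (s - 1) * (norm s * norm (s + 1) * Q)"
      using r n1 by (intro add_mono) (auto simp: norm_mult norm_divide)
    also have "\<dots> = norm (s - 1) * (1 + norm s * norm (zeta (s + 1)) + norm s * norm (s + 1) * Q)"
      by (simp add: algebra_simps)
    finally have "norm (zeta s) \<le> 1 + norm s * norm (zeta (s + 1)) + norm s * norm (s + 1) * Q"
      using n1 by (subst (asm) mult_le_cancel_left_pos) auto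
    also have "\<dots> \<le> 1 + 5 * y * Z + 5 * y * (6 * y) * Q"
      using s ns ns' y Q0 Z0 norm_zeta_le_Re_gt[of "s + 1"] unfolding Z_def[symmetric]
      by (intro add_mono mult_mono order_refl) auto
    also have "\<dots> \<le> y\<^sup>2 + 5 * y\<^sup>2 * Z + 30 * y\<^sup>2 * Q"
    proof -
      have "1 \<le> y\<^sup>2" "y \<le> y\<^sup>2" using y mult_mono[of 1 y 1 y] by (auto simp: power2_eq_square)
      thus ?thesis using Z0 Q0 by (intro add_mono mult_right_mono) (auto simp: power2_eq_square)
    qed
    finally show ?thesis by (simp add: y_def algebra_simps)
  qed
  show ?thesis by (rule that[OF _ main]) (use Z0 Q0 in auto)
qed

text \<open>
  Termwise in \<open>-Ln (1 - z) = \<Sum>n. z ^ n / n\<close>, this is \<open>3 + 4 * cos \<theta> + cos (2 * \<theta>) \<ge> 0\<close>.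
\<close>

lemma Re_Ln_341_nonneg:
  assumes r: "0 \<le> r" "r < 1"
  shows "3 * Re (- Ln (1 - of_real r)) + 4 * Re (- Ln (1 - of_real r * cis \<phi>)) + Re (- Ln (1 - of_real r * cis (2 * \<phi>))) \<ge> 0"
proof -
  have ser: "(\<lambda>n. r ^ n / real n * cos (real n * \<psi>)) sums Re (- Ln (1 - of_real r * cis \<psi>))" for \<psi>
  proof -
    have "norm (- (of_real r * cis \<psi>)) < 1" using r by (simp add: norm_mult)
    from sums_minus[OF sums_Re[OF Ln_series'[OF this]]]
    have "(\<lambda>n. - Re (- ((- (- (of_real r * cis \<psi>))) ^ n) / of_nat n)) sums Re (- Ln (1 - of_real r * cis \<psi>))"
      by simp
    moreover have "- Re (- ((- (- (of_real r * cis \<psi>))) ^ n) / of_nat n) = r ^ n / real n * cos (real n * \<psi>)" for n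
    proof -
      have "(of_real r * cis \<psi>) ^ n = of_real (r ^ n) * cis (real n * \<psi>)"
        by (simp add: power_mult_distrib Complex.DeMoivre)
      moreover have "Re (of_real x * cis y / of_nat n) = x / real n * cos y" for x y
        by (simp add: Re_divide_of_nat)
      ultimately show ?thesis by simp
    qed
    ultimately show ?thesis by (simp only:)
  qed
  have "(\<lambda>n. 3 * (r ^ n / real n * cos (real n * 0)) + 4 * (r ^ n / real n * cos (real n * \<phi>)) + r ^ n / real n * cos (real n * (2 * \<phi>)))
    sums (3 * Re (- Ln (1 - of_real r * cis 0)) + 4 * Re (- Ln (1 - of_real r * cis \<phi>)) + Re (- Ln (1 - of_real r * cis (2 * \<phi>))))"
    by (intro sums_add sums_mult ser)
  moreover have "3 * (r ^ n / real n * cos (real n * 0)) + 4 * (r ^ n / real n * cos (real n * \<phi>)) + r ^ n / real n * cos (real n * (2 * \<phi>)) \<ge> 0" for n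
  proof -
    define c where "c = cos (real n * \<phi>)"
    have "cos (real n * (2 * \<phi>)) = 2 * c\<^sup>2 - 1"
      using cos_double_cos[of "real n * \<phi>"] by (simp add: c_def mult_ac)
    moreover have "3 * (R * 1) + 4 * (R * c) + R * (2 * c\<^sup>2 - 1) = R * (2 * (1 + c)\<^sup>2)" for R
      by (simp add: power2_eq_square algebra_simps)
    ultimately have "3 * (r ^ n / real n * cos (real n * 0)) + 4 * (r ^ n / real n * cos (real n * \<phi>)) + r ^ n / real n * cos (real n * (2 * \<phi>))
      = r ^ n / real n * (2 * (1 + c)\<^sup>2)"
      by (simp only: c_def[symmetric] mult_zero_right cos_zero)
    thus ?thesis using r by simp
  qed
  ultimately have "3 * Re (- Ln (1 - of_real r * cis 0)) + 4 * Re (- Ln (1 - of_real r * cis \<phi>)) + Re (- Ln (1 - of_real r * cis (2 * \<phi>))) \<ge> 0"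
    by (metis (no_types, lifting) suminf_nonneg sums_iff)
  thus ?thesis by simp
qed

lemma zeta_341:
  assumes "x > 1"
  shows "norm (zeta (of_real x)) ^ 3 * norm (zeta (Complex x u)) ^ 4 * norm (zeta (Complex x (2 * u))) \<ge> 1"
proof (rule LIMSEQ_le_const)
  let ?e = "\<lambda>N y. exp (euler_log N (Complex x y))"
  show "(\<lambda>N. norm (?e N 0) ^ 3 * norm (?e N u) ^ 4 * norm (?e N (2 * u))) \<longlonglongrightarrow>
     norm (zeta (of_real x)) ^ 3 * norm (zeta (Complex x u)) ^ 4 * norm (zeta (Complex x (2 * u)))"
    unfolding complex_of_real_def using assms by (intro tendsto_intros exp_euler_log_tendsto) auto
  have "1 \<le> norm (?e N 0) ^ 3 * norm (?e N u) ^ 4 * norm (?e N (2 * u))" for N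
  proof -
    have pw: "1 / of_nat p powr Complex x y = of_real (real p powr (- x)) * cis (- y * ln (real p))" if "p > 0" for p y
    proof -
      have "of_nat p powr Complex x y = exp (Complex x y * of_real (ln (real p)))"
        using that by (simp add: powr_def Ln_of_nat)
      hence "1 / of_nat p powr Complex x y = exp (- (Complex x y * of_real (ln (real p))))"
        by (simp only: exp_minus inverse_eq_divide)
      also have "- (Complex x y * of_real (ln (real p))) = Complex (- x * ln (real p)) (- y * ln (real p))"
        by (simp add: complex_eq_iff)
      also have "exp \<dots> = of_real (exp (- x * ln (real p))) * cis (- y * ln (real p))"
        by (subst exp_eq_polar) (simp only: complex.sel)
      also have "exp (- x * ln (real p)) = real p powr (- x)"
        using that by (simp only: powr_def) simp
      finally show ?thesis .
    qed
    have "0 \<le> (\<Sum>p | prime p \<and> p \<le> N. 3 * Re (- Ln (1 - 1 / of_nat p powr Complex x 0)) +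
       4 * Re (- Ln (1 - 1 / of_nat p powr Complex x u)) + Re (- Ln (1 - 1 / of_nat p powr Complex x (2 * u))))"
    proof (rule sum_nonneg)
      fix p assume "p \<in> {p. prime p \<and> p \<le> N}"
      hence p: "prime p" by simp
      have r: "0 \<le> real p powr (- x)" by simp
      have r': "real p powr (- x) < 1"
        using norm_inverse_prime_powr_lt_1[OF p, of "of_real x"] assms
          norm_inverse_powr[OF prime_gt_0_nat[OF p], of "of_real x"] by simp
      show "0 \<le> 3 * Re (- Ln (1 - 1 / of_nat p powr Complex x 0)) +
       4 * Re (- Ln (1 - 1 / of_nat p powr Complex x u)) + Re (- Ln (1 - 1 / of_nat p powr Complex x (2 * u)))"
        using Re_Ln_341_nonneg[OF r r', of "- u * ln (real p)"]
        unfolding pw[OF prime_gt_0_nat[OF p]] by (simp add: mult_ac)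
    qed
    also have "\<dots> = 3 * Re (euler_log N (Complex x 0)) + 4 * Re (euler_log N (Complex x u)) + Re (euler_log N (Complex x (2 * u)))"
      unfolding euler_log_def by (simp only: Re_sum sum.distrib sum_distrib_left)
    finally have "1 \<le> exp (3 * Re (euler_log N (Complex x 0)) + 4 * Re (euler_log N (Complex x u)) + Re (euler_log N (Complex x (2 * u))))"
      by simp
    also have "\<dots> = norm (?e N 0) ^ 3 * norm (?e N u) ^ 4 * norm (?e N (2 * u))"
    proof -
      have "exp (3 * a) = exp a ^ 3" "exp (4 * a) = exp a ^ 4" for a :: real
        using exp_of_nat_mult[of 3 a] exp_of_nat_mult[of 4 a] by simp_all
      thus ?thesis by (simp only: exp_add norm_exp_eq_Re)
    qed
    finally show ?thesis .
  qed
  thus "\<exists>N. \<forall>n\<ge>N. 1 \<le> norm (?e n 0) ^ 3 * norm (?e n u) ^ 4 * norm (?e n (2 * u))" by blast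
qed

text \<open>
  A zero at \<open>1 + iu\<close> would make the product of \<open>zeta_341\<close> tend to 0 as \<open>x\<close> decreases to 1, because
  the fourth power of the zero outweighs the third power of the pole.
\<close>

lemma zeta_nonzero_Re_eq_1:
  assumes u: "u \<noteq> 0"
  shows "zeta (Complex 1 u) \<noteq> 0"
proof
  assume z: "zeta (Complex 1 u) = 0"
  obtain F where F: "F holomorphic_on UNIV" "\<And>s. Re s > 1 \<Longrightarrow> F s = (s - 1) * zeta_series s"
    using zeta_series_continuation by blast
  have Fz: "F s = (s - 1) * zeta s" if "Re s > 1" for s
    using F(2)[OF that] zeta_sums[OF that] zeta_series_sums[OF that] sums_unique2 by metis
  have cont: "isCont zeta s" if "s \<noteq> 1" for s
    by (rule field_differentiable_imp_continuous_at,
        rule holomorphic_on_imp_differentiable_at[OF zeta_holomorphic]) (use that in auto)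
  define D where "D = deriv zeta (Complex 1 u)"
  have "(zeta has_field_derivative D) (at (Complex 1 u))"
    unfolding D_def using u by (intro holomorphic_derivI[OF zeta_holomorphic]) (auto simp: complex_eq_iff)
  hence der: "((\<lambda>h. (zeta (Complex 1 u + h) - zeta (Complex 1 u)) / h) \<longlongrightarrow> D) (at 0)"
    by (simp add: DERIV_def)
  have h0: "filterlim (\<lambda>x. complex_of_real (x - 1)) (at 0) (at_right 1)"
  proof (rule filterlim_atI)
    have "((\<lambda>x. complex_of_real (x - 1)) \<longlongrightarrow> complex_of_real (1 - 1)) (at_right 1)"
      by (intro tendsto_intros)
    thus "((\<lambda>x. complex_of_real (x - 1)) \<longlongrightarrow> 0) (at_right 1)" by simp
    show "\<forall>\<^sub>F x in at_right 1. complex_of_real (x - 1) \<noteq> 0"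
      unfolding eventually_at_filter by (auto simp: complex_eq_iff)
  qed
  have l2: "((\<lambda>x. zeta (Complex x u) / of_real (x - 1)) \<longlongrightarrow> D) (at_right 1)"
  proof -
    have "Complex 1 u + of_real (x - 1) = Complex x u" for x by (simp add: complex_eq_iff)
    thus ?thesis using filterlim_compose[OF der h0] z by simp
  qed
  have l1: "((\<lambda>x. F (of_real x)) \<longlongrightarrow> F (of_real 1)) (at_right 1)"
  proof -
    have "isCont F (of_real 1)"
      using holomorphic_on_imp_continuous_on[OF F(1)] continuous_on_interior by fastforce
    thus ?thesis by (rule isCont_tendsto_compose) (intro tendsto_intros)
  qed
  have l3: "((\<lambda>x. zeta (Complex x (2 * u))) \<longlongrightarrow> zeta (Complex 1 (2 * u))) (at_right 1)"
    using u by (intro isCont_tendsto_compose[OF cont] tendsto_intros) (auto simp: complex_eq_iff)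
  have "((\<lambda>x. norm (F (of_real x)) ^ 3 * norm (zeta (Complex x u) / of_real (x - 1)) ^ 4 *
            norm (zeta (Complex x (2 * u))) * (x - 1)) \<longlongrightarrow>
         norm (F (of_real 1)) ^ 3 * norm D ^ 4 * norm (zeta (Complex 1 (2 * u))) * (1 - 1)) (at_right 1)"
    by (intro tendsto_intros l1 l2 l3)
  moreover have "\<forall>\<^sub>F x in at_right 1. 1 \<le> norm (F (of_real x)) ^ 3 * norm (zeta (Complex x u) / of_real (x - 1)) ^ 4 *
            norm (zeta (Complex x (2 * u))) * (x - 1)"
    unfolding eventually_at_filter
  proof (intro always_eventually allI impI)
    fix x :: real assume "x \<noteq> 1" "x \<in> {1<..}"
    hence x: "x > 1" by simp
    have "norm (F (of_real x)) ^ 3 * norm (zeta (Complex x u) / of_real (x - 1)) ^ 4 *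
            norm (zeta (Complex x (2 * u))) * (x - 1) =
          norm (zeta (of_real x)) ^ 3 * norm (zeta (Complex x u)) ^ 4 * norm (zeta (Complex x (2 * u)))"
    proof -
      have "norm (complex_of_real x - 1) = x - 1"
        using x by (metis abs_of_pos diff_gt_0_iff_gt norm_of_real of_real_1 of_real_diff)
      moreover have "norm (complex_of_real (x - 1)) = x - 1" using x by (subst norm_of_real) auto
      ultimately have "norm (F (of_real x)) = (x - 1) * norm (zeta (of_real x))"
        "norm (zeta (Complex x u) / of_real (x - 1)) = norm (zeta (Complex x u)) / (x - 1)"
        using x Fz[of "of_real x"] by (auto simp only: norm_mult norm_divide Re_complex_of_real)
      moreover have "((x - 1) * a) ^ 3 * (b / (x - 1)) ^ 4 * c * (x - 1) = a ^ 3 * b ^ 4 * c" for a b c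
        using x by (simp add: power_mult_distrib power_divide divide_simps) (simp add: eval_nat_numeral)
      ultimately show ?thesis by (simp only:)
    qed
    thus "1 \<le> norm (F (of_real x)) ^ 3 * norm (zeta (Complex x u) / of_real (x - 1)) ^ 4 *
            norm (zeta (Complex x (2 * u))) * (x - 1)"
      using zeta_341[OF x, of u] by (simp only:)
  qed
  ultimately have "1 \<le> norm (F (of_real 1)) ^ 3 * norm D ^ 4 * norm (zeta (Complex 1 (2 * u))) * (1 - 1)"
    by (rule tendsto_lowerbound) auto
  thus False by simp
qed

lemma zeta_nonzero:
  assumes riemann_hypothesis "Re s > 1 / 2" "Im s \<noteq> 0"
  shows "zeta s \<noteq> 0"
proof -
  consider "Re s < 1" | "Re s = 1" | "Re s > 1" by linarith
  thus ?thesis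
  proof cases
    case 1
    thus ?thesis using assms by (auto simp: riemann_hypothesis_def)
  next
    case 2
    hence "s = Complex 1 (Im s)" by (simp add: complex_eq_iff)
    thus ?thesis using zeta_nonzero_Re_eq_1[OF assms(3)] by simp
  qed (rule exp_euler_log_tendsto(2))
qed

section \<open>The branch of the logarithm\<close>

text \<open>
  The difference is a continuous function with values in \<open>2 * pi * \<i> * \<int>\<close>.
\<close>

lemma continuous_logs_differ_by_constant:
  fixes F G :: "'a::topological_space \<Rightarrow> complex"
  assumes "connected S" "continuous_on S F" "continuous_on S G"
    and "\<And>x. x \<in> S \<Longrightarrow> exp (F x) = exp (G x)"
  shows "\<exists>c. exp c = 1 \<and> (\<forall>x\<in>S. F x = G x + c)"
proof -
  have int: "\<exists>n::int. F x - G x = of_real (of_int n * (2 * pi)) * \<i>" if x: "x \<in> S" for x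
    using assms(4)[OF x] unfolding exp_eq by (auto simp: algebra_simps)
  have "(\<lambda>x. F x - G x) constant_on S"
  proof (rule continuous_discrete_range_constant[OF assms(1)])
    show "continuous_on S (\<lambda>x. F x - G x)" by (intro continuous_intros assms)
    fix x assume x: "x \<in> S"
    have "2 * pi \<le> norm (F y - G y - (F x - G x))" if y: "y \<in> S" "F y - G y \<noteq> F x - G x" for y
    proof -
      obtain m n :: int where mn: "F x - G x = of_real (of_int n * (2 * pi)) * \<i>"
        "F y - G y = of_real (of_int m * (2 * pi)) * \<i>" using int[OF x] int[OF y(1)] by blast
      have "F y - G y - (F x - G x) = of_real (of_int (m - n) * (2 * pi)) * \<i>"
        unfolding mn by (simp add: algebra_simps)
      hence "norm (F y - G y - (F x - G x)) = \<bar>of_int (m - n)\<bar> * (2 * pi)"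
        by (simp only: norm_mult norm_of_real) (simp add: abs_mult)
      moreover have "m \<noteq> n" using mn y by auto
      hence "\<bar>of_int (m - n)\<bar> \<ge> (1::real)" by linarith
      hence "\<bar>of_int (m - n)\<bar> * (2 * pi) \<ge> 1 * (2 * pi)" by (intro mult_right_mono) auto
      ultimately show ?thesis by simp
    qed
    thus "\<exists>e>0. \<forall>y. y \<in> S \<and> F y - G y \<noteq> F x - G x \<longrightarrow> e \<le> norm (F y - G y - (F x - G x))"
      by (intro exI[of _ "2 * pi"]) auto
  qed
  then obtain c where c: "\<And>x. x \<in> S \<Longrightarrow> F x - G x = c" unfolding constant_on_def by blast
  show ?thesis
  proof (cases "S = {}")
    case True
    thus ?thesis by (intro exI[of _ 0]) simp
  next
    case False
    then obtain x where x: "x \<in> S" by blast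
    have "exp c = 1" using assms(4)[OF x] c[OF x] exp_diff[of "F x" "G x"] by simp
    thus ?thesis using c by (intro exI[of _ c]) (auto simp: algebra_simps)
  qed
qed

lemma holomorphic_log_on_convex:
  assumes "convex S" "open S" "f holomorphic_on S" "\<And>z. z \<in> S \<Longrightarrow> f z \<noteq> 0"
  obtains g where "g holomorphic_on S" "\<And>z. z \<in> S \<Longrightarrow> f z = exp (g z)"
  using simply_connected_eq_holomorphic_log[OF assms(2)] convex_imp_simply_connected[OF assms(1)] assms(3,4)
  by metis

text \<open>
  The limit of the logarithms of the partial Euler products is the branch of \<open>log \<zeta>\<close> that is real at 2.  Its
  distance from the partial sum over the primes up to \<open>2 ^ J\<close> is a tail of \<open>\<Sum>p. p ^ -2\<close>.
\<close>

lemma euler_log_limit_on_line_2: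
  obtains D where
    "continuous_on {s. Re s = 2} D"
    "\<And>s. Re s = 2 \<Longrightarrow> exp (D s) = zeta s" "Im (D 2) = 0"
    "\<And>s J. Re s = 2 \<Longrightarrow> norm (D s - euler_log (2 ^ J) s) \<le> 32 / (2 ^ J * (real J + 1))"
proof -
  let ?L = "{s::complex. Re s = 2}"
  define f where "f = (\<lambda>n s. if prime n then - Ln (1 - 1 / of_nat n powr s) else (0::complex))"
  define D where "D = (\<lambda>s. \<Sum>n. f n s)"
  have el: "euler_log N s = (\<Sum>n<Suc N. f n s)" for N s
    unfolding euler_log_def f_def
    by (subst sum.inter_filter[symmetric]) (auto intro!: sum.cong simp: less_Suc_eq_le)
  have ul: "uniform_limit ?L (\<lambda>N s. \<Sum>n<N. f n s) D sequentially"
    unfolding D_def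
  proof (rule Weierstrass_m_test)
    show "summable (\<lambda>n. 4 * real n powr (- 2))"
      by (intro summable_mult) (simp add: summable_real_powr_iff)
    show "norm (f n s) \<le> 4 * real n powr (- 2)" if "s \<in> ?L" for n s
      using norm_Ln_euler_factor_le[of n s] that by (auto simp: f_def)
  qed
  have cf: "continuous_on ?L (f n)" for n
  proof (cases "prime n")
    case True
    have "continuous_on ?L (\<lambda>s. - Ln (1 - 1 / of_nat n powr s))"
    proof (intro continuous_intros)
      fix s assume "s \<in> ?L"
      thus "1 - 1 / of_nat n powr s \<notin> \<real>\<^sub>\<le>\<^sub>0" by (intro euler_factor_nonpos_Reals True) auto
    qed (use prime_gt_0_nat[OF True] in auto)
    thus ?thesis using True by (simp add: f_def)
  qed (simp add: f_def)
  have cD: "continuous_on ?L D"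
    by (rule uniform_limit_theorem[OF _ ul]) (auto intro!: always_eventually continuous_intros cf)
  have lim: "(\<lambda>N. euler_log N s) \<longlonglongrightarrow> D s" if s: "Re s = 2" for s
  proof -
    have "(\<lambda>N. \<Sum>n<N. f n s) \<longlonglongrightarrow> D s" using tendsto_uniform_limitI[OF ul] s by simp
    thus ?thesis unfolding el by (rule LIMSEQ_Suc)
  qed
  have eD: "exp (D s) = zeta s" if s: "Re s = 2" for s
  proof -
    have "(\<lambda>N. exp (euler_log N s)) \<longlonglongrightarrow> exp (D s)" by (intro tendsto_intros lim s)
    moreover have "(\<lambda>N. exp (euler_log N s)) \<longlonglongrightarrow> zeta s" using s by (intro exp_euler_log_tendsto) auto
    ultimately show ?thesis by (rule LIMSEQ_unique)
  qed
  have "Im (D 2) = 0"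
  proof -
    have "Im (f n 2) = 0" for n
    proof (cases "prime n")
      case True
      hence "norm (1 / of_nat n powr (2::complex)) < 1" by (intro norm_inverse_prime_powr_lt_1) auto
      moreover have e: "1 / of_nat n powr (2::complex) = of_real (1 / real n ^ 2)"
        using prime_gt_0_nat[OF True] by (simp add: powr_numeral)
      ultimately have "1 / real n ^ 2 < 1" by (simp only: norm_of_real)
      hence "Ln (of_real (1 - 1 / real n ^ 2)) = of_real (ln (1 - 1 / real n ^ 2))"
        by (intro Ln_of_real) simp
      thus ?thesis using True e by (simp add: f_def)
    qed (simp add: f_def)
    hence "Im (euler_log N 2) = 0" for N unfolding el by simp
    moreover have "(\<lambda>N. Im (euler_log N 2)) \<longlonglongrightarrow> Im (D 2)" by (intro tendsto_intros lim) simp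
    ultimately show ?thesis by (simp add: LIMSEQ_const_iff)
  qed
  have tail: "norm (D s - euler_log (2 ^ J) s) \<le> 32 / (2 ^ J * (real J + 1))" if s: "Re s = 2" for s J
  proof (rule Lim_norm_ubound)
    show "((\<lambda>N. euler_log N s - euler_log (2 ^ J) s) \<longlonglongrightarrow> D s - euler_log (2 ^ J) s)"
      by (intro tendsto_intros lim s)
    have "norm (euler_log N s - euler_log (2 ^ J) s) \<le> 32 / (2 ^ J * (real J + 1))" if N: "N \<ge> 2 ^ J" for N
    proof -
      have "euler_log N s - euler_log (2 ^ J) s =
        (\<Sum>p\<in>{p. prime p \<and> p \<le> N} - {p. prime p \<and> p \<le> 2 ^ J}. - Ln (1 - 1 / of_nat p powr s))"
        unfolding euler_log_def using N by (intro sum_diff[symmetric]) auto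
      also have "norm \<dots> \<le> (\<Sum>p\<in>{p. prime p \<and> p \<le> N} - {p. prime p \<and> p \<le> 2 ^ J}. 4 * real p powr (- 2))"
        using norm_Ln_euler_factor_le[of _ s] s by (intro sum_norm_le) auto
      also have "\<dots> = 4 * (\<Sum>p\<in>{p. prime p \<and> p \<le> N} - {p. prime p \<and> p \<le> 2 ^ J}. real p powr (- 2))"
        by (rule sum_distrib_left[symmetric])
      also have "\<dots> \<le> 4 * (8 / (2 ^ J * (real J + 1)))"
        by (intro mult_left_mono prime_square_tail_le) auto
      finally show ?thesis by simp
    qed
    thus "\<forall>\<^sub>F N in sequentially. norm (euler_log N s - euler_log (2 ^ J) s) \<le> 32 / (2 ^ J * (real J + 1))"
      by (rule eventually_sequentiallyI)
  qed simp
  show ?thesis by (rule that[OF cD eD \<open>Im (D 2) = 0\<close> tail])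
qed

definition zeta_strip :: "complex set" where
  "zeta_strip = {s. Re s > 1 / 2} \<inter> {s. Im s > 1}"

lemma convex_zeta_strip: "convex zeta_strip" and open_zeta_strip: "open zeta_strip"
  unfolding zeta_strip_def
  by (intro convex_Int open_Int convex_halfspace_Re_gt convex_halfspace_Im_gt open_halfspace_Re_gt open_halfspace_Im_gt)+

text \<open>
  The path that defines \<open>zeta_S\<close> starts at 2, outside the domain of \<open>F\<close>, so the branch on the
  line \<open>Re s = 2\<close> is recorded as well: \<open>F\<close> is the branch of \<open>log \<zeta>\<close> that is obtained from the
  real logarithm at 2 by continuation along this line.
\<close>

definition log_zeta_branch :: "(complex \<Rightarrow> complex) \<Rightarrow> (complex \<Rightarrow> complex) \<Rightarrow> bool" where
  "log_zeta_branch D F \<longleftrightarrow> continuous_on {s. Re s = 2} D \<and> (\<forall>s. Re s = 2 \<longrightarrow> exp (D s) = zeta s) \<and>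
     Im (D 2) = 0 \<and> (\<forall>s J. Re s = 2 \<longrightarrow> norm (D s - euler_log (2 ^ J) s) \<le> 32 / (2 ^ J * (real J + 1))) \<and>
     F holomorphic_on zeta_strip \<and> (\<forall>s\<in>zeta_strip. exp (F s) = zeta s) \<and>
     (\<forall>s. Re s = 2 \<and> Im s > 1 \<longrightarrow> F s = D s)"

lemma log_zeta_branch_exists:
  assumes riemann_hypothesis
  obtains D F where "log_zeta_branch D F"
proof -
  obtain D where D: "continuous_on {s. Re s = 2} D"
    "\<And>s. Re s = 2 \<Longrightarrow> exp (D s) = zeta s" "Im (D 2) = 0"
    "\<And>s J. Re s = 2 \<Longrightarrow> norm (D s - euler_log (2 ^ J) s) \<le> 32 / (2 ^ J * (real J + 1))"
    by (rule euler_log_limit_on_line_2) blast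
  have "zeta holomorphic_on zeta_strip"
    by (rule holomorphic_on_subset[OF zeta_holomorphic]) (auto simp: zeta_strip_def)
  moreover have "zeta s \<noteq> 0" if "s \<in> zeta_strip" for s
    using zeta_nonzero[OF assms, of s] that by (auto simp: zeta_strip_def)
  ultimately obtain G where G: "G holomorphic_on zeta_strip" "\<And>s. s \<in> zeta_strip \<Longrightarrow> zeta s = exp (G s)"
    by (rule holomorphic_log_on_convex[OF convex_zeta_strip open_zeta_strip]) blast+
  let ?L = "{s. Re s = 2} \<inter> {s. Im s > 1}"
  have L: "?L \<subseteq> zeta_strip" "?L \<subseteq> {s. Re s = 2}" by (auto simp: zeta_strip_def)
  have "connected ?L"
  proof (intro convex_connected convex_Int convex_halfspace_Im_gt)
    have "{s. Re s = 2} = {s. Re s \<ge> 2} \<inter> {s. Re s \<le> 2}" by auto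
    thus "convex {s. Re s = 2}"
      by (simp only:) (intro convex_Int convex_halfspace_Re_ge convex_halfspace_Re_le)
  qed
  moreover have "continuous_on ?L D" by (rule continuous_on_subset[OF D(1) L(2)])
  moreover have "continuous_on ?L G"
    using holomorphic_on_imp_continuous_on[OF G(1)] L by (blast intro: continuous_on_subset)
  moreover have "exp (D s) = exp (G s)" if "s \<in> ?L" for s
    using that L D(2) G(2) by (metis (mono_tags, lifting) mem_Collect_eq subsetD)
  ultimately have "\<exists>c. exp c = 1 \<and> (\<forall>s\<in>?L. D s = G s + c)"
    by (rule continuous_logs_differ_by_constant)
  then obtain c where c: "exp c = 1" "\<And>s. s \<in> ?L \<Longrightarrow> D s = G s + c" by blast
  have "log_zeta_branch D (\<lambda>s. G s + c)"
    unfolding log_zeta_branch_def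
  proof (intro conjI)
    show "(\<lambda>s. G s + c) holomorphic_on zeta_strip" by (intro holomorphic_intros G)
  qed (use D G(2) c in \<open>auto simp: exp_add\<close>)
  thus ?thesis by (rule that)
qed

lemma log_zeta_branchD:
  assumes "log_zeta_branch D F"
  shows "continuous_on {s. Re s = 2} D" "\<And>s. Re s = 2 \<Longrightarrow> exp (D s) = zeta s" "Im (D 2) = 0"
    "\<And>s J. Re s = 2 \<Longrightarrow> norm (D s - euler_log (2 ^ J) s) \<le> 32 / (2 ^ J * (real J + 1))"
    "F holomorphic_on zeta_strip" "\<And>s. s \<in> zeta_strip \<Longrightarrow> exp (F s) = zeta s"
    "\<And>s. Re s = 2 \<Longrightarrow> Im s > 1 \<Longrightarrow> F s = D s"
  using assms unfolding log_zeta_branch_def by auto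

text \<open>
  With \<open>g = f - f c\<close> and \<open>B\<close> the bound for \<open>Re g\<close>, Schwarz's lemma applies to \<open>g / (2 * B - g)\<close>.
\<close>

lemma Borel_Caratheodory:
  fixes f :: "complex \<Rightarrow> complex"
  assumes R: "R > 0" and f: "f holomorphic_on ball c R"
    and A: "\<And>z. z \<in> ball c R \<Longrightarrow> Re (f z) < A" and z: "z \<in> ball c R"
  shows "norm (f z - f c) \<le> 2 * (A - Re (f c)) * norm (z - c) / (R - norm (z - c))"
proof -
  define B where "B = A - Re (f c)"
  have B: "B > 0" using A[of c] R by (simp add: B_def)
  define g where "g = (\<lambda>w. f (c + of_real R * w) - f c)"
  define h where "h = (\<lambda>w. g w / (2 * of_real B - g w))"
  have inb: "c + of_real R * w \<in> ball c R" if "norm w < 1" for w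
    using that R by (simp add: dist_norm norm_mult)
  have Reg: "Re (g w) < B" if "norm w < 1" for w
    using A[OF inb[OF that]] by (simp add: g_def B_def)
  have nz: "2 * of_real B - g w \<noteq> 0" if "norm w < 1" for w
  proof
    assume "2 * of_real B - g w = 0"
    hence "Re (2 * of_real B - g w) = 0" by simp
    thus False using Reg[OF that] B by simp
  qed
  have holg: "g holomorphic_on ball 0 1"
  proof -
    have "f \<circ> (\<lambda>w. c + of_real R * w) holomorphic_on ball 0 1"
      by (rule holomorphic_on_compose_gen[OF _ f]) (auto intro!: holomorphic_intros inb)
    thus ?thesis unfolding g_def o_def by (intro holomorphic_intros)
  qed
  have nh: "norm (h w) < 1" if w: "norm w < 1" for w
  proof -
    have "norm (g w) < norm (2 * of_real B - g w)"
    proof (rule power_less_imp_less_base)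
      have "norm (2 * of_real B - g w) ^ 2 - norm (g w) ^ 2 = 4 * B * (B - Re (g w))"
        unfolding cmod_power2 by (simp add: power2_eq_square algebra_simps)
      moreover have "4 * B * (B - Re (g w)) > 0" using Reg[OF w] B by simp
      ultimately show "norm (g w) ^ 2 < norm (2 * of_real B - g w) ^ 2" by linarith
    qed auto
    thus ?thesis using nz[OF w] by (simp add: h_def norm_divide)
  qed
  define w where "w = (z - c) / of_real R"
  have w: "norm w < 1" "norm w = norm (z - c) / R" using z R by (auto simp: w_def norm_divide dist_norm norm_minus_commute)
  have "norm (h w) \<le> norm w"
  proof (rule Schwarz_Lemma(1))
    show "h holomorphic_on ball 0 1" unfolding h_def by (intro holomorphic_intros holg nz) auto
    show "h 0 = 0" by (simp add: h_def g_def)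
  qed (use nh w in auto)
  have h1: "1 + h w \<noteq> 0"
  proof
    assume "1 + h w = 0"
    hence "h w = - 1" by (metis add_eq_0_iff)
    thus False using nh[OF w(1)] by simp
  qed
  have "g w = 2 * of_real B * h w / (1 + h w)"
    using nz[OF w(1)] h1 by (simp add: h_def field_simps)
  hence "norm (g w) = 2 * B * norm (h w) / norm (1 + h w)"
    using B by (simp add: norm_mult norm_divide)
  also have "\<dots> \<le> 2 * B * norm w / (1 - norm w)"
  proof (intro frac_le mult_left_mono)
    show "1 - norm w \<le> norm (1 + h w)"
      using norm_triangle_ineq2[of 1 "- h w"] \<open>norm (h w) \<le> norm w\<close> by simp
  qed (use B R w \<open>norm (h w) \<le> norm w\<close> in auto)
  also have "\<dots> = 2 * B * norm (z - c) / (R - norm (z - c))"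
  proof -
    have "1 - norm (z - c) / R = (R - norm (z - c)) / R" using R by (simp add: diff_divide_distrib)
    thus ?thesis using R by (simp add: w(2))
  qed
  finally show ?thesis using R by (simp add: g_def w_def B_def)
qed

text \<open>
  The disc of radius \<open>3/2\<close> about \<open>2 + \<i>u\<close> touches the critical line, and on it \<open>Re (F s) = ln |\<zeta> s|\<close>
  is at most a constant times \<open>ln u\<close>.
\<close>

lemma log_zeta_bound:
  obtains K where "K > 0"
    "\<And>D F s. log_zeta_branch D F \<Longrightarrow> 1 / 2 < Re s \<Longrightarrow> Re s \<le> 2 \<Longrightarrow> Im s \<ge> 3 \<Longrightarrow>
       norm (F s) \<le> K * ln (Im s) / (Re s - 1 / 2)"
proof -
  obtain K0 where K0: "K0 \<ge> 1"
    "\<And>s. 1 / 2 \<le> Re s \<Longrightarrow> Re s \<le> 4 \<Longrightarrow> Im s \<ge> 1 \<Longrightarrow> norm (zeta s) \<le> K0 * (Im s)\<^sup>2"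
    by (rule zeta_growth) blast
  define K where "K = 96 + 3 * (ln K0 + 5 + 32)"
  have l0: "ln K0 \<ge> 0" using K0 by simp
  have main: "norm (F s) \<le> K * ln (Im s) / (Re s - 1 / 2)"
    if DF: "log_zeta_branch D F" and s: "1 / 2 < Re s" "Re s \<le> 2" "Im s \<ge> 3" for D F s
  proof -
    define u where "u = Im s"
    define c where "c = Complex 2 u"
    note B = log_zeta_branchD[OF DF]
    have u: "u \<ge> 3" using s by (simp add: u_def)
    have lu: "ln u \<ge> 1"
    proof -
      have "exp 1 \<le> u" using exp_le u by linarith
      thus ?thesis using u by (subst ln_ge_iff) auto
    qed
    have inb: "1 / 2 < Re z \<and> Re z < 7 / 2 \<and> u - 3 / 2 < Im z \<and> Im z < u + 3 / 2" if "z \<in> ball c (3 / 2)" for z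
      using that abs_Re_le_cmod[of "c - z"] abs_Im_le_cmod[of "c - z"] by (auto simp: dist_norm c_def)
    have "ball c (3 / 2) \<subseteq> zeta_strip"
      using inb u by (fastforce simp: zeta_strip_def)
    hence sub: "z \<in> zeta_strip" if "z \<in> ball c (3 / 2)" for z using that by blast
    have lK: "ln K0 + 5 * ln u > ln K0 + 2 * ln (u + 3 / 2)"
    proof -
      have "ln (u + 3 / 2) \<le> ln (u * u)"
      proof -
        have "u + 3 / 2 \<le> 3 * u" using u by simp
        also have "\<dots> \<le> u * u" using u by (intro mult_right_mono) auto
        finally show ?thesis using u by simp
      qed
      also have "\<dots> = 2 * ln u" using u by (simp add: ln_mult)
      finally show ?thesis using lu by simp
    qed
    have rz: "norm (s - c) = 2 - Re s"
    proof -
      have "s - c = of_real (Re s - 2)" by (simp add: complex_eq_iff c_def u_def)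
      thus ?thesis using s by (simp only: norm_of_real)
    qed
    have Fc: "norm (F c) \<le> 32"
    proof -
      have "{p::nat. prime p \<and> p \<le> 1} = {}" using prime_gt_1_nat by (auto simp: not_le)
      hence "euler_log (2 ^ 0) c = 0" unfolding euler_log_def by (simp only: power_0 sum.empty)
      thus ?thesis using B(4)[of c 0] B(7)[of c] u by (simp add: c_def)
    qed
    have "norm (F s - F c) \<le> 2 * (ln K0 + 5 * ln u - Re (F c)) * norm (s - c) / (3 / 2 - norm (s - c))"
    proof (rule Borel_Caratheodory)
      show "F holomorphic_on ball c (3 / 2)" using B(5) sub by (blast intro: holomorphic_on_subset)
      show "s \<in> ball c (3 / 2)" using rz s by (simp add: dist_norm norm_minus_commute)
      fix z assume z: "z \<in> ball c (3 / 2)"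
      have "norm (zeta z) = exp (Re (F z))" using B(6)[OF sub[OF z]] by (metis norm_exp_eq_Re)
      moreover have "norm (zeta z) \<le> K0 * (Im z)\<^sup>2" using inb[OF z] u by (intro K0) auto
      moreover have "K0 * (Im z)\<^sup>2 \<le> K0 * (u + 3 / 2)\<^sup>2"
        using inb[OF z] u K0 by (intro mult_left_mono power_mono) auto
      moreover have "K0 * (u + 3 / 2)\<^sup>2 = exp (ln K0 + 2 * ln (u + 3 / 2))"
        using u K0 by (simp add: exp_add exp_double)
      ultimately have "exp (Re (F z)) \<le> exp (ln K0 + 2 * ln (u + 3 / 2))" by linarith
      thus "Re (F z) < ln K0 + 5 * ln u" using lK by simp
    qed auto
    also have "\<dots> \<le> 2 * ((ln K0 + 5 + 32) * ln u) * (3 / 2) / (3 / 2 - norm (s - c))"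
    proof (rule divide_right_mono)
      have "- Re (F c) \<le> 32" using Fc abs_Re_le_cmod[of "F c"] by linarith
      hence "ln K0 + 5 * ln u - Re (F c) \<le> ln K0 * ln u + 5 * ln u + 32 * ln u"
        using lu l0 mult_left_mono[OF lu l0] by linarith
      hence "2 * (ln K0 + 5 * ln u - Re (F c)) \<le> 2 * ((ln K0 + 5 + 32) * ln u)" by (simp add: algebra_simps)
      thus "2 * (ln K0 + 5 * ln u - Re (F c)) * norm (s - c) \<le> 2 * ((ln K0 + 5 + 32) * ln u) * (3 / 2)"
        by (rule mult_mono) (use rz s lu l0 in auto)
    qed (use rz s in auto)
    also have "\<dots> = 3 * (ln K0 + 5 + 32) * ln u / (Re s - 1 / 2)" by (simp add: rz)
    finally have 1: "norm (F s - F c) \<le> 3 * (ln K0 + 5 + 32) * ln u / (Re s - 1 / 2)" .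
    have "32 * (Re s - 1 / 2) = 32 * Re s - 16" by simp
    also have "\<dots> \<le> 96 * ln u" using s lu by linarith
    finally have "32 * (Re s - 1 / 2) \<le> 96 * ln u" .
    hence 2: "32 \<le> 96 * ln u / (Re s - 1 / 2)" using s by (simp add: field_simps)
    have "norm (F s) \<le> norm (F s - F c) + norm (F c)" using norm_triangle_ineq[of "F s - F c" "F c"] by simp
    also have "\<dots> \<le> 3 * (ln K0 + 5 + 32) * ln u / (Re s - 1 / 2) + 96 * ln u / (Re s - 1 / 2)"
      using 1 2 Fc by linarith
    also have "\<dots> = K * ln u / (Re s - 1 / 2)"
      by (simp add: K_def add_divide_distrib algebra_simps)
    finally show ?thesis by (simp add: u_def)
  qed
  show ?thesis
  proof (rule that[of K])
    show "K > 0" using l0 by (simp add: K_def)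
  qed (rule main)
qed

section \<open>An estimate from the imaginary part on one side of a rectangle\<close>

lemma integral_inverse_one_plus_square_le:
  assumes "H \<ge> 0"
  shows "(\<lambda>v::real. 1 / (1 + v\<^sup>2)) integrable_on {-H..H}"
    and "integral {-H..H} (\<lambda>v::real. 1 / (1 + v\<^sup>2)) \<le> pi"
proof -
  have "((\<lambda>v::real. 1 / (1 + v\<^sup>2)) has_integral (arctan H - arctan (-H))) {-H..H}"
  proof (rule fundamental_theorem_of_calculus)
    show "(arctan has_vector_derivative 1 / (1 + v\<^sup>2)) (at v within {-H..H})" for v
      using DERIV_arctan[of v]
      by (simp add: has_real_derivative_iff_has_vector_derivative inverse_eq_divide has_vector_derivative_at_within)
  qed (use assms in auto)
  thus "(\<lambda>v::real. 1 / (1 + v\<^sup>2)) integrable_on {-H..H}" "integral {-H..H} (\<lambda>v::real. 1 / (1 + v\<^sup>2)) \<le> pi"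
    using arctan_ubound[of H] by (auto simp: has_integral_iff arctan_minus)
qed

lemma exp_minus_square_le: "exp (- v\<^sup>2) \<le> 1 / (1 + v\<^sup>2 :: real)"
proof -
  have "1 + v\<^sup>2 \<le> exp (v\<^sup>2)" by (rule exp_ge_add_one_self)
  moreover have "1 + v\<^sup>2 > 0" by (simp add: add_pos_nonneg)
  ultimately have "1 / exp (v\<^sup>2) \<le> 1 / (1 + v\<^sup>2)" by (intro divide_left_mono) auto
  thus ?thesis by (simp only: exp_minus inverse_eq_divide)
qed

lemma rectangle_three_sides_bound:
  fixes f :: "complex \<Rightarrow> complex"
  assumes b: "b > 0" and H: "H > 0"
    and cont: "continuous_on (path_image (rectpath (Complex 0 (-H)) (Complex b H))) f"
    and int: "(f has_contour_integral I) (rectpath (Complex 0 (-H)) (Complex b H))"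
    and \<beta>: "\<beta> \<ge> 0" "\<And>r. 0 \<le> r \<Longrightarrow> r \<le> b \<Longrightarrow> norm (f (Complex r H)) \<le> \<beta>"
      "\<And>r. 0 \<le> r \<Longrightarrow> r \<le> b \<Longrightarrow> norm (f (Complex r (-H))) \<le> \<beta>"
    and \<rho>: "\<And>v. -H \<le> v \<Longrightarrow> v \<le> H \<Longrightarrow> norm (f (Complex b v)) \<le> \<rho> / (1 + v\<^sup>2)"
  shows "norm (I + \<i> * integral {-H..H} (\<lambda>v. f (Complex 0 v))) \<le> 2 * \<beta> * b + pi * \<rho>"
proof -
  let ?P = "path_image (rectpath (Complex 0 (-H)) (Complex b H))"
  have P: "?P = {z. Re z \<in> {0, b} \<and> Im z \<in> {-H..H}} \<union> {z. Im z \<in> {-H, H} \<and> Re z \<in> {0..b}}"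
    using b H by (subst path_image_rectpath) auto
  define c1 c2 c3 c4 where "c1 = Complex 0 (-H)" and "c2 = Complex b (-H)" and "c3 = Complex b H" and "c4 = Complex 0 H"
  have seg: "closed_segment c1 c2 = {z. Im z = -H \<and> Re z \<in> {0..b}}"
    "closed_segment c3 c4 = {z. Im z = H \<and> Re z \<in> {0..b}}"
    "closed_segment c2 c3 = {z. Re z = b \<and> Im z \<in> {-H..H}}"
    "closed_segment c4 c1 = {z. Re z = 0 \<and> Im z \<in> {-H..H}}"
    using b H unfolding c1_def c2_def c3_def c4_def
    by (simp_all add: closed_segment_same_Re closed_segment_same_Im closed_segment_eq_real_ivl)
  have sub: "closed_segment c1 c2 \<subseteq> ?P" "closed_segment c2 c3 \<subseteq> ?P" "closed_segment c3 c4 \<subseteq> ?P" "closed_segment c4 c1 \<subseteq> ?P"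
    unfolding seg P by blast+
  have i: "f contour_integrable_on linepath c1 c2" "f contour_integrable_on linepath c2 c3"
    "f contour_integrable_on linepath c3 c4" "f contour_integrable_on linepath c4 c1"
    by (intro contour_integrable_continuous_linepath continuous_on_subset[OF cont] sub)+
  note hi = i[THEN has_contour_integral_integral]
  have "(f has_contour_integral (contour_integral (linepath c1 c2) f + (contour_integral (linepath c2 c3) f +
     (contour_integral (linepath c3 c4) f + contour_integral (linepath c4 c1) f)))) (rectpath c1 c3)"
  proof -
    have "rectpath c1 c3 = linepath c1 c2 +++ linepath c2 c3 +++ linepath c3 c4 +++ linepath c4 c1"
      by (simp add: rectpath_def Let_def c1_def c2_def c3_def c4_def)
    thus ?thesis
      by (simp only:) (intro has_contour_integral_join hi valid_path_join valid_path_linepath; simp)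
  qed
  hence I: "I = contour_integral (linepath c1 c2) f + (contour_integral (linepath c2 c3) f +
     (contour_integral (linepath c3 c4) f + contour_integral (linepath c4 c1) f))"
    using int has_contour_integral_unique unfolding c1_def c3_def by blast
  have left: "contour_integral (linepath c4 c1) f = - \<i> * integral {-H..H} (\<lambda>v. f (Complex 0 v))"
  proof -
    define J where "J = contour_integral (linepath c1 c4) f"
    have "f contour_integrable_on linepath c1 c4"
      using i(4) contour_integrable_reversepath[of "linepath c4 c1" f] by simp
    hence "(f has_contour_integral J) (linepath c1 c4)"
      unfolding J_def by (rule has_contour_integral_integral)
    hence "((\<lambda>v. f (Complex 0 v)) has_integral (- \<i> * J)) {-H..H}"
      using H by (subst (asm) has_contour_integral_linepath_same_Re_iff[of _ 0 _ "-H" H]) (auto simp: c1_def c4_def)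
    moreover have "contour_integral (linepath c4 c1) f = - J"
      using contour_integral_reversepath[of "linepath c1 c4" f] by (simp add: J_def)
    ultimately show ?thesis by (simp add: integral_unique)
  qed
  have right: "norm (contour_integral (linepath c2 c3) f) \<le> pi * \<rho>"
  proof -
    define J where "J = contour_integral (linepath c2 c3) f"
    have "((\<lambda>v. f (Complex b v)) has_integral (- \<i> * J)) {-H..H}"
      using hi(2) H unfolding J_def[symmetric]
      by (subst (asm) has_contour_integral_linepath_same_Re_iff[of _ b _ "-H" H]) (auto simp: c2_def c3_def)
    hence *: "(\<lambda>v. f (Complex b v)) integrable_on {-H..H}" "integral {-H..H} (\<lambda>v. f (Complex b v)) = - \<i> * J"
      by (auto simp: has_integral_iff)
    have "norm J = norm (integral {-H..H} (\<lambda>v. f (Complex b v)))" unfolding * by (simp add: norm_mult)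
    also have "\<dots> \<le> integral {-H..H} (\<lambda>v. \<rho> * (1 / (1 + v\<^sup>2)))"
      using integral_inverse_one_plus_square_le[of H] H \<rho>
      by (intro integral_norm_bound_integral * integrable_on_mult_right) auto
    also have "\<dots> = \<rho> * integral {-H..H} (\<lambda>v. 1 / (1 + v\<^sup>2))" by (rule integral_mult_right)
    also have "\<dots> \<le> \<rho> * pi"
    proof (rule mult_left_mono)
      have "norm (f (Complex b 0)) \<le> \<rho>" using \<rho>[of 0] H by simp
      thus "\<rho> \<ge> 0" using norm_ge_zero[of "f (Complex b 0)"] by linarith
    qed (use integral_inverse_one_plus_square_le[of H] H in auto)
    finally show ?thesis by (simp add: J_def mult.commute)
  qed
  have bot: "norm (contour_integral (linepath c1 c2) f) \<le> \<beta> * norm (c2 - c1)"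
  proof (rule has_contour_integral_bound_linepath[OF hi(1) \<beta>(1)])
    fix z assume "z \<in> closed_segment c1 c2"
    then obtain r where "z = Complex r (-H)" "0 \<le> r" "r \<le> b"
      unfolding seg by (intro that[of "Re z"]) (auto simp: complex_eq_iff)
    thus "norm (f z) \<le> \<beta>" using \<beta>(3)[of r] by simp
  qed
  have top: "norm (contour_integral (linepath c3 c4) f) \<le> \<beta> * norm (c4 - c3)"
  proof (rule has_contour_integral_bound_linepath[OF hi(3) \<beta>(1)])
    fix z assume "z \<in> closed_segment c3 c4"
    then obtain r where "z = Complex r H" "0 \<le> r" "r \<le> b"
      unfolding seg by (intro that[of "Re z"]) (auto simp: complex_eq_iff)
    thus "norm (f z) \<le> \<beta>" using \<beta>(2)[of r] by simp
  qed
  have "c2 - c1 = of_real b" "c4 - c3 = of_real (- b)"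
    by (simp_all add: c1_def c2_def c3_def c4_def complex_eq_iff)
  hence n: "norm (c2 - c1) = b" "norm (c4 - c3) = b"
    using b by (simp_all only: norm_of_real abs_minus_cancel abs_of_pos)
  have eq: "I + \<i> * integral {-H..H} (\<lambda>v. f (Complex 0 v)) =
    contour_integral (linepath c1 c2) f + contour_integral (linepath c2 c3) f + contour_integral (linepath c3 c4) f"
  proof -
    have *: "p + (q + (r + - \<i> * J)) + \<i> * J = p + q + r" for p q r J :: complex
      by simp
    show ?thesis unfolding I left by (rule *)
  qed
  have norm3: "norm (p + q + r) \<le> norm p + norm q + norm r" for p q r :: complex
    using norm_triangle_ineq[of "p + q" r] norm_triangle_ineq[of p q] by linarith
  have tri: "norm (I + \<i> * integral {-H..H} (\<lambda>v. f (Complex 0 v))) \<le>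
    norm (contour_integral (linepath c1 c2) f) + norm (contour_integral (linepath c2 c3) f) +
      norm (contour_integral (linepath c3 c4) f)"
    unfolding eq by (rule norm3)
  have "x \<le> 2 * \<beta> * b + pi * \<rho>" if "x \<le> y + z + w" "y \<le> \<beta> * b" "z \<le> pi * \<rho>" "w \<le> \<beta> * b" for x y z w
    using that by simp
  from this[OF tri bot[unfolded n] right top[unfolded n]] show ?thesis .
qed

text \<open>
  The kernel of the estimate: it is 1 at \<open>a\<close>, grows like \<open>exp (l * Re z)\<close>, decays like a Gaussian
  in the vertical direction, commutes with conjugation and vanishes at \<open>\<plusminus>iH\<close>.
\<close>

definition corner_kernel :: "real \<Rightarrow> real \<Rightarrow> real \<Rightarrow> complex \<Rightarrow> complex" where
  "corner_kernel l a H z = exp (of_real l * (z - of_real a) + (z - of_real a)\<^sup>2) *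
     (z\<^sup>2 + of_real (H\<^sup>2)) / of_real (a\<^sup>2 + H\<^sup>2)"

lemma corner_kernel_at: "H > 0 \<Longrightarrow> corner_kernel l a H (of_real a) = 1"
proof -
  assume "H > 0"
  hence "a\<^sup>2 + H\<^sup>2 > 0" by (simp add: add_nonneg_pos)
  hence "complex_of_real (a\<^sup>2 + H\<^sup>2) \<noteq> 0" by (simp only: of_real_eq_0_iff)
  thus ?thesis unfolding corner_kernel_def by (simp flip: of_real_power of_real_add)
qed

lemma corner_kernel_holomorphic: "H > 0 \<Longrightarrow> corner_kernel l a H holomorphic_on A"
proof -
  assume "H > 0"
  hence "a\<^sup>2 + H\<^sup>2 > 0" by (simp add: add_nonneg_pos)
  hence "complex_of_real (a\<^sup>2 + H\<^sup>2) \<noteq> 0" by (simp only: of_real_eq_0_iff)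
  thus ?thesis unfolding corner_kernel_def by (intro holomorphic_intros)
qed

lemma cnj_corner_kernel: "cnj (corner_kernel l a H z) = corner_kernel l a H (cnj z)"
  by (simp add: corner_kernel_def exp_cnj)

lemma norm_corner_kernel:
  "norm (corner_kernel l a H z) =
     exp (l * (Re z - a) + (Re z - a)\<^sup>2) * exp (- (Im z)\<^sup>2) * (norm (z\<^sup>2 + of_real (H\<^sup>2)) / (a\<^sup>2 + H\<^sup>2))"
proof -
  have "Re (of_real l * (z - of_real a) + (z - of_real a)\<^sup>2) = (l * (Re z - a) + (Re z - a)\<^sup>2) + - (Im z)\<^sup>2"
    by (simp add: power2_eq_square)
  moreover have "norm (complex_of_real (a\<^sup>2 + H\<^sup>2)) = a\<^sup>2 + H\<^sup>2" by (subst norm_of_real) simp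
  moreover have "norm (exp z) = exp x * exp y" if "Re z = x + y" for z x y
    by (simp only: norm_exp_eq_Re that exp_add)
  ultimately show ?thesis
    unfolding corner_kernel_def by (simp only: norm_mult norm_divide times_divide_eq_right)
qed

text \<open>Near the corners the kernel is small enough to absorb a singularity \<open>1 / r\<close>.\<close>

lemma norm_corner_kernel_horizontal_le:
  assumes "l \<ge> 0" "0 < a" "a \<le> 1 / 2" "H \<ge> 1" "\<bar>Re z\<bar> \<le> 3 / 2" "\<bar>Im z\<bar> = H"
  shows "norm (corner_kernel l a H z) \<le> 4 * exp 4 * exp (3 / 2 * l) * exp (- H\<^sup>2) * \<bar>Re z\<bar>"
proof -
  define r where "r = Re z"
  have "(r - a)\<^sup>2 \<le> 2\<^sup>2" using assms by (intro abs_le_square_iff[THEN iffD1]) (auto simp: r_def)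
  moreover have "l * (r - a) \<le> l * (3 / 2)" using assms by (intro mult_left_mono) (auto simp: r_def)
  ultimately have 1: "exp (l * (r - a) + (r - a)\<^sup>2) \<le> exp 4 * exp (3 / 2 * l)"
    by (simp flip: exp_add)
  have im: "(Im z)\<^sup>2 = H\<^sup>2" using assms by (metis power2_abs)
  have "z\<^sup>2 + of_real (H\<^sup>2) = of_real r * (of_real r + 2 * \<i> * of_real (Im z))"
    using im by (auto simp: complex_eq_iff r_def power2_eq_square)
  hence "norm (z\<^sup>2 + of_real (H\<^sup>2)) = \<bar>r\<bar> * norm (of_real r + 2 * \<i> * of_real (Im z))"
    by (simp only: norm_mult norm_of_real)
  also have "norm (of_real r + 2 * \<i> * of_real (Im z)) \<le> \<bar>r\<bar> + 2 * \<bar>Im z\<bar>"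
    using norm_triangle_ineq[of "of_real r" "2 * \<i> * of_real (Im z)"] by (simp add: norm_mult)
  also have "\<bar>r\<bar> + 2 * \<bar>Im z\<bar> \<le> 4 * H\<^sup>2"
  proof -
    have "H \<le> H\<^sup>2" using assms mult_mono[of 1 H H H] by (auto simp: power2_eq_square)
    thus ?thesis using assms by (simp add: r_def)
  qed
  finally have "norm (z\<^sup>2 + of_real (H\<^sup>2)) \<le> \<bar>r\<bar> * (4 * H\<^sup>2)" by (simp add: mult_left_mono)
  also have "\<dots> \<le> 4 * \<bar>r\<bar> * (a\<^sup>2 + H\<^sup>2)" by (simp add: algebra_simps)
  finally have 2: "norm (z\<^sup>2 + of_real (H\<^sup>2)) / (a\<^sup>2 + H\<^sup>2) \<le> 4 * \<bar>r\<bar>"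
    using assms by (simp add: divide_le_eq add_nonneg_pos)
  have "norm (corner_kernel l a H z) \<le> exp 4 * exp (3 / 2 * l) * exp (- H\<^sup>2) * (4 * \<bar>r\<bar>)"
    unfolding norm_corner_kernel im r_def[symmetric] using 1 2 by (intro mult_mono) auto
  thus ?thesis by (simp add: r_def mult_ac)
qed

lemma norm_corner_kernel_vertical_le:
  assumes "0 < a" "a \<le> 1 / 2" "H \<ge> 1" "\<bar>Re z\<bar> \<le> 3 / 2" "\<bar>Im z\<bar> \<le> H"
  shows "norm (corner_kernel l a H z) \<le> 5 * exp 4 * exp (l * (Re z - a)) / (1 + (Im z)\<^sup>2)"
proof -
  have "(Re z - a)\<^sup>2 \<le> 2\<^sup>2" using assms by (intro abs_le_square_iff[THEN iffD1]) auto
  hence 1: "exp (l * (Re z - a) + (Re z - a)\<^sup>2) \<le> exp 4 * exp (l * (Re z - a))"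
    by (simp flip: exp_add)
  have "norm (z\<^sup>2 + of_real (H\<^sup>2)) \<le> norm z ^ 2 + H\<^sup>2"
    using norm_triangle_ineq[of "z\<^sup>2" "of_real (H\<^sup>2)"] by (simp add: norm_power)
  also have "\<dots> = (Re z)\<^sup>2 + (Im z)\<^sup>2 + H\<^sup>2" by (simp add: cmod_power2)
  also have "\<dots> \<le> (3 / 2)\<^sup>2 + H\<^sup>2 + H\<^sup>2"
    using assms by (intro add_mono abs_le_square_iff[THEN iffD1]) auto
  also have "\<dots> \<le> 5 * (a\<^sup>2 + H\<^sup>2)"
  proof -
    have "1 \<le> H\<^sup>2" using assms by simp
    moreover have "0 \<le> a\<^sup>2" by simp
    moreover have "(3 / 2)\<^sup>2 + y + y \<le> 5 * (x + y)" if "1 \<le> y" "0 \<le> x" for x y :: real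
      using that by (simp add: power2_eq_square)
    ultimately show ?thesis by blast
  qed
  finally have 2: "norm (z\<^sup>2 + of_real (H\<^sup>2)) / (a\<^sup>2 + H\<^sup>2) \<le> 5"
    using assms by (simp add: divide_le_eq add_nonneg_pos)
  have "norm (corner_kernel l a H z) \<le> exp 4 * exp (l * (Re z - a)) * (1 / (1 + (Im z)\<^sup>2)) * 5"
    unfolding norm_corner_kernel using 1 2 exp_minus_square_le by (intro mult_mono) auto
  thus ?thesis by (simp add: mult_ac)
qed

text \<open>
  Cauchy's formula for \<open>G\<close> times the kernel \<open>k z / (z - a)\<close> and Cauchy's theorem for \<open>G\<close> times the
  reflected kernel, which has its pole at \<open>-a\<close> outside the rectangle.  On the left side the two
  kernels are complex conjugates, so that the difference of the first formula and the conjugate of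
  the second one contains \<open>G\<close> on that side only through \<open>G - cnj G\<close>.
\<close>

lemma rectangle_estimate:
  fixes G :: "complex \<Rightarrow> complex"
  assumes S: "convex S" "open S" "G holomorphic_on S" "cbox (Complex 0 (-H)) (Complex b H) \<subseteq> S"
    and a: "0 < a" "a \<le> 1 / 2" and b: "1 \<le> b" "b \<le> 3 / 2" and H: "H \<ge> 1" and l: "l \<ge> 0"
    and Q: "\<And>r. 0 \<le> r \<Longrightarrow> r \<le> b \<Longrightarrow> r * norm (G (Complex r H)) \<le> Q"
      "\<And>r. 0 \<le> r \<Longrightarrow> r \<le> b \<Longrightarrow> r * norm (G (Complex r (-H))) \<le> Q"
    and \<rho>: "\<And>v. -H \<le> v \<Longrightarrow> v \<le> H \<Longrightarrow> norm (G (Complex b v)) \<le> \<rho>"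
  shows "norm (G (of_real a)) \<le> 10 * exp 4 * (Q * exp (3 / 2 * l) * exp (- H\<^sup>2) + \<rho> * exp (l * (b - a))) +
     5 * exp 4 * exp (- l * a) / a * integral {-H..H} (\<lambda>v. \<bar>Im (G (Complex 0 v))\<bar> / (1 + v\<^sup>2))"
proof -
  let ?k = "corner_kernel l a H"
  let ?R = "rectpath (Complex 0 (-H)) (Complex b H)"
  have H0: "H > 0" using H by simp
  have PS: "path_image ?R \<subseteq> S"
    using path_image_rectpath_subset_cbox[of "Complex 0 (-H)" "Complex b H"] S(4) b H by auto
  have P: "path_image ?R = {z. Re z \<in> {0, b} \<and> Im z \<in> {-H..H}} \<union> {z. Im z \<in> {-H, H} \<and> Re z \<in> {0..b}}"
    using b H by (subst path_image_rectpath) auto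
  have Q0: "Q \<ge> 0" using Q(1)[of 0] b by simp
  have \<rho>0: "\<rho> \<ge> 0" using \<rho>[of 0] H norm_ge_zero[of "G (Complex b 0)"] by linarith
  define f1 where "f1 = (\<lambda>z. G z * ?k z / (z - of_real a))"
  define f2 where "f2 = (\<lambda>z. G z * ?k (- z) / (- z - of_real a))"
  have holk: "(\<lambda>z. ?k (- z)) holomorphic_on A" for A
    using holomorphic_on_compose[OF _ corner_kernel_holomorphic[OF H0, of l a], of uminus A]
    by (simp add: o_def holomorphic_on_minus holomorphic_on_ident)
  have aP: "of_real a \<notin> path_image ?R" using a b H by (auto simp: P)
  have S': "convex (S \<inter> {z. Re z > - a})" by (intro convex_Int S convex_halfspace_Re_gt)
  have ne2: "- z - of_real a \<noteq> 0" if "Re z > - a" for z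
  proof
    assume "- z - of_real a = 0"
    hence "Re (- z - of_real a) = 0" by simp
    thus False using that by simp
  qed
  have hol2: "f2 holomorphic_on (S \<inter> {z. Re z > - a})"
    unfolding f2_def using ne2 by (intro holomorphic_intros holk holomorphic_on_subset[OF S(3)]) auto
  have PS': "path_image ?R \<subseteq> S \<inter> {z. Re z > - a}" using PS a b by (auto simp: P)
  have cont2: "continuous_on (path_image ?R) f2"
    using holomorphic_on_imp_continuous_on[OF hol2] PS' by (rule continuous_on_subset)
  have cont1: "continuous_on (path_image ?R) f1"
  proof -
    have "f1 holomorphic_on (S - {of_real a})"
      unfolding f1_def by (intro holomorphic_intros corner_kernel_holomorphic H0 holomorphic_on_subset[OF S(3)]) auto
    from holomorphic_on_imp_continuous_on[OF this] show ?thesis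
      by (rule continuous_on_subset) (use PS aP in auto)
  qed
  have int2: "(f2 has_contour_integral 0) ?R"
    by (rule Cauchy_theorem_convex_simple[OF hol2 S' _ PS']) auto
  have inbox: "of_real a \<in> box (Complex 0 (-H)) (Complex b H)"
    using a b H by (auto simp: in_box_complex_iff)
  have int1: "(f1 has_contour_integral (2 * pi * \<i> * G (of_real a))) ?R"
  proof -
    have "((\<lambda>z. (G z * ?k z) / (z - of_real a)) has_contour_integral
      (2 * pi * \<i> * winding_number ?R (of_real a) * (G (of_real a) * ?k (of_real a)))) ?R"
    proof (rule Cauchy_integral_formula_convex_simple[OF S(1)])
      show "(\<lambda>z. G z * ?k z) holomorphic_on S" by (intro holomorphic_intros S corner_kernel_holomorphic H0)
      show "of_real a \<in> interior S"
        using inbox S(4) box_subset_cbox[of "Complex 0 (-H)" "Complex b H"] by (auto simp: interior_open[OF S(2)])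
    qed (use PS aP in auto)
    thus ?thesis using winding_number_rectpath[OF inbox] corner_kernel_at[OF H0] by (simp add: f1_def)
  qed
  let ?\<beta> = "Q * (4 * exp 4 * exp (3 / 2 * l) * exp (- H\<^sup>2))"
  let ?\<rho> = "\<rho> * (10 * exp 4 * exp (l * (b - a)))"
  have hor: "norm (g * ?k w / u) \<le> ?\<beta>"
    if g: "r * norm g \<le> Q" and w: "\<bar>Re w\<bar> = r" "\<bar>Im w\<bar> = H" and u: "norm u \<ge> 1" and r: "r \<le> b" for r g w u
  proof -
    define c where "c = 4 * exp 4 * exp (3 / 2 * l) * exp (- H\<^sup>2)"
    have c: "c \<ge> 0" by (simp add: c_def)
    have "\<bar>Re w\<bar> \<le> 3 / 2" using w r b by linarith
    from norm_corner_kernel_horizontal_le[OF l a H this w(2)] have k: "norm (?k w) \<le> c * r"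
      unfolding w c_def .
    have "norm (g * ?k w / u) = norm g * norm (?k w) / norm u" by (simp only: norm_mult norm_divide)
    also have "\<dots> \<le> norm g * norm (?k w) / 1" using u by (intro divide_left_mono) auto
    also have "\<dots> \<le> norm g * (c * r)" using mult_left_mono[OF k norm_ge_zero[of g]] by simp
    also have "\<dots> = (r * norm g) * c" by simp
    also have "\<dots> \<le> Q * c" using g c by (rule mult_right_mono)
    finally show ?thesis unfolding c_def .
  qed
  have ver: "norm (g * ?k w / u) \<le> ?\<rho> / (1 + v\<^sup>2)"
    if g: "norm g \<le> \<rho>" and w: "Re w \<le> b" "\<bar>Re w\<bar> \<le> 3 / 2" "\<bar>Im w\<bar> = \<bar>v\<bar>" "\<bar>v\<bar> \<le> H"
      and u: "norm u \<ge> 1 / 2" for v g w u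
  proof -
    have sq: "(Im w)\<^sup>2 = v\<^sup>2" using w(3) by (metis power2_abs)
    have "norm (?k w) \<le> 5 * exp 4 * exp (l * (Re w - a)) / (1 + v\<^sup>2)"
      using norm_corner_kernel_vertical_le[OF a H w(2), of l] w(3,4) unfolding sq by simp
    also have "\<dots> \<le> 5 * exp 4 * exp (l * (b - a)) / (1 + v\<^sup>2)"
      using mult_left_mono[OF _ l, of "Re w - a" "b - a"] w(1)
      by (intro divide_right_mono mult_left_mono) auto
    finally have k: "norm (?k w) \<le> 5 * exp 4 * exp (l * (b - a)) / (1 + v\<^sup>2)" .
    have "u \<noteq> 0" using u by auto
    hence u2: "1 / norm u \<le> 2" using divide_left_mono[OF u, of 1] by simp
    have "norm (g * ?k w / u) = norm g * norm (?k w) * (1 / norm u)"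
      by (simp add: norm_mult norm_divide)
    also have "\<dots> \<le> \<rho> * (5 * exp 4 * exp (l * (b - a)) / (1 + v\<^sup>2)) * 2"
      using \<rho>0 by (intro mult_mono k u2 g mult_nonneg_nonneg) auto
    also have "\<dots> = ?\<rho> / (1 + v\<^sup>2)" by simp
    finally show ?thesis .
  qed
  \<comment> \<open>\<open>V1\<close> and \<open>V2\<close> are the integrals over the left side; the other sides are small\<close>
  define V1 V2 where "V1 = integral {-H..H} (\<lambda>v. f1 (Complex 0 v))" and "V2 = integral {-H..H} (\<lambda>v. f2 (Complex 0 v))"
  have \<beta>0: "?\<beta> \<ge> 0" using Q0 by simp
  have b0: "b > 0" using b by simp
  have n1: "norm z \<ge> 1" if "\<bar>Im z\<bar> = H" for z using that H abs_Im_le_cmod[of z] by simp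
  have n2: "norm z \<ge> 1 / 2" if "\<bar>Re z\<bar> \<ge> 1 / 2" for z using that abs_Re_le_cmod[of z] by simp
  have E1: "norm (2 * pi * \<i> * G (of_real a) + \<i> * V1) \<le> 2 * ?\<beta> * b + pi * ?\<rho>"
    unfolding V1_def
  proof (rule rectangle_three_sides_bound[OF b0 H0 cont1 int1 \<beta>0])
    show "norm (f1 (Complex r H)) \<le> ?\<beta>" if "0 \<le> r" "r \<le> b" for r
      unfolding f1_def by (rule hor[of r]) (use that H0 Q(1)[OF that] in \<open>auto intro!: n1\<close>)
    show "norm (f1 (Complex r (-H))) \<le> ?\<beta>" if "0 \<le> r" "r \<le> b" for r
      unfolding f1_def by (rule hor[of r]) (use that H0 Q(2)[OF that] in \<open>auto intro!: n1\<close>)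
    show "norm (f1 (Complex b v)) \<le> ?\<rho> / (1 + v\<^sup>2)" if "-H \<le> v" "v \<le> H" for v
      unfolding f1_def by (rule ver[OF _ _ _ _ _ n2]) (use that a b \<rho>[OF that] in auto)
  qed
  have E2: "norm (0 + \<i> * V2) \<le> 2 * ?\<beta> * b + pi * ?\<rho>"
    unfolding V2_def
  proof (rule rectangle_three_sides_bound[OF b0 H0 cont2 int2 \<beta>0])
    show "norm (f2 (Complex r H)) \<le> ?\<beta>" if "0 \<le> r" "r \<le> b" for r
      unfolding f2_def by (rule hor[of r]) (use that H0 Q(1)[OF that] in \<open>auto intro!: n1\<close>)
    show "norm (f2 (Complex r (-H))) \<le> ?\<beta>" if "0 \<le> r" "r \<le> b" for r
      unfolding f2_def by (rule hor[of r]) (use that H0 Q(2)[OF that] in \<open>auto intro!: n1\<close>)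
    show "norm (f2 (Complex b v)) \<le> ?\<rho> / (1 + v\<^sup>2)" if "-H \<le> v" "v \<le> H" for v
      unfolding f2_def by (rule ver[OF _ _ _ _ _ n2]) (use that a b \<rho>[OF that] in auto)
  qed
  have cv: "continuous_on {-H..H} (\<lambda>v. f (Complex 0 v))" if "continuous_on (path_image ?R) f" for f :: "complex \<Rightarrow> complex"
  proof -
    have "continuous_on {-H..H} (\<lambda>v. Complex 0 v)" unfolding Complex_eq by (intro continuous_intros)
    thus ?thesis by (rule continuous_on_compose2[OF that]) (auto simp: P)
  qed
  have i1: "(\<lambda>v. f1 (Complex 0 v)) integrable_on {-H..H}" and i2: "(\<lambda>v. f2 (Complex 0 v)) integrable_on {-H..H}"
    using cv cont1 cont2 by (auto intro: integrable_continuous_real)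
  have diff: "f1 (Complex 0 v) - cnj (f2 (Complex 0 v)) =
      2 * \<i> * of_real (Im (G (Complex 0 v))) * (?k (Complex 0 v) / (Complex 0 v - of_real a))" for v
  proof -
    have "cnj (f2 (Complex 0 v)) = cnj (G (Complex 0 v)) * (?k (Complex 0 v) / (Complex 0 v - of_real a))"
    proof -
      have "cnj (- Complex 0 v) = Complex 0 v" by (simp add: complex_eq_iff)
      moreover have "cnj (- Complex 0 v - of_real a) = Complex 0 v - of_real a" by (simp add: complex_eq_iff)
      ultimately show ?thesis
        unfolding f2_def by (simp only: complex_cnj_mult complex_cnj_divide cnj_corner_kernel times_divide_eq_right)
    qed
    hence "f1 (Complex 0 v) - cnj (f2 (Complex 0 v)) =
       (G (Complex 0 v) - cnj (G (Complex 0 v))) * (?k (Complex 0 v) / (Complex 0 v - of_real a))"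
      by (simp only: f1_def left_diff_distrib times_divide_eq_right diff_divide_distrib)
    moreover have "G (Complex 0 v) - cnj (G (Complex 0 v)) = 2 * \<i> * of_real (Im (G (Complex 0 v)))"
      by (simp add: complex_eq_iff)
    ultimately show ?thesis by simp
  qed
  have i3: "(\<lambda>v. cnj (f2 (Complex 0 v))) integrable_on {-H..H}"
    using cv[OF cont2] by (intro integrable_continuous_real continuous_intros)
  have "V1 - cnj V2 = integral {-H..H} (\<lambda>v. f1 (Complex 0 v) - cnj (f2 (Complex 0 v)))"
    unfolding V1_def V2_def using i1 i2 i3 by (simp add: integral_diff integral_cnj)
  also have "norm \<dots> \<le> integral {-H..H} (\<lambda>v. 10 * exp 4 * exp (- l * a) / a * (\<bar>Im (G (Complex 0 v))\<bar> / (1 + v\<^sup>2)))"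
  proof (rule integral_norm_bound_integral)
    show "(\<lambda>v. f1 (Complex 0 v) - cnj (f2 (Complex 0 v))) integrable_on {-H..H}"
      using i1 i3 by (rule integrable_diff)
    have "continuous_on (path_image ?R) G"
      using holomorphic_on_imp_continuous_on[OF S(3)] PS by (rule continuous_on_subset)
    from cv[OF this] have "continuous_on {-H..H} (\<lambda>v. \<bar>Im (G (Complex 0 v))\<bar> / (1 + v\<^sup>2))"
    proof (intro continuous_intros ballI)
      show "1 + v\<^sup>2 \<noteq> 0" for v :: real using zero_le_power2[of v] by linarith
    qed
    thus "(\<lambda>v. 10 * exp 4 * exp (- l * a) / a * (\<bar>Im (G (Complex 0 v))\<bar> / (1 + v\<^sup>2))) integrable_on {-H..H}"
      by (intro integrable_on_mult_right integrable_continuous_real)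
    fix v assume v: "v \<in> {-H..H}"
    have "norm (?k (Complex 0 v)) \<le> 5 * exp 4 * exp (- l * a) / (1 + v\<^sup>2)"
    proof -
      have "\<bar>v\<bar> \<le> H" using v by auto
      thus ?thesis using norm_corner_kernel_vertical_le[of a H "Complex 0 v" l] a H by simp
    qed
    moreover have "norm (Complex 0 v - of_real a) \<ge> a"
      using abs_Re_le_cmod[of "Complex 0 v - of_real a"] a by simp
    ultimately have "norm (?k (Complex 0 v)) / norm (Complex 0 v - of_real a) \<le> (5 * exp 4 * exp (- l * a) / (1 + v\<^sup>2)) / a"
      using a by (intro frac_le) auto
    hence "2 * \<bar>Im (G (Complex 0 v))\<bar> * (norm (?k (Complex 0 v)) / norm (Complex 0 v - of_real a)) \<le>
        2 * \<bar>Im (G (Complex 0 v))\<bar> * ((5 * exp 4 * exp (- l * a) / (1 + v\<^sup>2)) / a)"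
      by (intro mult_left_mono) auto
    thus "norm (f1 (Complex 0 v) - cnj (f2 (Complex 0 v))) \<le> 10 * exp 4 * exp (- l * a) / a * (\<bar>Im (G (Complex 0 v))\<bar> / (1 + v\<^sup>2))"
      unfolding diff by (simp add: norm_mult norm_divide mult_ac)
  qed
  also have "\<dots> = 10 * exp 4 * exp (- l * a) / a * integral {-H..H} (\<lambda>v. \<bar>Im (G (Complex 0 v))\<bar> / (1 + v\<^sup>2))"
    by (rule integral_mult_right)
  finally have V: "norm (V1 - cnj V2) \<le> 10 * exp 4 * exp (- l * a) / a * integral {-H..H} (\<lambda>v. \<bar>Im (G (Complex 0 v))\<bar> / (1 + v\<^sup>2))" .
  define W where "W = 5 * exp 4 * exp (- l * a) / a * integral {-H..H} (\<lambda>v. \<bar>Im (G (Complex 0 v))\<bar> / (1 + v\<^sup>2))"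
  have "10 * exp 4 * exp (- l * a) / a * integral {-H..H} (\<lambda>v. \<bar>Im (G (Complex 0 v))\<bar> / (1 + v\<^sup>2)) = 2 * W"
    unfolding W_def by simp
  hence V': "norm (V1 - cnj V2) \<le> 2 * W" using V by (simp only:)
  have W0: "W \<ge> 0" using order_trans[OF norm_ge_zero V'] by simp
  have identity: "p = (p + \<i> * x) - \<i> * (x - y) + - (\<i> * y)" for p x y :: complex
    by (simp add: right_diff_distrib)
  have "cnj (\<i> * V2) = - (\<i> * cnj V2)" by simp
  hence eq: "2 * pi * \<i> * G (of_real a) = (2 * pi * \<i> * G (of_real a) + \<i> * V1) - \<i> * (V1 - cnj V2) + cnj (\<i> * V2)"
    using identity[of "2 * pi * \<i> * G (of_real a)" V1 "cnj V2"] by (simp only:)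
  have norm3: "norm (p - q + r) \<le> x + y + z" if "norm p \<le> x" "norm q \<le> y" "norm r \<le> z" for p q r :: complex and x y z
    using norm_triangle_ineq[of "p - q" r] norm_triangle_ineq4[of p q] that by linarith
  have "norm (2 * pi * \<i> * G (of_real a)) \<le> (2 * ?\<beta> * b + pi * ?\<rho>) + 2 * W + (2 * ?\<beta> * b + pi * ?\<rho>)"
  proof (subst eq, rule norm3[OF E1])
    show "norm (\<i> * (V1 - cnj V2)) \<le> 2 * W" using V' by (simp add: norm_mult)
    show "norm (cnj (\<i> * V2)) \<le> 2 * ?\<beta> * b + pi * ?\<rho>"
      using E2 by (simp only: complex_mod_cnj add_0_left)
  qed
  moreover have "norm (2 * pi * \<i> * G (of_real a)) = 2 * pi * norm (G (of_real a))"
    by (simp add: norm_mult)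
  ultimately have big: "2 * pi * norm (G (of_real a)) \<le> (2 * ?\<beta> * b + pi * ?\<rho>) + 2 * W + (2 * ?\<beta> * b + pi * ?\<rho>)"
    by (simp only:)
  have cancel: "x \<le> \<beta> + \<rho>' + W"
    if "2 * pi * x \<le> (2 * \<beta> * b + pi * \<rho>') + 2 * W + (2 * \<beta> * b + pi * \<rho>')" "0 \<le> \<beta>" for x \<beta> \<rho>' :: real
  proof -
    have "b * \<beta> \<le> 3 / 2 * \<beta>" by (rule mult_right_mono[OF b(2) that(2)])
    moreover have "3 * \<beta> \<le> pi * \<beta>" by (rule mult_right_mono[OF less_imp_le[OF pi_gt3] that(2)])
    moreover have "1 * W \<le> pi * W" by (rule mult_right_mono[OF _ W0]) (use pi_gt3 in linarith)
    moreover have "2 * \<beta> * b = 2 * (b * \<beta>)" "2 * pi * x = 2 * (pi * x)" by simp_all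
    ultimately have "pi * x \<le> pi * \<beta> + pi * \<rho>' + pi * W" using that(1) by linarith
    also have "\<dots> = pi * (\<beta> + \<rho>' + W)" by (simp only: distrib_left)
    finally show ?thesis using pi_gt_zero by (simp only: mult_le_cancel_left_pos)
  qed
  have "norm (G (of_real a)) \<le> ?\<beta> + ?\<rho> + W" by (rule cancel[OF big \<beta>0])
  also have "\<dots> \<le> 10 * exp 4 * (Q * exp (3 / 2 * l) * exp (- H\<^sup>2) + \<rho> * exp (l * (b - a))) + W"
  proof (rule add_right_mono)
    have poly: "Q * (4 * e * p * q) + \<rho> * (10 * e * r) \<le> 10 * e * (Q * p * q + \<rho> * r)"
      if "e \<ge> 0" "p \<ge> 0" "q \<ge> 0" for e p q r :: real
    proof -
      have "0 \<le> 6 * (e * Q * p * q)" using that Q0 by (intro mult_nonneg_nonneg) auto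
      moreover have "10 * e * (Q * p * q + \<rho> * r) - (Q * (4 * e * p * q) + \<rho> * (10 * e * r)) = 6 * (e * Q * p * q)"
        by (simp add: algebra_simps)
      ultimately show ?thesis by linarith
    qed
    show "?\<beta> + ?\<rho> \<le> 10 * exp 4 * (Q * exp (3 / 2 * l) * exp (- H\<^sup>2) + \<rho> * exp (l * (b - a)))"
      by (rule poly) (rule exp_ge_zero)+
  qed
  finally show ?thesis unfolding W_def .
qed

section \<open>Boundary values on the critical line\<close>

text \<open>
  A zero of order \<open>n\<close> on the boundary contributes \<open>n * Ln (s - \<rho>)\<close> to the logarithm, and the
  imaginary part of this term is bounded by \<open>n * pi\<close> on a half plane bounded by a line through \<open>\<rho>\<close>.
\<close>

lemma Im_log_bounded_near_boundary_point:
  assumes f: "f holomorphic_on S" "open S" "connected S" "\<rho> \<in> S" "w0 \<in> S" "f w0 \<noteq> 0"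
    and W: "convex W" "\<And>s. s \<in> W \<Longrightarrow> Re s > Re \<rho>"
    and F: "continuous_on W F" "\<And>s. s \<in> W \<Longrightarrow> exp (F s) = f s"
  obtains r M where "r > 0" "\<And>s. s \<in> W \<Longrightarrow> dist \<rho> s < r \<Longrightarrow> \<bar>Im (F s)\<bar> \<le> M"
proof -
  define g where "g = zor_poly f \<rho>"
  define n where "n = nat (zorder f \<rho>)"
  have "\<exists>w\<in>S. f w \<noteq> 0" using f by blast
  from zorder_exist_zero[OF f(1-4) this] obtain r where r: "r > 0" "g holomorphic_on cball \<rho> r"
    "\<And>w. w \<in> cball \<rho> r \<Longrightarrow> f w = g w * (w - \<rho>) ^ n \<and> g w \<noteq> 0"
    unfolding g_def n_def by blast
  have "g holomorphic_on ball \<rho> r" by (rule holomorphic_on_subset[OF r(2)]) auto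
  moreover have "g w \<noteq> 0" if "w \<in> ball \<rho> r" for w using r(3)[of w] that by auto
  ultimately obtain h where h: "h holomorphic_on ball \<rho> r" "\<And>w. w \<in> ball \<rho> r \<Longrightarrow> g w = exp (h w)"
    by (rule holomorphic_log_on_convex[OF convex_ball open_ball]) blast+
  have ch: "continuous_on (ball \<rho> r) h" by (rule holomorphic_on_imp_continuous_on[OF h(1)])
  have "compact (h ` cball \<rho> (r / 2))"
    by (intro compact_continuous_image continuous_on_subset[OF ch]) (use r(1) in auto)
  hence "bounded (h ` cball \<rho> (r / 2))" by (rule compact_imp_bounded)
  then obtain B where B: "\<And>w. w \<in> cball \<rho> (r / 2) \<Longrightarrow> norm (h w) \<le> B"
    unfolding bounded_iff by blast
  let ?T = "W \<inter> ball \<rho> r"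
  have nr: "s - \<rho> \<notin> \<real>\<^sub>\<le>\<^sub>0" if "s \<in> W" for s
    using W(2)[OF that] by (auto simp: complex_nonpos_Reals_iff)
  have "\<exists>c. exp c = 1 \<and> (\<forall>s\<in>?T. F s = (of_nat n * Ln (s - \<rho>) + h s) + c)"
  proof (rule continuous_logs_differ_by_constant)
    show "connected ?T" by (intro convex_connected convex_Int W convex_ball)
    show "continuous_on ?T F" by (rule continuous_on_subset[OF F(1)]) auto
    show "continuous_on ?T (\<lambda>s. of_nat n * Ln (s - \<rho>) + h s)"
      using nr by (intro continuous_intros continuous_on_subset[OF ch]) auto
    fix s assume s: "s \<in> ?T"
    have "s \<noteq> \<rho>" using W(2)[of s] s by auto
    hence "exp (of_nat n * Ln (s - \<rho>) + h s) = (s - \<rho>) ^ n * exp (h s)"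
      by (simp add: exp_add exp_of_nat_mult)
    also have "\<dots> = f s" using h(2)[of s] r(3)[of s] s by (simp add: mult.commute)
    finally show "exp (F s) = exp (of_nat n * Ln (s - \<rho>) + h s)" using F(2) s by simp
  qed
  then obtain c where c: "\<And>s. s \<in> ?T \<Longrightarrow> F s = (of_nat n * Ln (s - \<rho>) + h s) + c" by blast
  show ?thesis
  proof (rule that[of "r / 2" "real n * pi + B + \<bar>Im c\<bar>"])
    show "r / 2 > 0" using r by simp
    fix s assume s: "s \<in> W" "dist \<rho> s < r / 2"
    have sT: "s \<in> ?T" using s r(1) by auto
    have "s \<noteq> \<rho>" using W(2)[of s] s by auto
    hence "\<bar>Im (Ln (s - \<rho>))\<bar> \<le> pi" using Im_Ln_le_pi[of "s - \<rho>"] mpi_less_Im_Ln[of "s - \<rho>"] by simp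
    hence 1: "\<bar>real n * Im (Ln (s - \<rho>))\<bar> \<le> real n * pi" by (simp add: abs_mult mult_left_mono)
    have 2: "\<bar>Im (h s)\<bar> \<le> B" using B[of s] s abs_Im_le_cmod[of "h s"] by auto
    have "Im (F s) = real n * Im (Ln (s - \<rho>)) + Im (h s) + Im c" using c[OF sT] by simp
    thus "\<bar>Im (F s)\<bar> \<le> real n * pi + B + \<bar>Im c\<bar>" using 1 2 by linarith
  qed
qed

lemma connected_minus_1: "connected (- {1 :: complex})"
  by (intro connected_punctured_universe) auto

lemma zeta_2_nonzero: "zeta 2 \<noteq> 0"
  by (rule exp_euler_log_tendsto(2)) simp

text \<open>
  A compactness argument without any uniformity in the height: the bound serves as a dominating
  function and shows that the supremum in \<open>zeta_L\<close> is that of a bounded set.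
\<close>

lemma Im_log_zeta_bounded_near_critical_line:
  assumes DF: "log_zeta_branch D F" and \<alpha>: "\<alpha> > 1"
  obtains d M where "d > 0"
    "\<And>\<delta> u. 0 < \<delta> \<Longrightarrow> \<delta> < d \<Longrightarrow> \<alpha> \<le> u \<Longrightarrow> u \<le> \<beta> \<Longrightarrow> \<bar>Im (F (Complex (1 / 2 + \<delta>) u))\<bar> \<le> M"
proof -
  note B = log_zeta_branchD[OF DF]
  have "\<exists>d>0. \<exists>M. \<forall>\<delta> u. 0 < \<delta> \<and> \<delta> < d \<and> \<alpha> \<le> u \<and> u \<le> \<beta> \<longrightarrow> \<bar>Im (F (Complex (1 / 2 + \<delta>) u))\<bar> \<le> M"
  proof (rule ccontr)
    assume neg: "\<not> ?thesis"
    have "\<exists>\<delta> u. 0 < \<delta> \<and> \<delta> < 1 / real (Suc n) \<and> \<alpha> \<le> u \<and> u \<le> \<beta> \<and> \<not> \<bar>Im (F (Complex (1 / 2 + \<delta>) u))\<bar> \<le> real n" for n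
      using neg by (metis divide_pos_pos of_nat_0_less_iff zero_less_Suc zero_less_one)
    then obtain \<delta> u where du: "\<And>n. 0 < \<delta> n" "\<And>n. \<delta> n < 1 / real (Suc n)" "\<And>n. \<alpha> \<le> u n" "\<And>n. u n \<le> \<beta>"
      "\<And>n. \<not> \<bar>Im (F (Complex (1 / 2 + \<delta> n) (u n)))\<bar> \<le> real n"
      by metis
    have "\<forall>n. u n \<in> {\<alpha>..\<beta>}" using du by auto
    then obtain l \<phi> where l: "l \<in> {\<alpha>..\<beta>}" "strict_mono \<phi>" "(u \<circ> \<phi>) \<longlonglongrightarrow> l"
      using compact_Icc[of \<alpha> \<beta>] unfolding compact_def by blast
    obtain r M where r: "r > 0" "\<And>s. s \<in> zeta_strip \<Longrightarrow> dist (Complex (1 / 2) l) s < r \<Longrightarrow> \<bar>Im (F s)\<bar> \<le> M"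
    proof (rule Im_log_bounded_near_boundary_point[OF zeta_holomorphic _ connected_minus_1 _ _ zeta_2_nonzero convex_zeta_strip,
           where \<rho> = "Complex (1 / 2) l" and F = F])
      show "continuous_on zeta_strip F" by (rule holomorphic_on_imp_continuous_on[OF B(5)])
      show "Complex (1 / 2) l \<in> - {1}" by (auto simp: complex_eq_iff)
    qed (use B(6) in \<open>auto simp: zeta_strip_def\<close>)
    have d0: "\<delta> \<longlonglongrightarrow> 0"
    proof (rule tendsto_sandwich[OF _ _ tendsto_const LIMSEQ_Suc[OF lim_1_over_n]])
      show "\<forall>\<^sub>F n in sequentially. 0 \<le> \<delta> n" by (intro always_eventually allI less_imp_le du)
      show "\<forall>\<^sub>F n in sequentially. \<delta> n \<le> 1 / real (Suc n)" by (intro always_eventually allI less_imp_le du)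
    qed
    have "(\<lambda>n. Complex (1 / 2 + (\<delta> \<circ> \<phi>) n) ((u \<circ> \<phi>) n)) \<longlonglongrightarrow> Complex (1 / 2 + 0) l"
      by (intro tendsto_intros l LIMSEQ_subseq_LIMSEQ[OF d0])
    hence "\<forall>\<^sub>F n in sequentially. dist (Complex (1 / 2 + (\<delta> \<circ> \<phi>) n) ((u \<circ> \<phi>) n)) (Complex (1 / 2 + 0) l) < r"
      using r(1) by (rule tendstoD)
    moreover have "\<forall>\<^sub>F n in sequentially. real n > M" 
      using filterlim_real_sequentially by (simp add: filterlim_at_top_dense)
    ultimately have "\<forall>\<^sub>F n in sequentially. False"
    proof eventually_elim
      case (elim n)
      have "Complex (1 / 2 + \<delta> (\<phi> n)) (u (\<phi> n)) \<in> zeta_strip"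
        using du(1)[of "\<phi> n"] du(3)[of "\<phi> n"] \<alpha> by (auto simp: zeta_strip_def)
      hence "\<bar>Im (F (Complex (1 / 2 + \<delta> (\<phi> n)) (u (\<phi> n))))\<bar> \<le> M"
        using elim(1) by (intro r) (auto simp: dist_commute)
      also have "M < real n" by (rule elim)
      also have "real n \<le> real (\<phi> n)" using seq_suble[OF l(2), of n] by simp
      finally show False using du(5)[of "\<phi> n"] by simp
    qed
    thus False by simp
  qed
  thus ?thesis using that by blast
qed

text \<open>
  Along the path that defines \<open>zeta_S u\<close>, a continuous argument of \<open>\<zeta>\<close> differs from the imaginary
  part of the branch by a constant: first from \<open>D\<close> up to \<open>2 + iu\<close>, then from \<open>F\<close>.
\<close>

lemma Im_log_zeta_tendsto_zeta_S:
  assumes RH: riemann_hypothesis and DF: "log_zeta_branch D F" and u: "u > 1" and no: "\<not> zero_ordinate u"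
  shows "((\<lambda>\<delta>. Im (F (Complex (1 / 2 + \<delta>) u))) \<longlongrightarrow> pi * zeta_S u) (at_right 0)"
proof -
  note B = log_zeta_branchD[OF DF]
  define q where "q = zeta_path u"
  define p where "p = zeta \<circ> q"
  have q1: "q x = Complex 2 (2 * x * u)" if "x \<le> 1 / 2" for x
    using that by (simp add: q_def zeta_path_def joinpaths_def linepath_def complex_eq_iff algebra_simps)
  have q2: "q x = Complex (1 / 2 + 3 * (1 - x)) u" if "x \<ge> 1 / 2" for x
  proof (cases "x = 1 / 2")
    case True
    thus ?thesis using q1[of x] by simp
  next
    case False
    thus ?thesis using that by (simp add: q_def zeta_path_def joinpaths_def linepath_def complex_eq_iff algebra_simps)
  qed
  have pq: "path q" unfolding q_def zeta_path_def by (intro path_join_imp path_linepath) simp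
  have zh: "zeta (Complex (1 / 2) u) \<noteq> 0" using no unfolding zero_ordinate_def by force
  have strip: "q x \<in> zeta_strip" if "1 / 2 \<le> x" "x < 1" for x
    using q2[of x] that u by (simp add: zeta_strip_def)
  have nz: "zeta (q x) \<noteq> 0" if x: "x \<in> {0..1}" for x
  proof -
    consider "x \<le> 1 / 2" | "1 / 2 < x" "x < 1" | "x = 1" using x by force
    thus ?thesis
    proof cases
      case 1
      thus ?thesis using q1[OF 1] exp_euler_log_tendsto(2)[of "q x"] by simp
    next
      case 2
      thus ?thesis using B(6)[OF strip[of x]] exp_not_eq_zero[of "F (q x)"] by auto
    next
      case 3
      thus ?thesis using q2[of 1] zh by simp
    qed
  qed
  have n1: "q x \<noteq> 1" if x: "x \<in> {0..1}" for x
    using q1[of x] q2[of x] u by (cases "x \<le> 1 / 2") (auto simp: complex_eq_iff)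
  have cp: "continuous_on {0..1} p"
    unfolding p_def
  proof (rule continuous_on_compose)
    show "continuous_on {0..1} q" using pq by (simp add: path_def)
    show "continuous_on (q ` {0..1}) zeta"
      using holomorphic_on_imp_continuous_on[OF zeta_holomorphic] by (rule continuous_on_subset) (use n1 in auto)
  qed
  have "path p" using cp by (simp add: path_def)
  moreover have "0 \<notin> path_image p" using nz by (auto simp: path_image_def p_def)
  ultimately have ex1: "\<exists>!d. \<exists>\<theta>. continuous_on {0..1} \<theta> \<and>
     (\<forall>x\<in>{0..1}. p x = of_real (cmod (p x)) * cis (\<theta> x)) \<and> d = \<theta> 1 - \<theta> 0"
    by (rule arg_change_unique)
  from theI'[OF ex1] obtain \<theta> where \<theta>: "continuous_on {0..1} \<theta>"
    "\<And>x. x \<in> {0..1} \<Longrightarrow> p x = of_real (cmod (p x)) * cis (\<theta> x)" "arg_change p = \<theta> 1 - \<theta> 0"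
    unfolding arg_change_def[symmetric] by blast
  define A where "A = (\<lambda>x. Complex (ln (cmod (p x))) (\<theta> x))"
  have pnz: "p x \<noteq> 0" if "x \<in> {0..1}" for x using nz[OF that] by (simp add: p_def)
  have cA: "continuous_on {0..1} A"
    unfolding A_def Complex_eq using pnz by (intro continuous_intros cp \<theta>) auto
  have eA: "exp (A x) = p x" if x: "x \<in> {0..1}" for x
    using \<theta>(2)[OF x] pnz[OF x] by (subst exp_eq_polar) (simp add: A_def)
  have cq: "continuous_on T q" if "T \<subseteq> {0..1}" for T
    using pq that unfolding path_def by (rule continuous_on_subset)
  have "\<exists>c. exp c = 1 \<and> (\<forall>x\<in>{0..1/2}. A x = D (q x) + c)"
  proof (rule continuous_logs_differ_by_constant)
    show "continuous_on {0..1/2} A" by (rule continuous_on_subset[OF cA]) auto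
    show "continuous_on {0..1/2} (\<lambda>x. D (q x))"
      by (rule continuous_on_compose2[OF B(1) cq]) (auto simp: q1)
    show "exp (A x) = exp (D (q x))" if "x \<in> {0..1/2}" for x
      using that eA[of x] B(2)[of "q x"] q1[of x] by (simp add: p_def)
  qed simp
  then obtain c1 where c1: "\<And>x. x \<in> {0..1/2} \<Longrightarrow> A x = D (q x) + c1" by blast
  have "\<exists>c. exp c = 1 \<and> (\<forall>x\<in>{1/2..<1}. A x = F (q x) + c)"
  proof (rule continuous_logs_differ_by_constant)
    show "continuous_on {1/2..<1} A" by (rule continuous_on_subset[OF cA]) auto
    show "continuous_on {1/2..<1} (\<lambda>x. F (q x))"
      by (rule continuous_on_compose2[OF holomorphic_on_imp_continuous_on[OF B(5)] cq]) (auto simp: strip)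
    show "exp (A x) = exp (F (q x))" if "x \<in> {1/2..<1}" for x
      using that eA[of x] B(6)[OF strip[of x]] by (simp add: p_def)
  qed simp
  then obtain c2 where c2: "\<And>x. x \<in> {1/2..<1} \<Longrightarrow> A x = F (q x) + c2" by blast
  have "D (q (1/2)) = F (q (1/2))" using B(7)[of "q (1/2)"] q1[of "1/2"] u by simp
  hence c12: "c1 = c2" using c1[of "1/2"] c2[of "1/2"] by simp
  have "q 0 = 2" using q1[of 0] by (simp add: complex_eq_iff)
  hence "A 0 = D 2 + c1" using c1[of 0] by simp
  hence "Im (A 0) = Im (D 2 + c1)" by (rule arg_cong)
  hence "\<theta> 0 = Im c1" using B(3) by (simp add: A_def)
  hence ImF: "Im (F (Complex (1 / 2 + \<delta>) u)) = \<theta> (1 - \<delta> / 3) - \<theta> 0" if "0 < \<delta>" "\<delta> \<le> 3 / 2" for \<delta>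
  proof -
    have "q (1 - \<delta> / 3) = Complex (1 / 2 + \<delta>) u" using q2[of "1 - \<delta> / 3"] that by simp
    moreover have "A (1 - \<delta> / 3) = F (q (1 - \<delta> / 3)) + c2" using that by (intro c2) auto
    hence "Im (A (1 - \<delta> / 3)) = Im (F (q (1 - \<delta> / 3)) + c2)" by simp
    hence "\<theta> (1 - \<delta> / 3) = Im (F (q (1 - \<delta> / 3))) + Im c2" by (simp add: A_def)
    ultimately show ?thesis using c12 \<open>\<theta> 0 = Im c1\<close> by simp
  qed
  have lim: "((\<lambda>\<delta>. \<theta> (1 - \<delta> / 3) - \<theta> 0) \<longlongrightarrow> \<theta> 1 - \<theta> 0) (at_right 0)"
  proof -
    have "(\<theta> \<longlongrightarrow> \<theta> 1) (at 1 within {0..1})" using \<theta>(1) by (simp add: continuous_on_def)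
    moreover have "filterlim (\<lambda>\<delta>::real. 1 - \<delta> / 3) (at 1 within {0..1}) (at_right 0)"
      unfolding filterlim_at
    proof
      show "\<forall>\<^sub>F \<delta>::real in at_right 0. 1 - \<delta> / 3 \<in> {0..1} \<and> 1 - \<delta> / 3 \<noteq> 1"
        using eventually_at_right_real[of 0 3] by (auto elim!: eventually_mono)
      have "((\<lambda>\<delta>::real. 1 - \<delta> / 3) \<longlongrightarrow> 1 - 0 / 3) (at_right 0)" by (intro tendsto_intros) auto
      thus "((\<lambda>\<delta>::real. 1 - \<delta> / 3) \<longlongrightarrow> 1) (at_right 0)" by simp
    qed
    ultimately have "((\<lambda>\<delta>. \<theta> (1 - \<delta> / 3)) \<longlongrightarrow> \<theta> 1) (at_right 0)" by (rule filterlim_compose)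
    thus ?thesis by (intro tendsto_intros)
  qed
  have "((\<lambda>\<delta>. Im (F (Complex (1 / 2 + \<delta>) u))) \<longlongrightarrow> \<theta> 1 - \<theta> 0) (at_right 0)"
  proof (rule Lim_transform_eventually[OF lim])
    have "\<forall>\<^sub>F \<delta>::real in at_right 0. \<delta> \<in> {0<..<1}" by (rule eventually_at_right_real) simp
    thus "\<forall>\<^sub>F \<delta> in at_right 0. \<theta> (1 - \<delta> / 3) - \<theta> 0 = Im (F (Complex (1 / 2 + \<delta>) u))"
      by eventually_elim (use ImF in auto)
  qed
  moreover have "pi * zeta_S u = \<theta> 1 - \<theta> 0"
    using no \<theta>(3) by (simp add: zeta_S_def p_def q_def)
  ultimately show ?thesis by simp
qed

lemma finite_zero_ordinates:
  assumes riemann_hypothesis "\<alpha> > 0"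
  shows "finite {u \<in> {\<alpha>..\<beta>}. zero_ordinate u}"
proof -
  let ?K = "(\<lambda>u. Complex (1 / 2) u) ` {\<alpha>..\<beta>}"
  have "finite {z \<in> ?K. zeta z = 0}" if "\<not> zeta constant_on - {1}"
  proof (rule holomorphic_compact_finite_zeros[OF zeta_holomorphic])
    show "compact ?K" unfolding Complex_eq by (intro compact_continuous_image continuous_intros) auto
    show "?K \<subseteq> - {1}" by (auto simp: complex_eq_iff)
  qed (use that in \<open>auto simp: connected_minus_1\<close>)
  moreover have "{z \<in> ?K. zeta z = 0} = {}" if const: "zeta constant_on - {1}"
  proof -
    from const obtain c where "\<And>z. z \<noteq> 1 \<Longrightarrow> zeta z = c" unfolding constant_on_def by auto
    from this[of 2] this show ?thesis using zeta_2_nonzero by (auto simp: complex_eq_iff)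
  qed
  ultimately have "finite {z \<in> ?K. zeta z = 0}" by (metis finite.emptyI)
  hence "finite (Im ` {z \<in> ?K. zeta z = 0})" by (rule finite_imageI)
  moreover have "{u \<in> {\<alpha>..\<beta>}. zero_ordinate u} \<subseteq> Im ` {z \<in> ?K. zeta z = 0}"
  proof
    fix u assume "u \<in> {u \<in> {\<alpha>..\<beta>}. zero_ordinate u}"
    then obtain b where b: "u \<in> {\<alpha>..\<beta>}" "0 < b" "b < 1" "zeta (Complex b u) = 0"
      by (auto simp: zero_ordinate_def)
    hence "b = 1 / 2" using assms(1) unfolding riemann_hypothesis_def by force
    hence "zeta (Complex (1 / 2) u) = 0" using b(4) by (simp only:)
    thus "u \<in> Im ` {z \<in> ?K. zeta z = 0}" using b by (intro image_eqI[of _ _ "Complex (1 / 2) u"]) auto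
  qed
  ultimately show ?thesis by (rule finite_subset[rotated])
qed

text \<open>
  At heights that are not ordinates \<open>zeta_S\<close> inherits the bound of \<open>Im (log \<zeta>)\<close> to the right of the
  critical line, and the ordinates in a compact interval add only finitely many values.
\<close>

lemma zeta_S_le_zeta_L:
  assumes RH: riemann_hypothesis and DF: "log_zeta_branch D F"
    and t: "t - C * ln (ln t) > 1" and u: "\<bar>u - t\<bar> \<le> C * ln (ln t)"
  shows "\<bar>zeta_S u\<bar> \<le> zeta_L C t"
proof -
  define H where "H = C * ln (ln t)"
  obtain d M where d: "d > 0"
    "\<And>\<delta> u. 0 < \<delta> \<Longrightarrow> \<delta> < d \<Longrightarrow> t - H \<le> u \<Longrightarrow> u \<le> t + H \<Longrightarrow> \<bar>Im (F (Complex (1 / 2 + \<delta>) u))\<bar> \<le> M"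
    using Im_log_zeta_bounded_near_critical_line[OF DF, of "t - H" "t + H"] t unfolding H_def by blast
  let ?Z = "{u \<in> {t - H..t + H}. zero_ordinate u}"
  have fin: "finite ?Z" using t by (intro finite_zero_ordinates RH) (auto simp: H_def)
  have "\<bar>zeta_S v\<bar> \<le> max (M / pi) (Max (insert 0 ((\<lambda>v. \<bar>zeta_S v\<bar>) ` ?Z)))" if v: "\<bar>v - t\<bar> \<le> H" for v
  proof (cases "zero_ordinate v")
    case True
    hence "v \<in> ?Z" using v by auto
    hence "\<bar>zeta_S v\<bar> \<le> Max (insert 0 ((\<lambda>v. \<bar>zeta_S v\<bar>) ` ?Z))" using fin by (intro Max_ge) auto
    thus ?thesis by simp
  next
    case False
    have v1: "v > 1" using v t by (simp add: H_def abs_le_iff)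
    have "((\<lambda>\<delta>. \<bar>Im (F (Complex (1 / 2 + \<delta>) v))\<bar>) \<longlongrightarrow> \<bar>pi * zeta_S v\<bar>) (at_right 0)"
      by (intro tendsto_intros Im_log_zeta_tendsto_zeta_S[OF RH DF v1 False])
    moreover have "\<forall>\<^sub>F \<delta> in at_right 0. \<bar>Im (F (Complex (1 / 2 + \<delta>) v))\<bar> \<le> M"
      using eventually_at_right_real[OF d(1)] by eventually_elim (use v in \<open>auto intro!: d(2)\<close>)
    ultimately have "\<bar>pi * zeta_S v\<bar> \<le> M" by (rule tendsto_upperbound) simp
    hence "\<bar>zeta_S v\<bar> \<le> M / pi" by (simp add: abs_mult field_simps)
    thus ?thesis by simp
  qed
  hence "bdd_above ((\<lambda>u. \<bar>zeta_S u\<bar>) ` {u. \<bar>u - t\<bar> \<le> H})" by (intro bdd_aboveI2) auto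
  thus ?thesis unfolding zeta_L_def H_def[symmetric] using u by (intro cSUP_upper) (auto simp: H_def)
qed

section \<open>The conditional estimate of \<open>log \<zeta>\<close>\<close>

text \<open>
  Lemma \<open>rectangle_estimate\<close> is applied to \<open>log \<zeta>\<close> minus the logarithm of the partial Euler product,
  with the left side at distance \<open>\<delta>\<close> from the critical line, and then \<open>\<delta>\<close> tends to 0.  In the
  limit the imaginary part of \<open>log \<zeta>\<close> on the left side is \<open>pi * zeta_S\<close>, except at finitely many
  heights.  On the left side the Euler product is as large as \<open>p0\<close>, which the factor \<open>exp (- l * a)\<close>
  reduces to the same order as the primes up to \<open>2 ^ J\<close> contribute at \<open>1/2 + a\<close>.
\<close>

lemma log_zeta_minus_euler_log_bound:
  assumes RH: riemann_hypothesis and DF: "log_zeta_branch D F"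
    and K: "\<And>s. 1 / 2 < Re s \<Longrightarrow> Re s \<le> 2 \<Longrightarrow> Im s \<ge> 3 \<Longrightarrow> norm (F s) \<le> K * ln (Im s) / (Re s - 1 / 2)" "K > 0"
    and a: "0 < a" "a < 1 / 2" and H: "H \<ge> 1" and t: "t - H \<ge> 3"
    and L: "\<And>u. \<bar>u - t\<bar> \<le> H \<Longrightarrow> \<bar>zeta_S u\<bar> \<le> L"
    and p0: "\<And>s. Re s \<ge> 1 / 2 \<Longrightarrow> norm (euler_log (2 ^ J) s) \<le> p0"
    and l: "l = real J * ln 2"
  shows "norm (F (Complex (1 / 2 + a) t) - euler_log (2 ^ J) (Complex (1 / 2 + a) t)) \<le>
     10 * exp 4 * ((K * ln (t + H) + 3 / 2 * p0) * exp (3 / 2 * l) * exp (- H\<^sup>2) +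
        32 / (2 ^ J * (real J + 1)) * exp (l * (3 / 2 - a))) +
     5 * exp 4 * exp (- l * a) / a * (pi * L * pi + p0 * pi)"
proof -
  note B = log_zeta_branchD[OF DF]
  define E where "E = euler_log (2 ^ J)"
  define X where "X = norm (F (Complex (1 / 2 + a) t) - E (Complex (1 / 2 + a) t))"
  define Q where "Q = K * ln (t + H) + 3 / 2 * p0"
  define \<rho> where "\<rho> = 32 / (2 ^ J * (real J + 1))"
  define R where "R = 10 * exp 4 * (Q * exp (3 / 2 * l) * exp (- H\<^sup>2) + \<rho> * exp (l * (3 / 2 - a)))"
  define I where "I = (\<lambda>\<delta>. integral {-H..H} (\<lambda>v. \<bar>Im (F (Complex (1 / 2 + \<delta>) (t + v)))\<bar> / (1 + v\<^sup>2)))"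
  have p00: "p0 \<ge> 0" using p0[of 1] order_trans[OF norm_ge_zero] by fastforce
  have l0: "l \<ge> 0" using l by simp
  have nz: "1 + v\<^sup>2 \<noteq> 0" for v :: real using zero_le_power2[of v] by linarith
  have v0: "1 + v\<^sup>2 > 0" for v :: real using zero_le_power2[of v] by linarith
  have cF: "continuous_on {-H..H} (\<lambda>v. F (Complex (1 / 2 + \<delta>) (t + v)))" if "\<delta> > 0" for \<delta>
  proof (rule continuous_on_compose2[OF holomorphic_on_imp_continuous_on[OF B(5)]])
    show "continuous_on {-H..H} (\<lambda>v. Complex (1 / 2 + \<delta>) (t + v))"
      unfolding Complex_eq by (intro continuous_intros)
  qed (use that t in \<open>auto simp: zeta_strip_def\<close>)
  have contf: "continuous_on {-H..H} (\<lambda>v. \<bar>Im (F (Complex (1 / 2 + \<delta>) (t + v)))\<bar> / (1 + v\<^sup>2))" if "\<delta> > 0" for \<delta>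
    using nz by (intro continuous_intros cF that) auto
  have step: "X \<le> R + 5 * exp 4 * exp (- l * (a - \<delta>)) / (a - \<delta>) * (I \<delta> + p0 * pi)"
    if d: "0 < \<delta>" "\<delta> < a" for \<delta>
  proof -
    \<comment> \<open>\<open>c\<close> is the midpoint of the left side, which the rectangle of the estimate has at the origin\<close>
    define c where "c = Complex (1 / 2 + \<delta>) t"
    define G where "G = (\<lambda>z. F (z + c) - E (z + c))"
    define S where "S = {z. Re z > - \<delta>} \<inter> {z. Im z > 1 - t}"
    have inS: "z + c \<in> zeta_strip" if "z \<in> S" for z
      using that by (auto simp: S_def zeta_strip_def c_def)
    have E0: "E holomorphic_on zeta_strip"
      unfolding E_def by (rule holomorphic_on_subset[OF euler_log_holomorphic]) (auto simp: zeta_strip_def)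
    have cp: "Complex x y + c = Complex (1 / 2 + \<delta> + x) (t + y)" for x y
      by (simp add: c_def complex_eq_iff)
    have Eb: "norm (E s) \<le> p0" if "Re s \<ge> 1 / 2" for s
      unfolding E_def using that by (rule p0)
    have hor: "r * norm (G (Complex r y)) \<le> Q" if r: "0 \<le> r" "r \<le> 3 / 2 - \<delta>" and y: "y = H \<or> y = - H" for r y
    proof -
      have "norm (F (Complex r y + c)) \<le> K * ln (t + y) / (\<delta> + r)"
        using K(1)[of "Complex r y + c"] r y t d H unfolding cp by auto
      also have "\<dots> \<le> K * ln (t + H) / (\<delta> + r)"
        using r y t d H K(2) by (intro divide_right_mono mult_left_mono ln_mono) auto
      finally have "r * norm (F (Complex r y + c)) \<le> r * (K * ln (t + H) / (\<delta> + r))"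
        using r(1) by (rule mult_left_mono)
      also have "\<dots> = K * ln (t + H) * (r / (\<delta> + r))" by simp
      also have "\<dots> \<le> K * ln (t + H) * 1"
        using r d K(2) t H by (intro mult_left_mono mult_nonneg_nonneg ln_ge_zero) auto
      finally have 1: "r * norm (F (Complex r y + c)) \<le> K * ln (t + H)" by simp
      have 2: "r * norm (E (Complex r y + c)) \<le> 3 / 2 * p0"
        using r d p00 by (intro mult_mono Eb) (auto simp: cp)
      have "norm (G (Complex r y)) \<le> norm (F (Complex r y + c)) + norm (E (Complex r y + c))"
        unfolding G_def by (rule norm_triangle_ineq4)
      hence "r * norm (G (Complex r y)) \<le> r * (norm (F (Complex r y + c)) + norm (E (Complex r y + c)))"
        using r(1) by (rule mult_left_mono)
      also have "\<dots> = r * norm (F (Complex r y + c)) + r * norm (E (Complex r y + c))" by (rule distrib_left)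
      finally show ?thesis using 1 2 unfolding Q_def by linarith
    qed
    have "norm (G (of_real (a - \<delta>))) \<le> 10 * exp 4 * (Q * exp (3 / 2 * l) * exp (- H\<^sup>2) + \<rho> * exp (l * (3 / 2 - \<delta> - (a - \<delta>)))) +
       5 * exp 4 * exp (- l * (a - \<delta>)) / (a - \<delta>) * integral {-H..H} (\<lambda>v. \<bar>Im (G (Complex 0 v))\<bar> / (1 + v\<^sup>2))"
    proof (rule rectangle_estimate[where S = S])
      show "convex S" "open S" unfolding S_def
        by (intro convex_Int open_Int convex_halfspace_Re_gt convex_halfspace_Im_gt open_halfspace_Re_gt open_halfspace_Im_gt)+
      have "(\<lambda>z. f (z + c)) holomorphic_on S" if "f holomorphic_on zeta_strip" for f
      proof -
        have "(\<lambda>z. z + c) holomorphic_on S" by (intro holomorphic_intros)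
        moreover have "(\<lambda>z. z + c) ` S \<subseteq> zeta_strip" using inS by blast
        ultimately show ?thesis using holomorphic_on_compose_gen[OF _ that] by (simp add: o_def)
      qed
      thus "G holomorphic_on S" unfolding G_def using B(5) E0 by (intro holomorphic_intros)
      show "cbox (Complex 0 (- H)) (Complex (3 / 2 - \<delta>) H) \<subseteq> S"
        using d t by (auto simp: S_def in_cbox_complex_iff)
      show "r * norm (G (Complex r H)) \<le> Q" if "0 \<le> r" "r \<le> 3 / 2 - \<delta>" for r
        using that by (intro hor) auto
      show "r * norm (G (Complex r (- H))) \<le> Q" if "0 \<le> r" "r \<le> 3 / 2 - \<delta>" for r
        using that by (intro hor) auto
      fix v assume v: "- H \<le> v" "v \<le> H"
      have "Complex (3 / 2 - \<delta>) v + c = Complex 2 (t + v)" by (simp add: cp)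
      moreover have "F (Complex 2 (t + v)) = D (Complex 2 (t + v))" using v t by (intro B(7)) auto
      ultimately show "norm (G (Complex (3 / 2 - \<delta>) v)) \<le> \<rho>"
        using B(4)[of "Complex 2 (t + v)" J] by (simp add: G_def E_def \<rho>_def)
    qed (use d a H l0 in auto)
    moreover have "G (of_real (a - \<delta>)) = F (Complex (1 / 2 + a) t) - E (Complex (1 / 2 + a) t)"
    proof -
      have "of_real (a - \<delta>) + c = Complex (1 / 2 + a) t" by (simp add: c_def complex_eq_iff)
      thus ?thesis by (simp only: G_def)
    qed
    moreover have "3 / 2 - \<delta> - (a - \<delta>) = 3 / 2 - a" by simp
    ultimately have A: "X \<le> R + 5 * exp 4 * exp (- l * (a - \<delta>)) / (a - \<delta>) * integral {-H..H} (\<lambda>v. \<bar>Im (G (Complex 0 v))\<bar> / (1 + v\<^sup>2))"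
      by (simp only: X_def R_def)
    have "integral {-H..H} (\<lambda>v. \<bar>Im (G (Complex 0 v))\<bar> / (1 + v\<^sup>2)) \<le>
      integral {-H..H} (\<lambda>v. \<bar>Im (F (Complex (1 / 2 + \<delta>) (t + v)))\<bar> / (1 + v\<^sup>2) + p0 * (1 / (1 + v\<^sup>2)))"
    proof (rule integral_le)
      have "continuous_on {-H..H} (\<lambda>v. E (Complex (1 / 2 + \<delta>) (t + v)))"
      proof (rule continuous_on_compose2[OF holomorphic_on_imp_continuous_on[OF E0]])
        show "continuous_on {-H..H} (\<lambda>v. Complex (1 / 2 + \<delta>) (t + v))"
          unfolding Complex_eq by (intro continuous_intros)
      qed (use d t in \<open>auto simp: zeta_strip_def\<close>)
      hence "continuous_on {-H..H} (\<lambda>v. \<bar>Im (G (Complex 0 v))\<bar> / (1 + v\<^sup>2))"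
        unfolding G_def cp add_0_right using nz by (intro continuous_intros cF d) auto
      thus "(\<lambda>v. \<bar>Im (G (Complex 0 v))\<bar> / (1 + v\<^sup>2)) integrable_on {-H..H}"
        by (rule integrable_continuous_real)
      have "continuous_on {-H..H} (\<lambda>v. \<bar>Im (F (Complex (1 / 2 + \<delta>) (t + v)))\<bar> / (1 + v\<^sup>2) + p0 * (1 / (1 + v\<^sup>2)))"
        using nz by (intro continuous_intros contf d) auto
      thus "(\<lambda>v. \<bar>Im (F (Complex (1 / 2 + \<delta>) (t + v)))\<bar> / (1 + v\<^sup>2) + p0 * (1 / (1 + v\<^sup>2))) integrable_on {-H..H}"
        by (rule integrable_continuous_real)
      fix v assume "v \<in> {-H..H}"
      have "\<bar>Im (E (Complex (1 / 2 + \<delta>) (t + v)))\<bar> \<le> p0"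
        using Eb[of "Complex (1 / 2 + \<delta>) (t + v)"] abs_Im_le_cmod[of "E (Complex (1 / 2 + \<delta>) (t + v))"] d by simp
      hence "\<bar>Im (G (Complex 0 v))\<bar> \<le> \<bar>Im (F (Complex (1 / 2 + \<delta>) (t + v)))\<bar> + p0"
        unfolding G_def cp by simp
      hence "\<bar>Im (G (Complex 0 v))\<bar> / (1 + v\<^sup>2) \<le> (\<bar>Im (F (Complex (1 / 2 + \<delta>) (t + v)))\<bar> + p0) / (1 + v\<^sup>2)"
        using v0[of v] by (intro divide_right_mono) auto
      thus "\<bar>Im (G (Complex 0 v))\<bar> / (1 + v\<^sup>2) \<le> \<bar>Im (F (Complex (1 / 2 + \<delta>) (t + v)))\<bar> / (1 + v\<^sup>2) + p0 * (1 / (1 + v\<^sup>2))"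
        by (simp add: add_divide_distrib)
    qed
    also have "\<dots> = I \<delta> + p0 * integral {-H..H} (\<lambda>v. 1 / (1 + v\<^sup>2))"
    proof -
      have "(\<lambda>v. \<bar>Im (F (Complex (1 / 2 + \<delta>) (t + v)))\<bar> / (1 + v\<^sup>2)) integrable_on {-H..H}"
        by (intro integrable_continuous_real contf d)
      moreover have "(\<lambda>v::real. p0 * (1 / (1 + v\<^sup>2))) integrable_on {-H..H}"
        using integral_inverse_one_plus_square_le(1)[of H] H by (intro integrable_on_mult_right) auto
      ultimately show ?thesis unfolding I_def by (simp only: integral_add integral_mult_right)
    qed
    also have "\<dots> \<le> I \<delta> + p0 * pi"
      using integral_inverse_one_plus_square_le(2)[of H] H p00 by (intro add_left_mono mult_left_mono) auto
    finally have "integral {-H..H} (\<lambda>v. \<bar>Im (G (Complex 0 v))\<bar> / (1 + v\<^sup>2)) \<le> I \<delta> + p0 * pi" .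
    moreover have "0 \<le> 5 * exp 4 * exp (- l * (a - \<delta>)) / (a - \<delta>)" using d by simp
    ultimately show ?thesis using A mult_left_mono order_trans add_left_mono by meson
  qed
  obtain d M where d: "d > 0"
    "\<And>\<delta> u. 0 < \<delta> \<Longrightarrow> \<delta> < d \<Longrightarrow> t - H \<le> u \<Longrightarrow> u \<le> t + H \<Longrightarrow> \<bar>Im (F (Complex (1 / 2 + \<delta>) u))\<bar> \<le> M"
  proof -
    have "t - H > 1" using t by simp
    from Im_log_zeta_bounded_near_critical_line[OF DF this, of "t + H"] show ?thesis
      using that by blast
  qed
  define \<delta> where "\<delta> = (\<lambda>k. min d a / real (k + 2))"
  have \<delta>: "0 < \<delta> k" "\<delta> k < d" "\<delta> k < a" for k
  proof -
    have "min d a > 0" using d a by simp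
    moreover from this have "min d a / real (k + 2) < min d a / 1" by (intro divide_strict_left_mono) auto
    ultimately have "0 < \<delta> k" "\<delta> k < min d a" unfolding \<delta>_def by (simp_all only: div_by_1) simp
    thus "0 < \<delta> k" "\<delta> k < d" "\<delta> k < a" by simp_all
  qed
  have \<delta>lim: "\<delta> \<longlonglongrightarrow> 0" unfolding \<delta>_def by real_asymp
  have \<delta>filt: "filterlim \<delta> (at_right 0) sequentially"
    using \<delta>lim \<delta>(1) by (intro filterlim_at_withinI) (auto intro!: always_eventually)
  define Z where "Z = {v \<in> {-H..H}. zero_ordinate (t + v)}"
  have finZ: "finite Z"
  proof -
    have "finite {u \<in> {t - H..t + H}. zero_ordinate u}" using t by (intro finite_zero_ordinates RH) auto
    hence "finite ((\<lambda>u. u - t) ` {u \<in> {t - H..t + H}. zero_ordinate u})" by (rule finite_imageI)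
    moreover have "Z \<subseteq> (\<lambda>u. u - t) ` {u \<in> {t - H..t + H}. zero_ordinate u}"
    proof
      fix v assume "v \<in> Z"
      thus "v \<in> (\<lambda>u. u - t) ` {u \<in> {t - H..t + H}. zero_ordinate u}"
        by (intro image_eqI[of _ _ "t + v"]) (auto simp: Z_def)
    qed
    ultimately show ?thesis by (rule finite_subset[rotated])
  qed
  \<comment> \<open>the values at the finite set of ordinates are changed to make the convergence pointwise\<close>
  define f where "f = (\<lambda>k v. if v \<in> Z then 0 else \<bar>Im (F (Complex (1 / 2 + \<delta> k) (t + v)))\<bar> / (1 + v\<^sup>2))"
  define g where "g = (\<lambda>v. if v \<in> Z then 0 else \<bar>pi * zeta_S (t + v)\<bar> / (1 + v\<^sup>2))"
  have fI: "(f k has_integral I (\<delta> k)) {-H..H}" for k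
  proof (rule has_integral_spike_finite[OF finZ])
    show "((\<lambda>v. \<bar>Im (F (Complex (1 / 2 + \<delta> k) (t + v)))\<bar> / (1 + v\<^sup>2)) has_integral I (\<delta> k)) {-H..H}"
      unfolding I_def by (intro integrable_integral integrable_continuous_real contf \<delta>)
  qed (simp add: f_def)
  have M0: "M \<ge> 0"
  proof -
    have "\<bar>Im (F (Complex (1 / 2 + \<delta> 0) t))\<bar> \<le> M" using \<delta>[of 0] H by (intro d(2)) auto
    thus ?thesis by (rule order_trans[OF abs_ge_zero])
  qed
  have dom: "norm (f k v) \<le> M * (1 / (1 + v\<^sup>2))" if "v \<in> {-H..H}" for k v
  proof -
    have "\<bar>Im (F (Complex (1 / 2 + \<delta> k) (t + v)))\<bar> \<le> M" using that \<delta>[of k] by (intro d(2)) auto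
    hence "\<bar>Im (F (Complex (1 / 2 + \<delta> k) (t + v)))\<bar> / (1 + v\<^sup>2) \<le> M / (1 + v\<^sup>2)"
      using v0[of v] by (intro divide_right_mono) auto
    thus ?thesis using M0 v0[of v] by (auto simp: f_def)
  qed
  have hint: "(\<lambda>v::real. c * (1 / (1 + v\<^sup>2))) integrable_on {-H..H}" for c
    using integral_inverse_one_plus_square_le(1)[of H] H by (intro integrable_on_mult_right) auto
  have conv: "(\<lambda>k. f k v) \<longlonglongrightarrow> g v" if v: "v \<in> {-H..H}" for v
  proof (cases "v \<in> Z")
    case False
    hence no: "\<not> zero_ordinate (t + v)" using v by (simp add: Z_def)
    have "t + v > 1" using v t by auto
    from filterlim_compose[OF Im_log_zeta_tendsto_zeta_S[OF RH DF this no] \<delta>filt]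
    have "(\<lambda>k. Im (F (Complex (1 / 2 + \<delta> k) (t + v)))) \<longlonglongrightarrow> pi * zeta_S (t + v)" .
    hence "(\<lambda>k. \<bar>Im (F (Complex (1 / 2 + \<delta> k) (t + v)))\<bar> / (1 + v\<^sup>2)) \<longlonglongrightarrow> \<bar>pi * zeta_S (t + v)\<bar> / (1 + v\<^sup>2)"
      using nz by (intro tendsto_intros) auto
    thus ?thesis using False by (simp add: f_def g_def)
  qed (simp add: f_def g_def)
  have int_f: "f k integrable_on {-H..H}" "integral {-H..H} (f k) = I (\<delta> k)" for k
    using fI[of k] by (auto simp: has_integral_iff)
  have gi: "g integrable_on {-H..H}"
    by (rule dominated_convergence(1)[OF int_f(1) hint dom conv])
  have Ilim: "(\<lambda>k. I (\<delta> k)) \<longlonglongrightarrow> integral {-H..H} g"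
    using dominated_convergence(2)[OF int_f(1) hint dom conv] by (simp add: int_f(2))
  have L0: "L \<ge> 0" using L[of t] H by simp
  have "integral {-H..H} g \<le> integral {-H..H} (\<lambda>v. (pi * L) * (1 / (1 + v\<^sup>2)))"
  proof (rule integral_le[OF gi hint])
    fix v assume v: "v \<in> {-H..H}"
    have "\<bar>zeta_S (t + v)\<bar> \<le> L" using v by (intro L) auto
    hence "\<bar>pi * zeta_S (t + v)\<bar> \<le> pi * L" by (simp add: abs_mult)
    hence "\<bar>pi * zeta_S (t + v)\<bar> / (1 + v\<^sup>2) \<le> pi * L / (1 + v\<^sup>2)"
      using v0[of v] by (intro divide_right_mono) auto
    thus "g v \<le> (pi * L) * (1 / (1 + v\<^sup>2))" using L0 v0[of v] by (auto simp: g_def)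
  qed
  also have "\<dots> = (pi * L) * integral {-H..H} (\<lambda>v. 1 / (1 + v\<^sup>2))" by (rule integral_mult_right)
  also have "\<dots> \<le> (pi * L) * pi"
    using integral_inverse_one_plus_square_le(2)[of H] H L0 by (intro mult_left_mono) auto
  finally have gL: "integral {-H..H} g \<le> pi * L * pi" .
  have "(\<lambda>k. R + 5 * exp 4 * exp (- l * (a - \<delta> k)) / (a - \<delta> k) * (I (\<delta> k) + p0 * pi)) \<longlonglongrightarrow>
      R + 5 * exp 4 * exp (- l * (a - 0)) / (a - 0) * (integral {-H..H} g + p0 * pi)"
    using a by (intro tendsto_intros \<delta>lim Ilim) auto
  moreover have "\<exists>N. \<forall>k\<ge>N. X \<le> R + 5 * exp 4 * exp (- l * (a - \<delta> k)) / (a - \<delta> k) * (I (\<delta> k) + p0 * pi)"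
    using step \<delta> by blast
  ultimately have "X \<le> R + 5 * exp 4 * exp (- l * (a - 0)) / (a - 0) * (integral {-H..H} g + p0 * pi)"
    by (rule LIMSEQ_le_const)
  also have "\<dots> \<le> R + 5 * exp 4 * exp (- l * (a - 0)) / (a - 0) * (pi * L * pi + p0 * pi)"
    using gL a by (intro add_left_mono mult_left_mono add_right_mono) auto
  finally show ?thesis unfolding X_def R_def Q_def \<rho>_def E_def by simp
qed

section \<open>The choice of the length of the Euler product\<close>

text \<open>
  The three terms come from the primes up to \<open>x = 2 ^ J\<close>, from the argument on the critical line and
  from the truncation at height \<open>H\<close>.
\<close>

lemma log_zeta_bound_on_RH:
  assumes RH: riemann_hypothesis and \<sigma>: "1 / 2 < \<sigma>" "\<sigma> < 1"
  obtains B where "B > 0"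
    "\<And>D F t H L J. log_zeta_branch D F \<Longrightarrow> H \<ge> 1 \<Longrightarrow> t - H \<ge> 3 \<Longrightarrow>
       (\<And>u. \<bar>u - t\<bar> \<le> H \<Longrightarrow> \<bar>zeta_S u\<bar> \<le> L) \<Longrightarrow>
       norm (F (Complex \<sigma> t)) \<le> B * ((2 ^ J) powr (1 - \<sigma>) / (real J + 1) + L * (2 ^ J) powr (1 / 2 - \<sigma>) +
         (ln (t + H) + 1) * (2 ^ J)\<^sup>2 * exp (- H\<^sup>2))"
proof -
  obtain K where K: "K > 0" "\<And>D F s. log_zeta_branch D F \<Longrightarrow> 1 / 2 < Re s \<Longrightarrow> Re s \<le> 2 \<Longrightarrow> Im s \<ge> 3 \<Longrightarrow>
       norm (F s) \<le> K * ln (Im s) / (Re s - 1 / 2)"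
    by (rule log_zeta_bound) blast
  obtain Kh where Kh: "Kh > 0"
    "\<And>J. (\<Sum>p | prime p \<and> p \<le> 2 ^ J. real p powr (- (1 / 2))) \<le> Kh * (2 ^ J) powr (1 - 1 / 2) / (real J + 1)"
    by (rule prime_power_sum_le[of "1 / 2"]) auto
  obtain Ks where Ks: "Ks > 0"
    "\<And>J. (\<Sum>p | prime p \<and> p \<le> 2 ^ J. real p powr (- \<sigma>)) \<le> Ks * (2 ^ J) powr (1 - \<sigma>) / (real J + 1)"
    by (rule prime_power_sum_le[of \<sigma>]) (use \<sigma> in auto)
  define a where "a = \<sigma> - 1 / 2"
  have a: "0 < a" "a < 1 / 2" using \<sigma> by (auto simp: a_def)
  define e where "e = exp (4::real)"
  have e0: "e > 0" by (simp add: e_def)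
  define B1 where "B1 = 4 * Ks + 320 * e + 20 * e * pi * Kh / a"
  define B2 where "B2 = 5 * e * pi * pi / a"
  define B3 where "B3 = 10 * e * (K + 6 * Kh)"
  have B0: "B1 > 0" "B2 > 0" "B3 > 0"
    unfolding B1_def B2_def B3_def using e0 K Kh Ks a by (auto intro!: add_pos_pos divide_pos_pos mult_pos_pos)
  have main: "norm (F (Complex \<sigma> t)) \<le> B1 * ((2 ^ J) powr (1 - \<sigma>) / (real J + 1)) + B2 * (L * (2 ^ J) powr (1 / 2 - \<sigma>)) +
         B3 * ((ln (t + H) + 1) * (2 ^ J)\<^sup>2 * exp (- H\<^sup>2))"
    if DF: "log_zeta_branch D F" and H: "H \<ge> 1" and t: "t - H \<ge> 3"
      and L: "\<And>u. \<bar>u - t\<bar> \<le> H \<Longrightarrow> \<bar>zeta_S u\<bar> \<le> L" for D F t H L J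
  proof -
    define x where "x = (2::real) ^ J"
    define j where "j = real J + 1"
    define p0 where "p0 = 4 * (Kh * x powr (1 / 2) / j)"
    define l where "l = real J * ln 2"
    have x: "x \<ge> 1" by (simp add: x_def)
    have j: "j \<ge> 1" by (simp add: j_def)
    have lx: "l = ln x" by (simp add: l_def x_def ln_realpow)
    have el: "exp (l * y) = x powr y" for y using x by (simp add: lx powr_def mult.commute)
    have p0: "norm (euler_log (2 ^ J) s) \<le> p0" if "Re s \<ge> 1 / 2" for s
    proof -
      have "norm (euler_log (2 ^ J) s) \<le> 4 * (\<Sum>p | prime p \<and> p \<le> 2 ^ J. real p powr (- Re s))"
        by (rule norm_euler_log_le[OF that])
      also have "\<dots> \<le> 4 * (\<Sum>p | prime p \<and> p \<le> 2 ^ J. real p powr (- (1 / 2)))"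
        using that prime_ge_1_nat by (intro mult_left_mono sum_mono powr_mono) auto
      also have "\<dots> \<le> p0" using Kh(2)[of J] by (simp add: p0_def x_def j_def)
      finally show ?thesis .
    qed
    have c: "1 / 2 + a = \<sigma>" by (simp add: a_def)
    have est: "norm (F (Complex \<sigma> t) - euler_log (2 ^ J) (Complex \<sigma> t)) \<le>
       10 * e * ((K * ln (t + H) + 3 / 2 * p0) * exp (3 / 2 * l) * exp (- H\<^sup>2) + 32 / (x * j) * exp (l * (3 / 2 - a))) +
       5 * e * exp (- l * a) / a * (pi * L * pi + p0 * pi)"
      using log_zeta_minus_euler_log_bound[OF RH DF K(2)[OF DF] K(1) a H t L p0 l_def]
      unfolding c e_def x_def j_def .
    have E: "norm (euler_log (2 ^ J) (Complex \<sigma> t)) \<le> 4 * (Ks * (x powr (1 - \<sigma>) / j))"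
      using norm_euler_log_le[of "Complex \<sigma> t" "2 ^ J"] Ks(2)[of J] \<sigma> by (simp add: x_def j_def)
    have lnt: "ln (t + H) \<ge> 0" using t H by (intro ln_ge_zero) auto
    have x32: "x powr (3 / 2) \<le> x\<^sup>2" using x powr_mono[of "3 / 2" 2 x] by (simp add: powr_numeral)
    have px: "p0 * x powr (3 / 2) \<le> 4 * Kh * x\<^sup>2"
    proof -
      have "p0 * x powr (3 / 2) = 4 * Kh * (x powr (1 / 2) * x powr (3 / 2)) / j" by (simp add: p0_def)
      also have "x powr (1 / 2) * x powr (3 / 2) = x\<^sup>2" using x by (simp add: powr_numeral flip: powr_add)
      also have "4 * Kh * x\<^sup>2 / j \<le> 4 * Kh * x\<^sup>2 / 1" using j Kh x by (intro divide_left_mono) auto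
      finally show ?thesis by simp
    qed
    have t3: "(K * ln (t + H) + 3 / 2 * p0) * exp (3 / 2 * l) * exp (- H\<^sup>2) \<le> (K + 6 * Kh) * ((ln (t + H) + 1) * x\<^sup>2 * exp (- H\<^sup>2))"
    proof -
      have "exp (3 / 2 * l) = x powr (3 / 2)" using el[of "3 / 2"] by (simp add: mult.commute)
      hence "(K * ln (t + H) + 3 / 2 * p0) * exp (3 / 2 * l) = K * ln (t + H) * x powr (3 / 2) + 3 / 2 * (p0 * x powr (3 / 2))"
        by (simp add: algebra_simps)
      also have "\<dots> \<le> K * ln (t + H) * x\<^sup>2 + 3 / 2 * (4 * Kh * x\<^sup>2)"
        using px x32 K(1) lnt by (intro add_mono mult_left_mono mult_nonneg_nonneg) auto
      also have "\<dots> \<le> (K + 6 * Kh) * ((ln (t + H) + 1) * x\<^sup>2)"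
      proof -
        have "0 \<le> K * x\<^sup>2" "0 \<le> Kh * ln (t + H) * x\<^sup>2" using K(1) Kh(1) lnt by auto
        thus ?thesis by (simp add: algebra_simps)
      qed
      finally show ?thesis using mult_right_mono[OF _ exp_ge_zero[of "- H\<^sup>2"]] by (simp only: mult.assoc[symmetric])
    qed
    have y: "x powr (1 - \<sigma>) = x powr (1 / 2) * x powr (- a)" by (simp add: a_def flip: powr_add)
    have t2: "32 / (x * j) * exp (l * (3 / 2 - a)) = 32 * (x powr (1 - \<sigma>) / j)"
    proof -
      have "exp (l * (3 / 2 - a)) = x powr (1 + (1 - \<sigma>))" unfolding el by (simp add: a_def)
      also have "\<dots> = x * x powr (1 - \<sigma>)" unfolding powr_add using x by simp
      finally show ?thesis using x by simp
    qed
    have t4: "5 * e * exp (- l * a) / a * (pi * L * pi + p0 * pi) =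
        B2 * (L * x powr (- a)) + 20 * e * pi * Kh / a * (x powr (1 - \<sigma>) / j)"
    proof -
      have "exp (- l * a) = x powr (- a)" using el[of "- a"] by simp
      thus ?thesis unfolding B2_def p0_def y using a j by (simp add: field_simps)
    qed
    have "norm (F (Complex \<sigma> t)) \<le> norm (F (Complex \<sigma> t) - euler_log (2 ^ J) (Complex \<sigma> t)) + norm (euler_log (2 ^ J) (Complex \<sigma> t))"
      by (rule norm_triangle_sub[of "F (Complex \<sigma> t)" "euler_log (2 ^ J) (Complex \<sigma> t)", unfolded add.commute[of "norm (euler_log (2 ^ J) (Complex \<sigma> t))"]])
    also have "\<dots> \<le> (10 * e * ((K + 6 * Kh) * ((ln (t + H) + 1) * x\<^sup>2 * exp (- H\<^sup>2)) + 32 * (x powr (1 - \<sigma>) / j)) +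
        (B2 * (L * x powr (- a)) + 20 * e * pi * Kh / a * (x powr (1 - \<sigma>) / j))) + 4 * (Ks * (x powr (1 - \<sigma>) / j))"
    proof (rule add_mono[OF order_trans[OF est] E])
      show "10 * e * ((K * ln (t + H) + 3 / 2 * p0) * exp (3 / 2 * l) * exp (- H\<^sup>2) + 32 / (x * j) * exp (l * (3 / 2 - a))) +
       5 * e * exp (- l * a) / a * (pi * L * pi + p0 * pi) \<le>
       10 * e * ((K + 6 * Kh) * ((ln (t + H) + 1) * x\<^sup>2 * exp (- H\<^sup>2)) + 32 * (x powr (1 - \<sigma>) / j)) +
        (B2 * (L * x powr (- a)) + 20 * e * pi * Kh / a * (x powr (1 - \<sigma>) / j))"
        unfolding t2 t4 using t3 e0 by (intro add_mono mult_left_mono order_refl) auto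
    qed
    also have "\<dots> = B1 * (x powr (1 - \<sigma>) / j) + B2 * (L * x powr (- a)) + B3 * ((ln (t + H) + 1) * x\<^sup>2 * exp (- H\<^sup>2))"
    proof -
      have "(10 * e * ((K + 6 * Kh) * r + 32 * w) + (q + 20 * e * pi * Kh / a * w)) + 4 * (Ks * w) =
        B1 * w + q + B3 * r" for q r w
        by (simp add: B1_def B3_def algebra_simps)
      thus ?thesis by (simp only:)
    qed
    also have "- a = 1 / 2 - \<sigma>" by (simp add: a_def)
    finally show ?thesis unfolding x_def j_def .
  qed
  show ?thesis
  proof (rule that[of "B1 + B2 + B3"])
    show "B1 + B2 + B3 > 0" using B0 by simp
    fix D F :: "complex \<Rightarrow> complex" and t H L :: real and J :: nat
    assume *: "log_zeta_branch D F" "H \<ge> 1" "t - H \<ge> 3" "\<And>u. \<bar>u - t\<bar> \<le> H \<Longrightarrow> \<bar>zeta_S u\<bar> \<le> L"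
    have "L \<ge> 0" using *(4)[of t] *(2) by simp
    hence nn: "0 \<le> (2 ^ J) powr (1 - \<sigma>) / (real J + 1)" "0 \<le> L * (2 ^ J) powr (1 / 2 - \<sigma>)"
      "0 \<le> (ln (t + H) + 1) * (2 ^ J)\<^sup>2 * exp (- H\<^sup>2)"
      using *(2,3) by auto
    have comb: "B1 * p + B2 * q + B3 * r \<le> (B1 + B2 + B3) * (p + q + r)" if "0 \<le> p" "0 \<le> q" "0 \<le> r" for p q r
    proof -
      have "0 \<le> B1 * q" "0 \<le> B1 * r" "0 \<le> B2 * p" "0 \<le> B2 * r" "0 \<le> B3 * p" "0 \<le> B3 * q" using that B0 by auto
      thus ?thesis by (simp add: algebra_simps)
    qed
    show "norm (F (Complex \<sigma> t)) \<le> (B1 + B2 + B3) * ((2 ^ J) powr (1 - \<sigma>) / (real J + 1) + L * (2 ^ J) powr (1 / 2 - \<sigma>) +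
         (ln (t + H) + 1) * (2 ^ J)\<^sup>2 * exp (- H\<^sup>2))"
      by (rule order_trans[OF main[OF *] comb[OF nn]])
  qed
qed

text \<open>
  With \<open>2 ^ J\<close> within a factor 2 of \<open>(M * y)\<^sup>2\<close>, where \<open>y\<close> stands for \<open>ln (ln t)\<close>, the first two
  terms balance.  The lower bound for \<open>M\<close>, which is \<open>sqrt (ln t)\<close>, makes \<open>J\<close> at least of the order
  of \<open>y\<close>.
\<close>

lemma euler_product_length:
  fixes M y :: real
  assumes "M \<ge> exp (y / 2)" "y \<ge> 1" and \<sigma>: "1 / 2 < \<sigma>" "\<sigma> < 1"
  obtains J where "(2 ^ J) powr (1 - \<sigma>) / (real J + 1) \<le> 2 * (M powr (2 - 2 * \<sigma>) * y powr (1 - 2 * \<sigma>))"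
    "M * (2 ^ J) powr (1 / 2 - \<sigma>) \<le> M powr (2 - 2 * \<sigma>) * y powr (1 - 2 * \<sigma>)"
    "2 ^ J \<le> 2 * (M * y)\<^sup>2"
proof -
  define X where "X = (M * y)\<^sup>2"
  have M: "M \<ge> 1" using assms(1,2) one_le_exp_iff[of "y / 2"] by linarith
  have My: "M * y \<ge> M" using M assms(2) mult_left_mono[of 1 y M] by simp
  hence My1: "M * y \<ge> 1" by (rule order_trans[OF M])
  have X1: "X \<ge> 1" using My1 power_mono[of 1 "M * y" 2] by (simp add: X_def)
  have Xpow: "X powr b = M powr (2 * b) * y powr (2 * b)" for b
    using M assms(2) by (simp add: X_def powr_powr powr_mult flip: powr_numeral)
  define J where "J = nat \<lceil>log 2 X\<rceil>"
  have lg: "log 2 X \<ge> 0" using X1 by simp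
  have J: "log 2 X \<le> real J" "real J \<le> log 2 X + 1" using lg by (auto simp: J_def)
  have XJ: "X \<le> 2 ^ J"
    using J(1) X1 by (simp add: log_le_iff powr_realpow)
  have JX: "2 ^ J \<le> 2 * X"
  proof -
    have "(2::real) ^ J = 2 powr real J" by (simp add: powr_realpow)
    also have "\<dots> \<le> 2 powr (log 2 X + 1)" using J(2) by (intro powr_mono) auto
    also have "\<dots> = 2 * X" using X1 by (simp add: powr_add)
    finally show ?thesis .
  qed
  have yJ: "y \<le> real J + 1"
  proof -
    have "(exp (y / 2))\<^sup>2 \<le> X" unfolding X_def using assms(1) My by (intro power_mono) auto
    moreover have "(exp (y / 2))\<^sup>2 = exp y" using exp_double[of "y / 2"] by simp
    ultimately have "y \<le> ln X" using X1 by (simp add: ln_ge_iff)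
    also have "ln X \<le> log 2 X"
    proof -
      have "ln X * ln 2 \<le> ln X * 1" using X1 ln_2_less_1 by (intro mult_left_mono) auto
      thus ?thesis by (simp add: log_def field_simps)
    qed
    finally show ?thesis using J(1) by simp
  qed
  have e1: "2 * (1 - \<sigma>) = 2 - 2 * \<sigma>" by simp
  show ?thesis
  proof (rule that[of J])
    have "(2 ^ J) powr (1 - \<sigma>) \<le> (2 * X) powr (1 - \<sigma>)" using JX \<sigma> by (intro powr_mono2) auto
    also have "\<dots> = 2 powr (1 - \<sigma>) * X powr (1 - \<sigma>)" using X1 by (simp add: powr_mult)
    also have "\<dots> \<le> 2 powr 1 * X powr (1 - \<sigma>)" using \<sigma> by (intro mult_right_mono powr_mono) auto
    also have "\<dots> = 2 * (M powr (2 - 2 * \<sigma>) * y powr (2 - 2 * \<sigma>))" unfolding Xpow e1 by simp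
    finally have "(2 ^ J) powr (1 - \<sigma>) / (real J + 1) \<le> 2 * (M powr (2 - 2 * \<sigma>) * y powr (2 - 2 * \<sigma>)) / y"
      using yJ assms(2) by (intro frac_le) auto
    also have "\<dots> = 2 * (M powr (2 - 2 * \<sigma>) * (y powr (2 - 2 * \<sigma>) / y powr 1))" using assms(2) by simp
    also have "y powr (2 - 2 * \<sigma>) / y powr 1 = y powr (1 - 2 * \<sigma>)"
      using powr_diff[of y "2 - 2 * \<sigma>" 1] by simp
    finally show "(2 ^ J) powr (1 - \<sigma>) / (real J + 1) \<le> 2 * (M powr (2 - 2 * \<sigma>) * y powr (1 - 2 * \<sigma>))" .
    have "M * (2 ^ J) powr (1 / 2 - \<sigma>) \<le> M * X powr (1 / 2 - \<sigma>)"
      using XJ X1 \<sigma> M by (intro mult_left_mono powr_mono2') auto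
    also have "\<dots> = (M powr 1 * M powr (1 - 2 * \<sigma>)) * y powr (1 - 2 * \<sigma>)" unfolding Xpow using M by simp
    also have "M powr 1 * M powr (1 - 2 * \<sigma>) = M powr (2 - 2 * \<sigma>)"
      using powr_add[of M 1 "1 - 2 * \<sigma>"] by simp
    finally show "M * (2 ^ J) powr (1 / 2 - \<sigma>) \<le> M powr (2 - 2 * \<sigma>) * y powr (1 - 2 * \<sigma>)" .
    show "2 ^ J \<le> 2 * (M * y)\<^sup>2" using JX by (simp add: X_def)
  qed
qed

text \<open>
  The Gaussian factor \<open>exp (- (C * y)\<^sup>2)\<close> beats every fixed power of \<open>ln t = exp y\<close>.
\<close>

lemma truncation_term_le_1:
  fixes M y A C :: real
  assumes "C > 0" "A \<ge> 0" "1 \<le> M" "M \<le> exp (A * y)" "y \<ge> 1" "(4 * A + 10) / C\<^sup>2 \<le> y"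
    and z: "0 \<le> z" "z \<le> 3 * exp y" and x: "0 \<le> x" "x \<le> 2 * (M * y)\<^sup>2"
  shows "z * x\<^sup>2 * exp (- (C * y)\<^sup>2) \<le> 1"
proof -
  have "y \<le> exp y" using exp_ge_add_one_self[of y] by linarith
  hence "M * y \<le> exp (A * y) * exp y" using assms by (intro mult_mono) auto
  hence "(M * y)\<^sup>2 \<le> (exp (A * y) * exp y)\<^sup>2" using assms by (intro power_mono) auto
  also have "\<dots> = exp (2 * A * y + 2 * y)"
    by (simp add: power_mult_distrib exp_add flip: exp_double)
  finally have "x \<le> 2 * exp (2 * A * y + 2 * y)" using x by linarith
  hence "x\<^sup>2 \<le> (2 * exp (2 * A * y + 2 * y))\<^sup>2" using x by (intro power_mono) auto
  also have "\<dots> = 4 * exp (4 * A * y + 4 * y)"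
    by (simp add: power_mult_distrib algebra_simps flip: exp_double)
  finally have x2: "x\<^sup>2 \<le> 4 * exp (4 * A * y + 4 * y)" .
  have "(4 * A + 10) \<le> C\<^sup>2 * y" using assms by (simp add: divide_le_eq mult.commute)
  hence "(4 * A + 10) * y \<le> C\<^sup>2 * y * y" using assms by (intro mult_right_mono) auto
  hence "- (C * y)\<^sup>2 \<le> - ((4 * A + 10) * y)" by (simp add: power2_eq_square mult_ac)
  hence "exp (- (C * y)\<^sup>2) \<le> exp (- ((4 * A + 10) * y))" by simp
  hence "z * x\<^sup>2 * exp (- (C * y)\<^sup>2) \<le> (3 * exp y) * (4 * exp (4 * A * y + 4 * y)) * exp (- ((4 * A + 10) * y))"
    using z x2 by (intro mult_mono) auto
  also have "\<dots> = 12 * exp (y + (4 * A * y + 4 * y) + - ((4 * A + 10) * y))"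
    by (simp only: exp_add)
  also have "y + (4 * A * y + 4 * y) + - ((4 * A + 10) * y) = - (5 * y)" by (simp add: algebra_simps)
  also have "12 * exp (- (5 * y)) \<le> 12 * exp (- 5)" using assms by simp
  also have "12 * exp (- 5 :: real) \<le> 1"
  proof -
    have "(2::real) ^ 5 \<le> exp 1 ^ 5" using exp_ge_add_one_self[of 1] by (intro power_mono) auto
    also have "\<dots> = exp 5" by (simp flip: exp_of_nat_mult)
    finally show ?thesis by (simp add: exp_minus field_simps)
  qed
  finally show ?thesis .
qed

theorem theorem2:
  fixes C \<sigma> :: real
  assumes riemann_hypothesis
    and "C > 1 / pi"
    and "1 / 2 < \<sigma>" and "\<sigma> < 1"
  shows "\<exists>c>0. (\<lambda>t. norm (zeta (Complex \<sigma> t))) \<in> O[at_top](\<lambda>t.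
           exp (c * max (zeta_L C t powr (2 - 2 * \<sigma>)) (ln t powr (1 - \<sigma>))
                  * ln (ln t) powr (1 - 2 * \<sigma>)))"
proof -
  have C: "C > 0" using assms(2) pi_gt_zero by (meson divide_pos_pos less_trans zero_less_one)
  obtain D F where DF: "log_zeta_branch D F" by (rule log_zeta_branch_exists[OF assms(1)])
  note DFD = log_zeta_branchD[OF DF]
  obtain B where B: "B > 0"
    "\<And>D F t H L J. log_zeta_branch D F \<Longrightarrow> H \<ge> 1 \<Longrightarrow> t - H \<ge> 3 \<Longrightarrow>
       (\<And>u. \<bar>u - t\<bar> \<le> H \<Longrightarrow> \<bar>zeta_S u\<bar> \<le> L) \<Longrightarrow>
       norm (F (Complex \<sigma> t)) \<le> B * ((2 ^ J) powr (1 - \<sigma>) / (real J + 1) + L * (2 ^ J) powr (1 / 2 - \<sigma>) +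
         (ln (t + H) + 1) * (2 ^ J)\<^sup>2 * exp (- H\<^sup>2))"
    by (rule log_zeta_bound_on_RH[OF assms(1,3,4)]) blast
  obtain K where K: "K \<ge> 1" "\<And>s. 1 / 2 \<le> Re s \<Longrightarrow> Re s \<le> 4 \<Longrightarrow> Im s \<ge> 1 \<Longrightarrow> norm (zeta s) \<le> K * (Im s)\<^sup>2"
    by (rule zeta_growth) blast
  \<comment> \<open>\<open>(ln t) powr A\<close> raised to the power \<open>2 - 2 * \<sigma>\<close> is \<open>(ln t) ^ 3\<close>, which exceeds \<open>ln t * ln (ln t)\<close>\<close>
  define A where "A = 3 / (2 - 2 * \<sigma>)"
  have A0: "A \<ge> 0" using assms(4) by (simp add: A_def)
  define c where "c = max (3 * B) 1"
  define y0 where "y0 = max 1 (max (1 / C) ((4 * A + 10) / C\<^sup>2))"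
  define R where "R = (\<lambda>t. exp (c * max (zeta_L C t powr (2 - 2 * \<sigma>)) (ln t powr (1 - \<sigma>)) * ln (ln t) powr (1 - 2 * \<sigma>)))"
  have bound: "norm (zeta (Complex \<sigma> t)) \<le> (K + exp B) * norm (R t)"
    if y: "ln (ln t) \<ge> y0" and t: "t - C * ln (ln t) \<ge> 3" "C * ln (ln t) \<le> t" "t \<ge> 3" for t
  proof -
    define y where "y = ln (ln t)"
    define H where "H = C * y"
    define L where "L = zeta_L C t"
    have y1: "y \<ge> 1" "y \<ge> 1 / C" "y \<ge> (4 * A + 10) / C\<^sup>2" using that(1) by (auto simp: y_def y0_def)
    have H1: "H \<ge> 1" using y1(2) C by (simp add: H_def divide_le_eq mult.commute)
    have tH: "t - H \<ge> 3" "H \<le> t" using t by (auto simp: H_def y_def)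
    have lt0: "ln t > 0"
    proof (rule ccontr)
      assume "\<not> ln t > 0"
      moreover have "ln t > 0" using t(3) by simp
      ultimately show False by simp
    qed
    have ey: "exp y = ln t" using lt0 by (simp add: y_def)
    have SL: "\<bar>zeta_S u\<bar> \<le> L" if "\<bar>u - t\<bar> \<le> H" for u
      unfolding L_def using that tH(1) by (intro zeta_S_le_zeta_L[OF assms(1) DF]) (auto simp: H_def y_def)
    have L0: "L \<ge> 0" using SL[of t] H1 by simp
    define M where "M = max L (exp (y / 2))"
    have M: "M \<ge> exp (y / 2)" "L \<le> M" by (auto simp: M_def)
    have M1: "M \<ge> 1" using M(1) y1(1) one_le_exp_iff[of "y / 2"] by linarith
    define T where "T = M powr (2 - 2 * \<sigma>) * y powr (1 - 2 * \<sigma>)"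
    have T0: "T \<ge> 0" by (simp add: T_def)
    have "max (L powr (2 - 2 * \<sigma>)) (ln t powr (1 - \<sigma>)) = M powr (2 - 2 * \<sigma>)"
    proof -
      have "ln t powr (1 - \<sigma>) = exp (y / 2) powr (2 - 2 * \<sigma>)"
        unfolding ey[symmetric] by (simp add: powr_def algebra_simps)
      moreover have "max (L powr (2 - 2 * \<sigma>)) (exp (y / 2) powr (2 - 2 * \<sigma>)) = M powr (2 - 2 * \<sigma>)"
      proof (cases "L \<le> exp (y / 2)")
        case True
        thus ?thesis using L0 assms(4) powr_mono2[OF _ L0 True, of "2 - 2 * \<sigma>"] by (simp add: M_def max_absorb2)
      next
        case False
        hence "exp (y / 2) \<le> L" by simp
        thus ?thesis using assms(4) powr_mono2[of "2 - 2 * \<sigma>" "exp (y / 2)" L] by (simp add: M_def max_absorb1)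
      qed
      ultimately show ?thesis by simp
    qed
    hence RT: "norm (R t) = exp (c * T)"
      by (simp add: R_def T_def L_def y_def mult.assoc)
    have cT: "3 * B * T \<le> c * T" "T \<le> c * T" using T0 mult_right_mono[of "3 * B" c T] mult_right_mono[of 1 c T] by (auto simp: c_def)
    have "norm (zeta (Complex \<sigma> t)) \<le> (K + exp B) * exp (c * T)"
    proof (cases "M \<le> exp (A * y)")
      case True
      obtain J where J: "(2 ^ J) powr (1 - \<sigma>) / (real J + 1) \<le> 2 * T" "M * (2 ^ J) powr (1 / 2 - \<sigma>) \<le> T" "2 ^ J \<le> 2 * (M * y)\<^sup>2"
        unfolding T_def by (rule euler_product_length[OF M(1) y1(1) assms(3,4)]) blast
      have "ln (t + H) + 1 \<le> 3 * exp y"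
      proof -
        have "t + H \<le> 2 * t" using tH by simp
        also have "\<dots> \<le> t * t" using t(3) by (intro mult_right_mono) auto
        finally have "ln (t + H) \<le> ln (t * t)" using t(3) H1 by (intro ln_mono) auto
        also have "\<dots> = 2 * ln t" using t(3) by (simp add: ln_mult)
        moreover have "exp y \<ge> 1" using y1(1) by simp
        ultimately show ?thesis using ey by linarith
      qed
      moreover have "ln (t + H) \<ge> 0" using t(3) H1 by (intro ln_ge_zero) auto
      ultimately have tr: "(ln (t + H) + 1) * (2 ^ J)\<^sup>2 * exp (- H\<^sup>2) \<le> 1"
        unfolding H_def using J(3) True by (intro truncation_term_le_1[OF C A0 M1 _ y1(1,3), of _ "2 ^ J"]) (auto simp: H_def)
      have "L * (2 ^ J) powr (1 / 2 - \<sigma>) \<le> T"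
        by (rule order_trans[OF mult_right_mono[OF M(2) powr_ge_zero] J(2)])
      hence "(2 ^ J) powr (1 - \<sigma>) / (real J + 1) + L * (2 ^ J) powr (1 / 2 - \<sigma>) +
         (ln (t + H) + 1) * (2 ^ J)\<^sup>2 * exp (- H\<^sup>2) \<le> 3 * T + 1"
        using J(1) tr by linarith
      hence "B * ((2 ^ J) powr (1 - \<sigma>) / (real J + 1) + L * (2 ^ J) powr (1 / 2 - \<sigma>) +
         (ln (t + H) + 1) * (2 ^ J)\<^sup>2 * exp (- H\<^sup>2)) \<le> B * (3 * T + 1)"
        using B(1) by (intro mult_left_mono) auto
      with B(2)[OF DF H1 tH(1) SL, of J] have "norm (F (Complex \<sigma> t)) \<le> B * (3 * T + 1)" by linarith
      hence "Re (F (Complex \<sigma> t)) \<le> B * (3 * T + 1)" using complex_Re_le_cmod order_trans by blast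
      also have "\<dots> \<le> B + c * T" using cT(1) by (simp add: algebra_simps)
      finally have "exp (Re (F (Complex \<sigma> t))) \<le> exp B * exp (c * T)" by (simp flip: exp_add)
      moreover have "Complex \<sigma> t \<in> zeta_strip" using assms(3) t(3) by (simp add: zeta_strip_def)
      hence "norm (zeta (Complex \<sigma> t)) = exp (Re (F (Complex \<sigma> t)))" using DFD(6) by (metis norm_exp_eq_Re)
      ultimately show ?thesis using K(1) by (simp add: distrib_right add_increasing)
    next
      case False
      \<comment> \<open>the maximum of \<open>zeta_S\<close> is so large that polynomial growth of \<open>\<zeta>\<close> suffices\<close>
      have "exp (2 * y) \<le> T"
      proof -
        have "exp (A * y) powr (2 - 2 * \<sigma>) \<le> M powr (2 - 2 * \<sigma>)" using False assms(4) by (intro powr_mono2) auto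
        moreover have "exp (A * y) powr (2 - 2 * \<sigma>) = exp (3 * y)"
          using assms(4) by (simp add: powr_def A_def)
        ultimately have 1: "exp (3 * y) \<le> M powr (2 - 2 * \<sigma>)" by simp
        have "exp (- y) \<le> y powr (- 1)"
        proof -
          have "y \<le> exp y" using exp_ge_add_one_self[of y] by linarith
          thus ?thesis using y1(1) by (simp add: exp_minus powr_minus field_simps)
        qed
        also have "y powr (- 1) \<le> y powr (1 - 2 * \<sigma>)" using y1(1) assms(4) by (intro powr_mono) auto
        finally have 2: "exp (- y) \<le> y powr (1 - 2 * \<sigma>)" .
        have "exp (2 * y) = exp (3 * y) * exp (- y)" by (simp flip: exp_add)
        also have "\<dots> \<le> T" unfolding T_def using 1 2 by (intro mult_mono) auto
        finally show ?thesis .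
      qed
      moreover have "2 * ln t \<le> exp (2 * y)"
      proof -
        have "2 \<le> exp y" using exp_ge_add_one_self[of y] y1(1) by linarith
        hence "2 * exp y \<le> exp y * exp y" by (intro mult_right_mono) auto
        thus ?thesis by (simp add: ey[symmetric] flip: exp_add)
      qed
      ultimately have "2 * ln t \<le> c * T" using cT(2) by linarith
      hence "exp (2 * ln t) \<le> exp (c * T)" by simp
      moreover have "exp (2 * ln t) = t\<^sup>2" using t(3) by (simp add: exp_double)
      ultimately have "t\<^sup>2 \<le> exp (c * T)" by simp
      hence "K * t\<^sup>2 \<le> K * exp (c * T)" using K(1) by (intro mult_left_mono) auto
      moreover have "norm (zeta (Complex \<sigma> t)) \<le> K * t\<^sup>2" using K(2)[of "Complex \<sigma> t"] assms(3,4) t(3) by simp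
      ultimately show ?thesis by (simp add: distrib_right add_increasing2)
    qed
    thus ?thesis unfolding RT .
  qed
  have "\<forall>\<^sub>F t in at_top. ln (ln t) \<ge> y0" by real_asymp
  moreover have "\<forall>\<^sub>F t in at_top. t - C * ln (ln t) \<ge> 3" using C by real_asymp
  moreover have "\<forall>\<^sub>F t in at_top. C * ln (ln t) \<le> t" using C by real_asymp
  moreover have "\<forall>\<^sub>F t in at_top. t \<ge> (3::real)" by (rule eventually_ge_at_top)
  ultimately have "\<forall>\<^sub>F t in at_top. norm (norm (zeta (Complex \<sigma> t))) \<le> (K + exp B) * norm (R t)"
    by eventually_elim (use bound in simp)
  hence "(\<lambda>t. norm (zeta (Complex \<sigma> t))) \<in> O[at_top](R)" by (rule bigoI)
  moreover have "c > 0" by (simp add: c_def)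
  ultimately show ?thesis unfolding R_def by blast
qed

end
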